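(* Let $\sigma:\Sigma\to\mathrm{Poly}^{\mathrm{int}}_{\mathrm{face}}$ and $\delta:\Delta\to\mathrm{Poly}^{\mathrm{int}}_{\mathrm{face}}$ be rational polyhedral complexes, let $\Phi=(\varphi,\{\Phi_\alpha\}_{\alpha\in\Sigma})$ be a morphism of polyhedral complexes from $\sigma$ to $\delta$, let $\varphi:\Sigma\to\Delta$ also denote the induced order-preserving map of face posets, let $|\Phi|:|\Sigma|\to|\Delta|$ be the topological realization of $\Phi$, and let $m_\varphi:\Sigma\to\mathbb{Z}_{\ge 1}$ be any map. Assume that for every $\alpha\in\Sigma$ the map $\varphi$ restricts to an isomorphism of posets from $\downarrow_\Sigma\alpha$ onto $\downarrow_\Delta\varphi(\alpha)$. Then: (1) The square formed by $\mathrm{poly}_\Sigma:|\Sigma|\to\Sigma$, $\varphi:\Sigma\to\Delta$, $|\Phi|:|\Sigma|\to|\Delta|$ and $\mathrm{poly}_\Delta:|\Delta|\to\Delta$ commutes, i.e. $\varphi\circ\mathrm{poly}_\Sigma=\mathrm{poly}_\Delta\circ|\Phi|$, and it is a fibre product square in the category of topological spaces (that is, $|\Sigma|$ together with $|\Phi|$ and $\mathrm{poly}_\Sigma$ is the fibre product $|\Delta|\times_\Delta\Sigma$ of $\mathrm{poly}_\Delta$ and $\varphi$). (2) If one of the pairs $(\varphi,m_\varphi)$ or $(|\Phi|,\,m_\varphi\circ\mathrm{poly}_\Sigma)$ is an indexed branched cover, then so is the other.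
   Context: Polyhedra. For a free abelian group $N$ of finite rank let $N_{\mathbb R}=N\otimes_{\mathbb Z}\mathbb R$. A rational polyhedron in $N_{\mathbb R}$ is an intersection of finitely many half-spaces $\{u\ge c\}$ with $u\in\mathrm{Hom}(N,\mathbb Z)$, $c\in\mathbb R$. An integrally affine map $N_{\mathbb R}\to N'_{\mathbb R}$ is an affine map sending $N$ into $N'$. We consider pairs $(N,\sigma)$ (abbreviated $\sigma$) where $\sigma\subset N_{\mathbb R}$ is a nonempty rational polyhedron containing no line, all of whose vertices lie in $N$, and with $N=N\cap\mathrm{aff}(\sigma)$ (so $\sigma$ is full-dimensional). A face morphism $f:(N',\tau)\to(N,\sigma)$ is an integrally affine map such that $f(\tau)$ is a face of $\sigma$ and $f$ maps $N'$ bijectively onto $N\cap\mathrm{aff}(f(\tau))$; it is proper if $f(\tau)$ is a proper face of $\sigma$. The pairs with face morphisms form the category $\mathrm{Poly}^{\mathrm{int}}_{\mathrm{face}}$. Polyhedral complexes. A rational polyhedral complex is a functor $\sigma:\Sigma\to\mathrm{Poly}^{\mathrm{int}}_{\mathrm{face}}$, $\alpha\mapsto(N^\alpha,\sigma_\alpha)$, from a finite category $\Sigma$ with $|\mathrm{Hom}_\Sigma(\alpha,\beta)|\le 1$ for all $\alpha,\beta$, such that: (a) for each $\alpha\in\Sigma$ and each proper face $\tau$ of $\sigma_\alpha$ there is a morphism $f:\beta\to\alpha$ in $\Sigma$ with $\sigma(f)(\sigma_\beta)=\tau$; (b) for all $g:\alpha\to\gamma$ and $h:\beta\to\gamma$ in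 $\Sigma$ with $\sigma(g),\sigma(h)$ proper, and every face morphism $f':\sigma_\alpha\to\sigma_\beta$ with $\sigma(h)\circ f'=\sigma(g)$, there is exactly one $f:\alpha\to\beta$ with $h\circ f=g$ and $\sigma(f)=f'$; (c) the only isomorphisms in $\Sigma$ are self-maps, and if $\sigma(f)$ is an isomorphism then so is $f$. The objects of $\Sigma$ form a finite poset, the face poset, with $\alpha\preceq\beta$ iff $\mathrm{Hom}_\Sigma(\alpha,\beta)\neq\varnothing$; it is also denoted $\Sigma$. Morphisms. A morphism $\Phi$ from $\sigma:\Sigma\to\mathrm{Poly}^{\mathrm{int}}_{\mathrm{face}}$ to $\delta:\Delta\to\mathrm{Poly}^{\mathrm{int}}_{\mathrm{face}}$ is a pair $(\varphi,\{\Phi_\alpha\}_{\alpha\in\Sigma})$ of a functor $\varphi:\Sigma\to\Delta$ and integrally affine maps $\Phi_\alpha:N^\alpha_{\mathbb R}\to N^{\varphi(\alpha)}_{\mathbb R}$ with $\Phi_\alpha(\sigma_\alpha)\subset\delta_{\varphi(\alpha)}$, natural in $\alpha$ (i.e. $\Phi_\beta\circ\sigma(f)=\delta(\varphi(f))\circ\Phi_\alpha$ on $\sigma_\alpha$ for every $f:\alpha\to\beta$), such that $\Phi_\alpha(\sigma_\alpha)$ is not contained in a proper face of $\delta_{\varphi(\alpha)}$. Topological realization. $|\Sigma|=\mathrm{colim}_{\alpha\in\Sigma}\sigma_\alpha$ in topological spaces (each $\sigma_\alpha$ with its Euclidean topology), with universal maps $p_\alpha:\sigma_\alpha\to|\Sigma|$.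 $|\Phi|$ is the continuous map with $|\Phi|\circ p_\alpha=p_{\varphi(\alpha)}\circ\Phi_\alpha$ for all $\alpha$. The map $\mathrm{poly}_\Sigma:|\Sigma|\to\Sigma$ is $x\mapsto\min\{\gamma\in\Sigma : x\in\mathrm{im}\,p_\gamma\}$ (this minimum exists). Posets. $\uparrow_\Sigma\alpha=\{\gamma:\alpha\le\gamma\}$, $\downarrow_\Sigma\alpha=\{\gamma:\gamma\le\alpha\}$. Posets carry the topology whose open sets are the up-closed sets. Indexed branched covers. A continuous map $F:X\to Y$ is a cover if every $y\in Y$ has a neighbourhood $U$ whose preimage is a disjoint union of copies of $U$ (each mapped homeomorphically to $U$). $F$ is a branched cover, with branch locus a closed set $B\subset Y$, if $Y\setminus B$ is open and dense and $F$ restricted to $F^{-1}(Y\setminus B)\to Y\setminus B$ is a cover. For $F$ with finite fibres, an index map $m_X:X\to\mathbb Z_{\ge1}$ and $V\subset X$ let $\deg(F,m_X,V)(y)=\sum_{x\in F^{-1}(y)\cap V}m_X(x)$ (empty sums are $0$). The pair $(F,m_X)$ is an indexed branched cover if $F$ is a branched cover (for some branch locus) and for every connected open $U\subset Y$ and every connected component $V$ of $F^{-1}(U)$ the function $\deg(F,m_X,V)$ is constant on $U$. *)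

theory Defs
  imports "HOL-Analysis.Analysis"
begin

section \<open>Categories and functors\<close>

record ('o, 'm) cat =
  Ob :: "'o set"
  Ar :: "'m set"
  src :: "'m \<Rightarrow> 'o"
  tgt :: "'m \<Rightarrow> 'o"
  ident :: "'o \<Rightarrow> 'm"
  cmp :: "'m \<Rightarrow> 'm \<Rightarrow> 'm"

definition hom_set :: "('o, 'm) cat \<Rightarrow> 'o \<Rightarrow> 'o \<Rightarrow> 'm set" where
  "hom_set C a b = {f \<in> Ar C. src C f = a \<and> tgt C f = b}"

text \<open>\<open>cmp C g f\<close> is the composite \<open>g \<circ> f\<close>, meaningful when \<open>tgt C f = src C g\<close>.\<close>

definition is_category :: "('o, 'm) cat \<Rightarrow> bool" where
  "is_category C \<longleftrightarrow>
     (\<forall>f \<in> Ar C. src C f \<in> Ob C \<and> tgt C f \<in> Ob C) \<and>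
     (\<forall>a \<in> Ob C. ident C a \<in> hom_set C a a) \<and>
     (\<forall>f \<in> Ar C. \<forall>g \<in> Ar C. tgt C f = src C g \<longrightarrow> cmp C g f \<in> hom_set C (src C f) (tgt C g)) \<and>
     (\<forall>f \<in> Ar C. cmp C f (ident C (src C f)) = f \<and> cmp C (ident C (tgt C f)) f = f) \<and>
     (\<forall>f \<in> Ar C. \<forall>g \<in> Ar C. \<forall>h \<in> Ar C. tgt C f = src C g \<and> tgt C g = src C h \<longrightarrow>
        cmp C h (cmp C g f) = cmp C (cmp C h g) f)"

definition is_iso :: "('o, 'm) cat \<Rightarrow> 'm \<Rightarrow> bool" where
  "is_iso C f \<longleftrightarrow> f \<in> Ar C \<and>
     (\<exists>g \<in> hom_set C (tgt C f) (src C f).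
        cmp C g f = ident C (src C f) \<and> cmp C f g = ident C (tgt C f))"

definition finite_thin_category :: "('o, 'm) cat \<Rightarrow> bool" where
  "finite_thin_category C \<longleftrightarrow> is_category C \<and> finite (Ob C) \<and> finite (Ar C) \<and>
     (\<forall>a \<in> Ob C. \<forall>b \<in> Ob C. card (hom_set C a b) \<le> 1)"

definition obj_le :: "('o, 'm) cat \<Rightarrow> 'o \<Rightarrow> 'o \<Rightarrow> bool" where
  "obj_le C a b \<longleftrightarrow> hom_set C a b \<noteq> {}"

definition down :: "('o, 'm) cat \<Rightarrow> 'o \<Rightarrow> 'o set" where
  "down C a = {c \<in> Ob C. obj_le C c a}"

record ('o, 'm, 'p, 'n) ftr =
  OMap :: "'o \<Rightarrow> 'p"
  AMap :: "'m \<Rightarrow> 'n"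

definition is_functor ::
    "('o, 'm) cat \<Rightarrow> ('p, 'n) cat \<Rightarrow> ('o, 'm, 'p, 'n) ftr \<Rightarrow> bool" where
  "is_functor C D F \<longleftrightarrow>
     (\<forall>a \<in> Ob C. OMap F a \<in> Ob D \<and> AMap F (ident C a) = ident D (OMap F a)) \<and>
     (\<forall>f \<in> Ar C. AMap F f \<in> hom_set D (OMap F (src C f)) (OMap F (tgt C f))) \<and>
     (\<forall>f \<in> Ar C. \<forall>g \<in> Ar C. tgt C f = src C g \<longrightarrow>
        AMap F (cmp C g f) = cmp D (AMap F g) (AMap F f))"


section \<open>Integral polyhedra and face morphisms\<close>

text \<open>
  A free abelian group \<open>N\<close> of finite rank is embedded in a Euclidean space as the
  \<open>\<int>\<close>-span of an \<open>\<real>\<close>-linearly independent set (of any size up to the dimension),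
  so that \<open>N \<otimes> \<real>\<close> is \<open>span N\<close>.
\<close>

definition is_lattice :: "'v::euclidean_space set \<Rightarrow> bool" where
  "is_lattice N \<longleftrightarrow> (\<exists>B. finite B \<and> independent B \<and>
     N = {(\<Sum>b\<in>B. of_int (k b) *\<^sub>R b) | k :: 'v \<Rightarrow> int. True})"

text \<open>Homomorphisms from \<open>N\<close> to \<open>\<int>\<close> are represented by linear extensions to the ambient space.\<close>

definition rational_polyhedron :: "'v::euclidean_space set \<Rightarrow> 'v set \<Rightarrow> bool" where
  "rational_polyhedron N P \<longleftrightarrow> (\<exists>H :: (('v \<Rightarrow> real) \<times> real) set. finite H \<and>
     (\<forall>(u, c) \<in> H. linear u \<and> u ` N \<subseteq> \<int>) \<and>
     P = {x \<in> span N. \<forall>(u, c) \<in> H. u x \<ge> c})"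

text \<open>The library's \<open>face_of\<close> also admits the empty set.\<close>

definition is_face :: "'v::euclidean_space set \<Rightarrow> 'v set \<Rightarrow> bool" where
  "is_face T P \<longleftrightarrow> T face_of P \<and> T \<noteq> {}"

definition is_proper_face :: "'v::euclidean_space set \<Rightarrow> 'v set \<Rightarrow> bool" where
  "is_proper_face T P \<longleftrightarrow> is_face T P \<and> T \<noteq> P"

definition contains_line :: "'v::real_vector set \<Rightarrow> bool" where
  "contains_line P \<longleftrightarrow> (\<exists>x d. d \<noteq> 0 \<and> (\<forall>t::real. x + t *\<^sub>R d \<in> P))"

definition integral_polyhedron :: "'v::euclidean_space set \<times> 'v set \<Rightarrow> bool" where
  "integral_polyhedron = (\<lambda>(N, P). is_lattice N \<and> rational_polyhedron N P \<and>
     P \<noteq> {} \<and> \<not> contains_line P \<and> (\<forall>v. v extreme_point_of P \<longrightarrow> v \<in> N) \<and>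
     N = N \<inter> affine hull P)"

text \<open>
  Maps between \<open>span N\<close> and \<open>span N'\<close> are taken extensional, so that equality of maps
  is equality of HOL functions.
\<close>

definition integrally_affine ::
    "'v::euclidean_space set \<Rightarrow> 'w::euclidean_space set \<Rightarrow> ('v \<Rightarrow> 'w) \<Rightarrow> bool" where
  "integrally_affine N N' f \<longleftrightarrow> f \<in> span N \<rightarrow>\<^sub>E span N' \<and>
     (\<exists>L b. linear L \<and> (\<forall>x \<in> span N. f x = L x + b)) \<and> f ` N \<subseteq> N'"

definition face_morphism ::
    "'v::euclidean_space set \<times> 'v set \<Rightarrow> 'v set \<times> 'v set \<Rightarrow> ('v \<Rightarrow> 'v) \<Rightarrow> bool" where
  "face_morphism = (\<lambda>(N', T) (N, P) f. integrally_affine N' N f \<and>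
     is_face (f ` T) P \<and> bij_betw f N' (N \<inter> affine hull (f ` T)))"

type_synonym 'v lpoly = "'v set \<times> 'v set"
type_synonym 'v lpoly_arrow = "'v lpoly \<times> ('v \<Rightarrow> 'v) \<times> 'v lpoly"

definition poly_face_cat :: "('v::euclidean_space lpoly, 'v lpoly_arrow) cat" where
  "poly_face_cat =
     \<lparr> Ob = {P. integral_polyhedron P},
       Ar = {(P, f, Q). integral_polyhedron P \<and> integral_polyhedron Q \<and> face_morphism P Q f},
       src = (\<lambda>(P, f, Q). P),
       tgt = (\<lambda>(P, f, Q). Q),
       ident = (\<lambda>P. (P, restrict id (span (fst P)), P)),
       cmp = (\<lambda>(Q, g, R) (P, f, Q'). (P, compose (span (fst P)) g f, R)) \<rparr>"


section \<open>Rational polyhedral complexes\<close>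

type_synonym ('o, 'm, 'v) poly_ftr = "('o, 'm, 'v lpoly, 'v lpoly_arrow) ftr"

abbreviation lat :: "('o, 'm, 'v::euclidean_space) poly_ftr \<Rightarrow> 'o \<Rightarrow> 'v set" where
  "lat \<sigma> a \<equiv> fst (OMap \<sigma> a)"

abbreviation cell :: "('o, 'm, 'v::euclidean_space) poly_ftr \<Rightarrow> 'o \<Rightarrow> 'v set" where
  "cell \<sigma> a \<equiv> snd (OMap \<sigma> a)"

abbreviation cell_map :: "('o, 'm, 'v::euclidean_space) poly_ftr \<Rightarrow> 'm \<Rightarrow> 'v \<Rightarrow> 'v" where
  "cell_map \<sigma> f \<equiv> fst (snd (AMap \<sigma> f))"

definition proper_arrow ::
    "('o, 'm) cat \<Rightarrow> ('o, 'm, 'v::euclidean_space) poly_ftr \<Rightarrow> 'm \<Rightarrow> bool" where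
  "proper_arrow C \<sigma> f \<longleftrightarrow> is_proper_face (cell_map \<sigma> f ` cell \<sigma> (src C f)) (cell \<sigma> (tgt C f))"

definition polyhedral_complex ::
    "('o, 'm) cat \<Rightarrow> ('o, 'm, 'v::euclidean_space) poly_ftr \<Rightarrow> bool" where
  "polyhedral_complex C \<sigma> \<longleftrightarrow>
     finite_thin_category C \<and> is_functor C poly_face_cat \<sigma> \<and>
     (\<forall>a \<in> Ob C. \<forall>T. is_proper_face T (cell \<sigma> a) \<longrightarrow>
        (\<exists>f \<in> Ar C. tgt C f = a \<and> cell_map \<sigma> f ` cell \<sigma> (src C f) = T)) \<and>
     (\<forall>g \<in> Ar C. \<forall>h \<in> Ar C.
        tgt C g = tgt C h \<and> proper_arrow C \<sigma> g \<and> proper_arrow C \<sigma> h \<longrightarrow>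
        (\<forall>f' \<in> hom_set poly_face_cat (OMap \<sigma> (src C g)) (OMap \<sigma> (src C h)).
           cmp poly_face_cat (AMap \<sigma> h) f' = AMap \<sigma> g \<longrightarrow>
           (\<exists>!f. f \<in> hom_set C (src C g) (src C h) \<and> cmp C h f = g \<and> AMap \<sigma> f = f'))) \<and>
     (\<forall>f. is_iso C f \<longrightarrow> src C f = tgt C f) \<and>
     (\<forall>f \<in> Ar C. is_iso poly_face_cat (AMap \<sigma> f) \<longrightarrow> is_iso C f)"

definition complex_morphism ::
    "('o, 'm) cat \<Rightarrow> ('o, 'm, 'v::euclidean_space) poly_ftr \<Rightarrow>
     ('p, 'n) cat \<Rightarrow> ('p, 'n, 'w::euclidean_space) poly_ftr \<Rightarrow>
     ('o, 'm, 'p, 'n) ftr \<Rightarrow> ('o \<Rightarrow> 'v \<Rightarrow> 'w) \<Rightarrow> bool" where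
  "complex_morphism C \<sigma> D \<delta> \<phi> \<Phi> \<longleftrightarrow>
     is_functor C D \<phi> \<and>
     (\<forall>a \<in> Ob C. integrally_affine (lat \<sigma> a) (lat \<delta> (OMap \<phi> a)) (\<Phi> a) \<and>
        \<Phi> a ` cell \<sigma> a \<subseteq> cell \<delta> (OMap \<phi> a)) \<and>
     (\<forall>f \<in> Ar C. \<forall>x \<in> cell \<sigma> (src C f).
        \<Phi> (tgt C f) (cell_map \<sigma> f x) = cell_map \<delta> (AMap \<phi> f) (\<Phi> (src C f) x)) \<and>
     (\<forall>a \<in> Ob C. \<not> (\<exists>T. is_proper_face T (cell \<delta> (OMap \<phi> a)) \<and> \<Phi> a ` cell \<sigma> a \<subseteq> T))"


section \<open>Topological realization\<close>

definition quotient_topology :: "'a topology \<Rightarrow> ('a \<times> 'a) set \<Rightarrow> 'a set topology" where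
  "quotient_topology X R =
     topology (\<lambda>U. U \<subseteq> topspace X // R \<and> openin X {x \<in> topspace X. R `` {x} \<in> U})"

lemma openin_quotient_topology:
  "openin (quotient_topology X R) U \<longleftrightarrow>
     U \<subseteq> topspace X // R \<and> openin X {x \<in> topspace X. R `` {x} \<in> U}"
proof -
  have "istopology (\<lambda>U. U \<subseteq> topspace X // R \<and> openin X {x \<in> topspace X. R `` {x} \<in> U})"
    unfolding istopology_def
  proof (intro conjI allI impI)
    fix S T
    assume S: "S \<subseteq> topspace X // R \<and> openin X {x \<in> topspace X. R `` {x} \<in> S}"
      and T: "T \<subseteq> topspace X // R \<and> openin X {x \<in> topspace X. R `` {x} \<in> T}"
    have "{x \<in> topspace X. R `` {x} \<in> S \<inter> T} =
        {x \<in> topspace X. R `` {x} \<in> S} \<inter> {x \<in> topspace X. R `` {x} \<in> T}"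
      by blast
    then show "openin X {x \<in> topspace X. R `` {x} \<in> S \<inter> T}"
      using S T by (simp add: openin_Int)
    show "S \<inter> T \<subseteq> topspace X // R" using S by blast
  next
    fix \<K>
    assume K: "\<forall>K\<in>\<K>. K \<subseteq> topspace X // R \<and> openin X {x \<in> topspace X. R `` {x} \<in> K}"
    have "{x \<in> topspace X. R `` {x} \<in> \<Union>\<K>} = (\<Union>K\<in>\<K>. {x \<in> topspace X. R `` {x} \<in> K})"
      by blast
    then show "openin X {x \<in> topspace X. R `` {x} \<in> \<Union>\<K>}"
      using K by (auto intro!: openin_Union)
    show "\<Union>\<K> \<subseteq> topspace X // R" using K by blast
  qed
  then show ?thesis
    by (simp add: quotient_topology_def)
qed

lemma topspace_quotient_topology [simp]:
  "topspace (quotient_topology X R) = topspace X // R"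
proof (rule antisym)
  have "{x \<in> topspace X. R `` {x} \<in> topspace X // R} = topspace X"
    by (auto simp: quotientI)
  then have "openin (quotient_topology X R) (topspace X // R)"
    by (simp add: openin_quotient_topology)
  then show "topspace X // R \<subseteq> topspace (quotient_topology X R)"
    by (rule openin_subset)
  show "topspace (quotient_topology X R) \<subseteq> topspace X // R"
    using openin_topspace[of "quotient_topology X R"] by (simp only: openin_quotient_topology)
qed

lemma quotient_map_quotient_topology:
  "quotient_map X (quotient_topology X R) (\<lambda>x. R `` {x})"
  unfolding quotient_map_def by (auto simp: openin_quotient_topology quotient_def)

definition cell_sum ::
    "('o, 'm) cat \<Rightarrow> ('o, 'm, 'v::euclidean_space) poly_ftr \<Rightarrow> ('o \<times> 'v) topology" where
  "cell_sum C \<sigma> = sum_topology (\<lambda>a. top_of_set (cell \<sigma> a)) (Ob C)"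

definition glue ::
    "('o, 'm) cat \<Rightarrow> ('o, 'm, 'v::euclidean_space) poly_ftr \<Rightarrow> (('o \<times> 'v) \<times> ('o \<times> 'v)) set" where
  "glue C \<sigma> = {((src C f, x), (tgt C f, cell_map \<sigma> f x)) | f x. f \<in> Ar C \<and> x \<in> cell \<sigma> (src C f)}"

definition glue_equiv ::
    "('o, 'm) cat \<Rightarrow> ('o, 'm, 'v::euclidean_space) poly_ftr \<Rightarrow> (('o \<times> 'v) \<times> ('o \<times> 'v)) set" where
  "glue_equiv C \<sigma> = Restr ((glue C \<sigma> \<union> (glue C \<sigma>)\<inverse>)\<^sup>*) (topspace (cell_sum C \<sigma>))"

text \<open>
  The colimit of topological spaces is the disjoint union of the cells modulo the equivalence
  relation generated by the gluing maps; \<open>real_inj C \<sigma> a\<close> is the universal map \<open>p\<^sub>a\<close>.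
\<close>

definition realization ::
    "('o, 'm) cat \<Rightarrow> ('o, 'm, 'v::euclidean_space) poly_ftr \<Rightarrow> ('o \<times> 'v) set topology" where
  "realization C \<sigma> = quotient_topology (cell_sum C \<sigma>) (glue_equiv C \<sigma>)"

definition real_inj ::
    "('o, 'm) cat \<Rightarrow> ('o, 'm, 'v::euclidean_space) poly_ftr \<Rightarrow> 'o \<Rightarrow> 'v \<Rightarrow> ('o \<times> 'v) set" where
  "real_inj C \<sigma> a x = glue_equiv C \<sigma> `` {(a, x)}"

lemma topspace_cell_sum: "topspace (cell_sum C \<sigma>) = Sigma (Ob C) (cell \<sigma>)"
  by (auto simp: cell_sum_def)

lemma equiv_glue_equiv: "equiv (topspace (cell_sum C \<sigma>)) (glue_equiv C \<sigma>)"
proof -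
  have "sym ((glue C \<sigma> \<union> (glue C \<sigma>)\<inverse>)\<^sup>*)"
    by (simp add: sym_Un_converse sym_rtrancl)
  then show ?thesis
    unfolding glue_equiv_def
    by (intro equivI refl_onI symI transI) (auto dest: symD intro: rtrancl_trans)
qed

lemma realization_universal_property:
  fixes \<sigma> :: "('o, 'm, 'v::euclidean_space) poly_ftr" and q :: "'o \<Rightarrow> 'v \<Rightarrow> 't"
  assumes cont: "\<And>a. a \<in> Ob C \<Longrightarrow> continuous_map (top_of_set (cell \<sigma> a)) T (q a)"
    and compat: "\<And>f x. f \<in> Ar C \<Longrightarrow> x \<in> cell \<sigma> (src C f) \<Longrightarrow>
      q (tgt C f) (cell_map \<sigma> f x) = q (src C f) x"
  shows "\<exists>!F. F \<in> extensional (topspace (realization C \<sigma>)) \<and>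
    continuous_map (realization C \<sigma>) T F \<and>
    (\<forall>a \<in> Ob C. \<forall>x \<in> cell \<sigma> a. F (real_inj C \<sigma> a x) = q a x)"
proof -
  let ?X = "cell_sum C \<sigma>" and ?p = "\<lambda>z. glue_equiv C \<sigma> `` {z}" and ?q = "\<lambda>z. q (fst z) (snd z)"
  have qm: "quotient_map ?X (realization C \<sigma>) ?p"
    unfolding realization_def by (rule quotient_map_quotient_topology)
  have qc: "continuous_map ?X T ?q"
    unfolding continuous_map topspace_cell_sum
  proof (intro conjI allI impI)
    show "?q ` Sigma (Ob C) (cell \<sigma>) \<subseteq> topspace T"
      using cont by (fastforce simp: continuous_map_def)
    fix U assume "openin T U"
    then have "\<forall>a \<in> Ob C. openin (top_of_set (cell \<sigma> a)) {x \<in> cell \<sigma> a. q a x \<in> U}"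
      using cont by (auto simp: continuous_map_def)
    moreover have "{x. (a, x) \<in> {z \<in> Sigma (Ob C) (cell \<sigma>). ?q z \<in> U}} = {x \<in> cell \<sigma> a. q a x \<in> U}"
      if "a \<in> Ob C" for a using that by auto
    ultimately show "openin ?X {z \<in> Sigma (Ob C) (cell \<sigma>). ?q z \<in> U}"
      unfolding cell_sum_def openin_sum_topology by auto
  qed
  have "?q z = ?q w" if "(z, w) \<in> (glue C \<sigma> \<union> (glue C \<sigma>)\<inverse>)\<^sup>*" for z w
    using that by (induction rule: rtrancl_induct) (auto simp: glue_def compat)
  then have rel: "?q z = ?q w" if "(z, w) \<in> glue_equiv C \<sigma>" for z w
    using that unfolding glue_equiv_def by blast
  have inv: "?q z = ?q w" if "z \<in> topspace ?X" "w \<in> topspace ?X" "?p z = ?p w" for z w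
    using rel eq_equiv_class[OF that(3) equiv_glue_equiv that(2)] by blast
  obtain G where G: "continuous_map (realization C \<sigma>) T G"
      "\<And>z. z \<in> topspace ?X \<Longrightarrow> G (?p z) = ?q z"
  proof (rule quotient_map_lift_exists[OF qm qc])
    show "?q z = ?q w" if "z \<in> topspace ?X" "w \<in> topspace ?X" "?p z = ?p w" for z w
      using inv that by blast
  qed (use that in blast)
  have top: "topspace (realization C \<sigma>) = ?p ` topspace ?X"
    using qm by (auto simp: quotient_map_def)
  show ?thesis
  proof (rule ex1I[of _ "restrict G (topspace (realization C \<sigma>))"], intro conjI ballI)
    show "continuous_map (realization C \<sigma>) T (restrict G (topspace (realization C \<sigma>)))"
      using G(1) by (simp add: continuous_map_eq)
    fix a x assume "a \<in> Ob C" "x \<in> cell \<sigma> a"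
    then have "(a, x) \<in> topspace ?X" by (simp add: topspace_cell_sum)
    then show "restrict G (topspace (realization C \<sigma>)) (real_inj C \<sigma> a x) = q a x"
      using G(2)[of "(a, x)"] top by (auto simp: real_inj_def)
  next
    fix F
    assume F: "F \<in> extensional (topspace (realization C \<sigma>)) \<and>
      continuous_map (realization C \<sigma>) T F \<and>
      (\<forall>a \<in> Ob C. \<forall>x \<in> cell \<sigma> a. F (real_inj C \<sigma> a x) = q a x)"
    show "F = restrict G (topspace (realization C \<sigma>))"
    proof (rule extensionalityI)
      fix c assume "c \<in> topspace (realization C \<sigma>)"
      then obtain z where "z \<in> topspace ?X" "c = ?p z" using top by blast
      then show "F c = restrict G (topspace (realization C \<sigma>)) c"
        using F G(2)[of z] \<open>c \<in> topspace (realization C \<sigma>)\<close>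
        by (cases z) (auto simp: topspace_cell_sum real_inj_def)
    qed (use F in auto)
  qed auto
qed

lemma continuous_map_real_inj:
  assumes "a \<in> Ob C"
  shows "continuous_map (top_of_set (cell \<sigma> a)) (realization C \<sigma>) (real_inj C \<sigma> a)"
proof -
  have "continuous_map (top_of_set (cell \<sigma> a)) (cell_sum C \<sigma>) (\<lambda>x. (a, x))"
    unfolding cell_sum_def using assms by (rule continuous_map_component_injection)
  moreover have "continuous_map (cell_sum C \<sigma>) (realization C \<sigma>) (\<lambda>z. glue_equiv C \<sigma> `` {z})"
    unfolding realization_def by (rule quotient_imp_continuous_map[OF quotient_map_quotient_topology])
  ultimately have "continuous_map (top_of_set (cell \<sigma> a)) (realization C \<sigma>)
      ((\<lambda>z. glue_equiv C \<sigma> `` {z}) \<circ> (\<lambda>x. (a, x)))"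
    by (rule continuous_map_compose)
  moreover have "(\<lambda>z. glue_equiv C \<sigma> `` {z}) \<circ> (\<lambda>x. (a, x)) = real_inj C \<sigma> a"
    by (simp add: fun_eq_iff real_inj_def)
  ultimately show ?thesis by simp
qed

definition real_map ::
    "('o, 'm) cat \<Rightarrow> ('o, 'm, 'v::euclidean_space) poly_ftr \<Rightarrow>
     ('p, 'n) cat \<Rightarrow> ('p, 'n, 'w::euclidean_space) poly_ftr \<Rightarrow>
     ('o, 'm, 'p, 'n) ftr \<Rightarrow> ('o \<Rightarrow> 'v \<Rightarrow> 'w) \<Rightarrow> ('o \<times> 'v) set \<Rightarrow> ('p \<times> 'w) set" where
  "real_map C \<sigma> D \<delta> \<phi> \<Phi> =
     (THE F. F \<in> extensional (topspace (realization C \<sigma>)) \<and>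
        continuous_map (realization C \<sigma>) (realization D \<delta>) F \<and>
        (\<forall>a \<in> Ob C. \<forall>x \<in> cell \<sigma> a.
           F (real_inj C \<sigma> a x) = real_inj D \<delta> (OMap \<phi> a) (\<Phi> a x)))"

lemma cell_map_in_cell:
  assumes "is_functor C poly_face_cat \<sigma>" "f \<in> Ar C" "x \<in> cell \<sigma> (src C f)"
  shows "cell_map \<sigma> f x \<in> cell \<sigma> (tgt C f)"
proof -
  have "AMap \<sigma> f \<in> hom_set poly_face_cat (OMap \<sigma> (src C f)) (OMap \<sigma> (tgt C f))"
    using assms unfolding is_functor_def by blast
  then have "cell_map \<sigma> f ` cell \<sigma> (src C f) face_of cell \<sigma> (tgt C f)"
    by (auto simp: hom_set_def poly_face_cat_def face_morphism_def is_face_def split: prod.splits)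
  then show ?thesis
    using assms(3) face_of_imp_subset by blast
qed

lemma real_inj_cell_map:
  assumes C: "is_category C" and \<sigma>: "is_functor C poly_face_cat \<sigma>"
    and f: "f \<in> Ar C" and x: "x \<in> cell \<sigma> (src C f)"
  shows "real_inj C \<sigma> (tgt C f) (cell_map \<sigma> f x) = real_inj C \<sigma> (src C f) x"
proof -
  have "src C f \<in> Ob C" "tgt C f \<in> Ob C"
    using C f unfolding is_category_def by blast+
  moreover have "((src C f, x), (tgt C f, cell_map \<sigma> f x)) \<in> glue C \<sigma>"
    using f x by (auto simp: glue_def)
  ultimately have "((src C f, x), (tgt C f, cell_map \<sigma> f x)) \<in> glue_equiv C \<sigma>"
    using x cell_map_in_cell[OF \<sigma> f x]
    by (simp add: glue_equiv_def topspace_cell_sum r_into_rtrancl)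
  then show ?thesis
    unfolding real_inj_def by (rule equiv_class_eq[OF equiv_glue_equiv, symmetric])
qed

lemma real_map_unique_existence:
  assumes C: "polyhedral_complex C \<sigma>" and D: "polyhedral_complex D \<delta>"
    and \<Phi>: "complex_morphism C \<sigma> D \<delta> \<phi> \<Phi>"
  shows "\<exists>!F. F \<in> extensional (topspace (realization C \<sigma>)) \<and>
    continuous_map (realization C \<sigma>) (realization D \<delta>) F \<and>
    (\<forall>a \<in> Ob C. \<forall>x \<in> cell \<sigma> a. F (real_inj C \<sigma> a x) = real_inj D \<delta> (OMap \<phi> a) (\<Phi> a x))"
proof (rule realization_universal_property)
  have cat: "is_category C" "is_category D" "is_functor D poly_face_cat \<delta>"
    "is_functor C poly_face_cat \<sigma>"
    using C D by (simp_all add: polyhedral_complex_def finite_thin_category_def)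
  have \<phi>: "is_functor C D \<phi>"
    using \<Phi> by (simp add: complex_morphism_def)
  fix a assume a: "a \<in> Ob C"
  have \<Phi>a: "integrally_affine (lat \<sigma> a) (lat \<delta> (OMap \<phi> a)) (\<Phi> a)"
    "\<Phi> a ` cell \<sigma> a \<subseteq> cell \<delta> (OMap \<phi> a)"
    using \<Phi> a by (simp_all add: complex_morphism_def)
  have "OMap \<sigma> a \<in> Ob poly_face_cat"
    using cat(4) a by (simp add: is_functor_def)
  then have "rational_polyhedron (lat \<sigma> a) (cell \<sigma> a)"
    by (auto simp: poly_face_cat_def integral_polyhedron_def split: prod.splits)
  then have sub: "cell \<sigma> a \<subseteq> span (lat \<sigma> a)"
    by (auto simp: rational_polyhedron_def)
  obtain L b where L: "linear L" and Lb: "\<forall>x \<in> span (lat \<sigma> a). \<Phi> a x = L x + b"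
    using \<Phi>a(1) by (auto simp: integrally_affine_def)
  have "continuous_on (cell \<sigma> a) (\<lambda>x. L x + b)"
    using L by (intro continuous_intros linear_continuous_on linear_conv_bounded_linear[THEN iffD1])
  then have "continuous_on (cell \<sigma> a) (\<Phi> a)"
    by (rule continuous_on_eq) (use Lb sub in auto)
  then have "continuous_map (top_of_set (cell \<sigma> a)) (top_of_set (cell \<delta> (OMap \<phi> a))) (\<Phi> a)"
    using \<Phi>a(2) by (auto simp: continuous_map_in_subtopology)
  moreover have "OMap \<phi> a \<in> Ob D"
    using \<phi> a by (simp add: is_functor_def)
  ultimately have "continuous_map (top_of_set (cell \<sigma> a)) (realization D \<delta>)
      (real_inj D \<delta> (OMap \<phi> a) \<circ> \<Phi> a)"
    by (meson continuous_map_compose continuous_map_real_inj)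
  then show "continuous_map (top_of_set (cell \<sigma> a)) (realization D \<delta>)
      (\<lambda>x. real_inj D \<delta> (OMap \<phi> a) (\<Phi> a x))"
    by (simp add: o_def)
next
  have cat: "is_category C" "is_category D" "is_functor D poly_face_cat \<delta>"
    using C D by (simp_all add: polyhedral_complex_def finite_thin_category_def)
  fix f x assume f: "f \<in> Ar C" and x: "x \<in> cell \<sigma> (src C f)"
  have "AMap \<phi> f \<in> hom_set D (OMap \<phi> (src C f)) (OMap \<phi> (tgt C f))"
    using \<Phi> f by (simp add: complex_morphism_def is_functor_def)
  then have \<phi>f: "AMap \<phi> f \<in> Ar D" "src D (AMap \<phi> f) = OMap \<phi> (src C f)"
    "tgt D (AMap \<phi> f) = OMap \<phi> (tgt C f)"
    by (simp_all add: hom_set_def)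
  have "src C f \<in> Ob C"
    using cat(1) f by (simp add: is_category_def)
  then have "\<Phi> (src C f) x \<in> cell \<delta> (OMap \<phi> (src C f))"
    using \<Phi> x by (auto simp: complex_morphism_def)
  then have "real_inj D \<delta> (OMap \<phi> (tgt C f)) (cell_map \<delta> (AMap \<phi> f) (\<Phi> (src C f) x)) =
      real_inj D \<delta> (OMap \<phi> (src C f)) (\<Phi> (src C f) x)"
    using real_inj_cell_map[OF cat(2,3) \<phi>f(1)] \<phi>f(2,3) by simp
  then show "real_inj D \<delta> (OMap \<phi> (tgt C f)) (\<Phi> (tgt C f) (cell_map \<sigma> f x)) =
      real_inj D \<delta> (OMap \<phi> (src C f)) (\<Phi> (src C f) x)"
    using \<Phi> f x by (simp add: complex_morphism_def)
qed

definition poly_map ::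
    "('o, 'm) cat \<Rightarrow> ('o, 'm, 'v::euclidean_space) poly_ftr \<Rightarrow> ('o \<times> 'v) set \<Rightarrow> 'o" where
  "poly_map C \<sigma> x =
     (THE c. c \<in> Ob C \<and> x \<in> real_inj C \<sigma> c ` cell \<sigma> c \<and>
        (\<forall>c' \<in> Ob C. x \<in> real_inj C \<sigma> c' ` cell \<sigma> c' \<longrightarrow> obj_le C c c'))"

definition poset_topology :: "('o, 'm) cat \<Rightarrow> 'o topology" where
  "poset_topology C =
     topology (\<lambda>U. U \<subseteq> Ob C \<and> (\<forall>a \<in> U. \<forall>b \<in> Ob C. obj_le C a b \<longrightarrow> b \<in> U))"

lemma openin_poset_topology:
  "openin (poset_topology C) U \<longleftrightarrow>
     U \<subseteq> Ob C \<and> (\<forall>a \<in> U. \<forall>b \<in> Ob C. obj_le C a b \<longrightarrow> b \<in> U)"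
proof -
  have "istopology (\<lambda>U. U \<subseteq> Ob C \<and> (\<forall>a \<in> U. \<forall>b \<in> Ob C. obj_le C a b \<longrightarrow> b \<in> U))"
    unfolding istopology_def
  proof (intro conjI allI impI ballI)
    fix \<K>
    assume K: "\<forall>K\<in>\<K>. K \<subseteq> Ob C \<and> (\<forall>a\<in>K. \<forall>b\<in>Ob C. obj_le C a b \<longrightarrow> b \<in> K)"
    show "\<Union>\<K> \<subseteq> Ob C"
      using K by (simp add: Sup_le_iff)
    show "b \<in> \<Union>\<K>" if "a \<in> \<Union>\<K>" "b \<in> Ob C" "obj_le C a b" for a b
    proof -
      from that(1) obtain K' where "K' \<in> \<K>" "a \<in> K'" by (rule UnionE)
      then show ?thesis using K that(2,3) by (intro UnionI[of K']) simp_all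
    qed
  qed auto
  then show ?thesis
    by (simp add: poset_topology_def)
qed

definition poset_iso_on_down ::
    "('o, 'm) cat \<Rightarrow> ('p, 'n) cat \<Rightarrow> ('o \<Rightarrow> 'p) \<Rightarrow> 'o \<Rightarrow> bool" where
  "poset_iso_on_down C D h a \<longleftrightarrow>
     bij_betw h (down C a) (down D (h a)) \<and>
     (\<forall>x \<in> down C a. \<forall>y \<in> down C a. obj_le C x y \<longleftrightarrow> obj_le D (h x) (h y))"


section \<open>Fibre products and indexed branched covers\<close>

text \<open>
  \<open>P\<close> with the maps \<open>f : P \<rightarrow> A\<close> and \<open>g : P \<rightarrow> B\<close> is the fibre product of \<open>h : A \<rightarrow> Z\<close>
  and \<open>k : B \<rightarrow> Z\<close>.
\<close>

definition fibre_product_square ::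
    "'p topology \<Rightarrow> 'a topology \<Rightarrow> 'b topology \<Rightarrow> 'z topology \<Rightarrow>
     ('p \<Rightarrow> 'a) \<Rightarrow> ('p \<Rightarrow> 'b) \<Rightarrow> ('a \<Rightarrow> 'z) \<Rightarrow> ('b \<Rightarrow> 'z) \<Rightarrow> bool" where
  "fibre_product_square P A B Z f g h k \<longleftrightarrow>
     continuous_map P A f \<and> continuous_map P B g \<and>
     continuous_map A Z h \<and> continuous_map B Z k \<and>
     (\<forall>x \<in> topspace P. h (f x) = k (g x)) \<and>
     homeomorphic_map P
       (subtopology (prod_topology A B) {(a, b). h a = k b}) (\<lambda>x. (f x, g x))"

definition is_cover :: "'a topology \<Rightarrow> 'b topology \<Rightarrow> ('a \<Rightarrow> 'b) \<Rightarrow> bool" where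
  "is_cover X Y F \<longleftrightarrow> continuous_map X Y F \<and>
     (\<forall>y \<in> topspace Y. \<exists>U \<V>. openin Y U \<and> y \<in> U \<and>
        \<Union>\<V> = {x \<in> topspace X. F x \<in> U} \<and> pairwise disjnt \<V> \<and>
        (\<forall>V \<in> \<V>. openin X V \<and> homeomorphic_map (subtopology X V) (subtopology Y U) F))"

definition is_branched_cover :: "'a topology \<Rightarrow> 'b topology \<Rightarrow> ('a \<Rightarrow> 'b) \<Rightarrow> 'b set \<Rightarrow> bool" where
  "is_branched_cover X Y F B \<longleftrightarrow> continuous_map X Y F \<and>
     closedin Y B \<and> Y closure_of (topspace Y - B) = topspace Y \<and>
     is_cover (subtopology X {x \<in> topspace X. F x \<in> topspace Y - B})
       (subtopology Y (topspace Y - B)) F"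

definition fibre_deg :: "('a \<Rightarrow> 'b) \<Rightarrow> ('a \<Rightarrow> nat) \<Rightarrow> 'a set \<Rightarrow> 'b \<Rightarrow> nat" where
  "fibre_deg F m V y = (\<Sum>x | x \<in> V \<and> F x = y. m x)"

definition indexed_branched_cover ::
    "'a topology \<Rightarrow> 'b topology \<Rightarrow> ('a \<Rightarrow> 'b) \<Rightarrow> ('a \<Rightarrow> nat) \<Rightarrow> bool" where
  "indexed_branched_cover X Y F m \<longleftrightarrow>
     (\<exists>B. is_branched_cover X Y F B) \<and>
     (\<forall>y \<in> topspace Y. finite {x \<in> topspace X. F x = y}) \<and>
     (\<forall>x \<in> topspace X. m x \<ge> 1) \<and>
     (\<forall>U V. openin Y U \<and> connectedin Y U \<and>
        V \<in> connected_components_of (subtopology X {x \<in> topspace X. F x \<in> U}) \<longrightarrow>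
        (\<exists>d. \<forall>y \<in> U. fibre_deg F m V y = d))"

end

theory Submission
  imports Defs
begin

text \<open>
  The face poset of a polyhedral complex controls its realization: arrows into \<open>a\<close> correspond to
  the faces of the cell of \<open>a\<close> (\<open>arrow_eq_if_same_face\<close>), so the realization is the disjoint
  union of the relative interiors of the cells (\<open>point_exists\<close>, \<open>real_inj_carrier\<close>), cells
  are closed and embedded, and \<open>poly_map\<close> names the stratum of a point. That face
  morphisms are injective on real points, not only on lattice points, uses the
  discreteness of lattices (\<open>lattice_injective_imp_span_injective\<close>).

  Let \<open>\<phi>\<close> be an isomorphism from each lower interval onto a lower interval. Then every
  \<open>\<Phi> a\<close> is an affine bijection from the cell of \<open>a\<close> onto the cell of \<open>\<phi> a\<close> that
  preserves the faces. It maps relative interior to relative interior because its image lies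
  in no proper face, and boundary to boundary because \<open>\<phi>\<close> is injective on faces
  (\<open>Phi_rint_iff\<close>). Since every line leaves the cell, this forces injectivity
  (\<open>Phi_inj\<close>); surjectivity follows by induction over the faces (\<open>Phi_surj\<close>).
  Hence the map of realizations carries the stratum of \<open>a\<close> bijectively onto the stratum of \<open>\<phi> a\<close>, so a point of the source is determined by its image and its
  stratum: this is the fibre product as a set. It is the fibre product as a space because a
  neighbourhood in the target can be found by deleting finitely many closed images of
  parts of cells (\<open>F_open_nbhd\<close>).

  For the indexed branched covers, the maps of posets and of realizations are always branched
  covers with finite fibres, branched at most outside the maximal strata. Only the degree
  condition has content, and on both sides it is equivalent to the same combinatorial
  condition \<open>balanced\<close> on the index map: for \<open>b \<ge> \<phi> a\<close>, the indices of the elements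
  above \<open>a\<close> and over \<open>b\<close> add up to the index of \<open>a\<close>. Testing the degree on open stars
  gives balancing. Conversely, balancing makes degrees agree along segments that run into the
  relative interior of a cell (comparable elements, for posets), hence makes them locally
  constant, hence constant on connected open sets.
\<close>

section \<open>Lattices\<close>

lemma lattice_zero: "is_lattice N \<Longrightarrow> 0 \<in> N"
  unfolding is_lattice_def by (auto intro!: exI[of _ "\<lambda>_. 0"])

lemma lattice_diff:
  assumes "is_lattice N" "x \<in> N" "y \<in> N" shows "x - y \<in> N"
proof -
  obtain B where B: "N = {(\<Sum>b\<in>B. of_int (k b) *\<^sub>R b) | k. True}"
    using assms(1) unfolding is_lattice_def by blast
  obtain k l where "x = (\<Sum>b\<in>B. of_int (k b) *\<^sub>R b)" "y = (\<Sum>b\<in>B. of_int (l b) *\<^sub>R b)"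
    using assms(2,3) B by blast
  then have "x - y = (\<Sum>b\<in>B. of_int (k b - l b) *\<^sub>R b)"
    by (simp add: sum_subtractf scaleR_diff_left)
  then show ?thesis
    unfolding B by (intro CollectI exI[of _ "\<lambda>b. k b - l b"]) simp
qed

text \<open>Coordinates with respect to a lattice basis are linear functionals, hence bounded on bounded
  sets.\<close>

lemma lattice_bounded_finite:
  fixes N :: "'v::euclidean_space set"
  assumes "is_lattice N"
  shows "finite {x \<in> N. norm x \<le> r}"
proof -
  obtain B :: "'v set" where B: "finite B" "independent B"
      "N = {(\<Sum>b\<in>B. of_int (k b) *\<^sub>R b) | k. True}"
    using assms unfolding is_lattice_def by blast
  have "\<exists>g. linear g \<and> (\<forall>c\<in>B. g c = (if c = b then 1 else (0::real)))" for b
    using linear_independent_extend[OF B(2), of "\<lambda>c. if c = b then 1 else 0"] by metis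
  then obtain g where g: "\<And>b. linear (g b)" "\<And>b c. c \<in> B \<Longrightarrow> g b c = (if c = b then 1 else (0::real))"
    by metis
  have g_sum: "g b (\<Sum>c\<in>B. of_int (k c) *\<^sub>R c) = of_int (k b)" if "b \<in> B" for b k
  proof -
    have "g b (\<Sum>c\<in>B. of_int (k c) *\<^sub>R c) = (\<Sum>c\<in>B. of_int (k c) * g b c)"
      by (simp add: linear_sum[OF g(1)] linear_cmul[OF g(1)])
    also have "\<dots> = (\<Sum>c\<in>B. if c = b then of_int (k c) else 0)"
      by (intro sum.cong) (auto simp: g(2))
    finally show ?thesis
      using that B(1) by simp
  qed
  have "\<exists>K. \<forall>x. norm (g b x) \<le> K * norm x" for b
    using linear_bounded[OF g(1)[of b]] by (auto simp: mult.commute)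
  then obtain K where K: "\<And>b x. norm (g b x) \<le> K b * norm x"
    by metis
  define I where "I b = {- \<lceil>\<bar>K b\<bar> * \<bar>r\<bar>\<rceil> .. \<lceil>\<bar>K b\<bar> * \<bar>r\<bar>\<rceil>}" for b
  have "{x \<in> N. norm x \<le> r} \<subseteq> (\<lambda>k. \<Sum>b\<in>B. of_int (k b) *\<^sub>R b) ` (PiE B I)"
  proof
    fix x assume "x \<in> {x \<in> N. norm x \<le> r}"
    then obtain k where k: "x = (\<Sum>b\<in>B. of_int (k b) *\<^sub>R b)" and r: "norm x \<le> r"
      using B(3) by blast
    have "k b \<in> I b" if "b \<in> B" for b
    proof -
      have "\<bar>of_int (k b)\<bar> \<le> K b * norm x"
        using K[of b x] g_sum[OF that, of k] k by simp
      also have "\<dots> \<le> \<bar>K b\<bar> * \<bar>r\<bar>"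
        using r by (intro mult_mono) auto
      finally show ?thesis
        unfolding I_def by (simp add: abs_le_iff) linarith
    qed
    then have "restrict k B \<in> PiE B I" by auto
    moreover have "x = (\<Sum>b\<in>B. of_int (restrict k B b) *\<^sub>R b)"
      unfolding k by (rule sum.cong) auto
    ultimately show "x \<in> (\<lambda>k. \<Sum>b\<in>B. of_int (k b) *\<^sub>R b) ` (PiE B I)" by blast
  qed
  moreover have "finite (PiE B I)"
    using B(1) by (intro finite_PiE) (auto simp: I_def)
  ultimately show ?thesis
    by (meson finite_imageI finite_subset)
qed

text \<open>The kernel of a map between lattices is a rational subspace, so it vanishes once it contains no
  nonzero lattice point. Rational linear algebra is avoided by rounding: if \<open>L v = 0\<close> with
  \<open>v \<noteq> 0\<close>, the multiples of \<open>v\<close> rounded to lattice points stay at bounded distance from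
  the line through \<open>v\<close>. Their images are then lattice points in a bounded set, so finite in
  number, whereas the rounded points themselves are unbounded. Integrality of the target is
  essential: \<open>(x, y) \<mapsto> x - \<surd>2 y\<close> is injective on \<open>\<int> \<times> \<int>\<close> but not on the plane.\<close>

lemma lattice_injective_imp_span_injective:
  fixes L :: "'v::euclidean_space \<Rightarrow> 'w::euclidean_space"
  assumes N: "is_lattice N" and N': "is_lattice N'" and L: "linear L"
    and maps: "L ` N \<subseteq> N'" and inj: "inj_on L N"
  shows "inj_on L (span N)"
proof -
  obtain B :: "'v set" where B: "finite B" "independent B"
      "N = {(\<Sum>b\<in>B. of_int (k b) *\<^sub>R b) | k. True}"
    using N unfolding is_lattice_def by blast
  have "N \<subseteq> span B"
    unfolding B(3) by (auto intro!: span_sum span_scale intro: span_base)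
  then have NB: "span N \<subseteq> span B" by (simp add: span_minimal)
  have "v = 0" if v: "v \<in> span N" "L v = 0" for v
  proof (rule ccontr)
    assume "v \<noteq> 0"
    obtain t where t: "v = (\<Sum>b\<in>B. t b *\<^sub>R b)"
      using v(1) NB span_finite[OF B(1)] by auto
    \<comment> \<open>the lattice point obtained from the n-th multiple of v by rounding coordinates\<close>
    define w where "w n = (\<Sum>b\<in>B. of_int \<lfloor>real n * t b\<rfloor> *\<^sub>R b)" for n :: nat
    define R where "R = (\<Sum>b\<in>B. norm b)"
    have wN: "w n \<in> N" for n unfolding B(3) w_def
      by (intro CollectI exI[of _ "\<lambda>b. \<lfloor>real n * t b\<rfloor>"]) simp
    have near: "norm (real n *\<^sub>R v - w n) \<le> R" for n
    proof -
      have "real n *\<^sub>R v - w n = (\<Sum>b\<in>B. frac (real n * t b) *\<^sub>R b)"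
        unfolding t w_def by (simp add: scaleR_sum_right sum_subtractf[symmetric]
            scaleR_diff_left[symmetric] frac_def)
      also have "norm \<dots> \<le> (\<Sum>b\<in>B. norm (frac (real n * t b) *\<^sub>R b))" by (rule norm_sum)
      also have "\<dots> \<le> R"
        unfolding R_def
        by (intro sum_mono) (simp add: mult_left_le_one_le frac_ge_0 less_imp_le[OF frac_lt_1])
      finally show ?thesis .
    qed
    obtain K where K: "\<And>x. norm (L x) \<le> norm x * K" "K > 0"
      using bounded_linear.pos_bounded[OF L[unfolded linear_conv_bounded_linear]] by blast
    have "norm (L (w n)) \<le> R * K" for n
    proof -
      have "L (w n) = - L (real n *\<^sub>R v - w n)"
        using v(2) by (simp add: linear_diff[OF L] linear_cmul[OF L])
      then have "norm (L (w n)) \<le> norm (real n *\<^sub>R v - w n) * K"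
        using K(1)[of "real n *\<^sub>R v - w n"] by (simp only: norm_minus_cancel)
      also have "\<dots> \<le> R * K" using near K(2) by (intro mult_right_mono) auto
      finally show ?thesis .
    qed
    then have "L ` range w \<subseteq> {x \<in> N'. norm x \<le> R * K}"
      using wN maps by auto
    then have "finite (L ` range w)"
      using lattice_bounded_finite[OF N'] finite_subset by blast
    moreover have "inj_on L (range w)" using inj wN by (meson image_subsetI inj_on_subset)
    ultimately have "finite (range w)" by (rule finite_imageD)
    then obtain M where M: "\<And>n. norm (w n) \<le> M"
      using finite_imp_bounded bounded_iff by (metis rangeI)
    obtain n :: nat where "real n * norm v > M + R"
      using \<open>v \<noteq> 0\<close> reals_Archimedean3[of "norm v"] by auto
    moreover have "real n * norm v \<le> norm (real n *\<^sub>R v - w n) + norm (w n)"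
      using norm_triangle_ineq[of "real n *\<^sub>R v - w n" "w n"] by simp
    ultimately show False using near[of n] M[of n] by linarith
  qed
  then show ?thesis
    using linear_injective_on_subspace_0[OF L subspace_span] by blast
qed

text \<open>A face of least dimension among those through the point works: if the point were on its relative
  boundary, a facet would be smaller.\<close>

section \<open>Faces, relative frontiers and affine maps\<close>

lemma point_in_rel_interior_of_face:
  fixes S :: "'v::euclidean_space set"
  assumes "polyhedron S" "x \<in> S"
  obtains T where "T face_of S" "x \<in> rel_interior T"
proof -
  obtain T where T: "T face_of S \<and> x \<in> T \<and>
      (\<forall>T'. T' face_of S \<and> x \<in> T' \<longrightarrow> nat (aff_dim T + 2) \<le> nat (aff_dim T' + 2))"
    using ex_has_least_nat[of "\<lambda>T. T face_of S \<and> x \<in> T" S "\<lambda>T. nat (aff_dim T + 2)"]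
      assms face_of_refl[OF polyhedron_imp_convex] by auto
  have pT: "polyhedron T" using T assms(1) face_of_polyhedron_polyhedron by blast
  have "x \<in> rel_interior T"
  proof (rule ccontr)
    assume "x \<notin> rel_interior T"
    then have "x \<in> \<Union> {F. F facet_of T}"
      using rel_boundary_of_polyhedron[OF pT] T by blast
    then obtain F where F: "F facet_of T" "x \<in> F" by blast
    have "aff_dim F \<ge> - 1" by (rule aff_dim_geq)
    moreover have "aff_dim F = aff_dim T - 1"
      using F(1) unfolding facet_of_def by blast
    moreover have "F face_of S" using F(1) T face_of_trans unfolding facet_of_def by blast
    then have "nat (aff_dim T + 2) \<le> nat (aff_dim F + 2)" using T F(2) by blast
    ultimately show False by linarith
  qed
  then show ?thesis using T that by blast
qed

text \<open>Otherwise \<open>S\<close> would cut a clopen proper part out of the connected segment, since \<open>S\<close> is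
  closed and its relative interior is open in the affine hull.\<close>

lemma segment_meets_rel_frontier:
  fixes S :: "'v::euclidean_space set"
  assumes S: "closed S" and x: "x \<in> S" and y: "y \<in> affine hull S" "y \<notin> S"
  obtains w where "w \<in> closed_segment x y" "w \<in> S" "w \<notin> rel_interior S"
proof (rule ccontr)
  let ?I = "closed_segment x y"
  assume "\<not> thesis"
  then have eq: "?I \<inter> S = ?I \<inter> rel_interior S"
    using that rel_interior_subset by blast
  have sub: "?I \<subseteq> affine hull S"
    using x y(1) by (simp add: closed_segment_subset hull_inc affine_imp_convex)
  obtain U where U: "open U" "rel_interior S = affine hull S \<inter> U"
    using openin_rel_interior[of S] by (auto simp: openin_open)
  have "openin (top_of_set ?I) (?I \<inter> S)"
    unfolding eq U(2) using U(1) sub by (metis inf.assoc inf.orderE openin_open_Int)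
  moreover have "closedin (top_of_set ?I) (?I \<inter> S)"
    using S by (rule closedin_closed_Int)
  ultimately have "?I \<inter> S = {} \<or> ?I \<inter> S = ?I"
    using connected_clopen[of ?I] by (meson connected_segment)
  then show False using x y(2) by (auto)
qed

text \<open>This is how the absence of lines enters: one of the two directions along any line leaves
  \<open>S\<close>, even if the other one is a recession direction.\<close>

lemma line_meets_rel_frontier:
  fixes S :: "'v::euclidean_space set"
  assumes S: "closed S" "\<not> contains_line S" and xy: "x \<in> S" "y \<in> S" "x \<noteq> y"
  obtains t where "x + t *\<^sub>R (y - x) \<in> S" "x + t *\<^sub>R (y - x) \<notin> rel_interior S"
proof -
  obtain t where t: "x + t *\<^sub>R (y - x) \<notin> S"
    using S(2) xy(3) by (metis contains_line_def right_minus_eq)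
  have aff: "x + t *\<^sub>R (y - x) \<in> affine hull S"
    using xy(1,2) mem_affine_3_minus[OF affine_affine_hull hull_inc hull_inc hull_inc] by blast
  obtain w where w: "w \<in> closed_segment x (x + t *\<^sub>R (y - x))" "w \<in> S" "w \<notin> rel_interior S"
    using segment_meets_rel_frontier[OF S(1) xy(1) aff t] by blast
  obtain u where "w = (1 - u) *\<^sub>R x + u *\<^sub>R (x + t *\<^sub>R (y - x))"
    using w(1) by (auto simp: in_segment)
  then have "w = x + (u * t) *\<^sub>R (y - x)" by (simp add: algebra_simps)
  then show ?thesis using w that by blast
qed

text \<open>Only the restriction of \<open>f\<close> to \<open>S\<close> matters, because the maps between lattice spans are
  extensional functions.\<close>

definition affine_on :: "'v::real_vector set \<Rightarrow> ('v \<Rightarrow> 'w::real_vector) \<Rightarrow> bool" where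
  "affine_on S f \<longleftrightarrow> (\<exists>L b. linear L \<and> (\<forall>x\<in>S. f x = L x + b))"

lemma affine_on_combination:
  assumes "affine_on S f" "x \<in> S" "y \<in> S" "(1 - t) *\<^sub>R x + t *\<^sub>R y \<in> S"
  shows "f ((1 - t) *\<^sub>R x + t *\<^sub>R y) = (1 - t) *\<^sub>R f x + t *\<^sub>R f y"
proof -
  obtain L b where L: "linear L" "\<forall>x\<in>S. f x = L x + b"
    using assms(1) unfolding affine_on_def by blast
  have "f ((1 - t) *\<^sub>R x + t *\<^sub>R y) = (1 - t) *\<^sub>R L x + t *\<^sub>R L y + b"
    using L assms(4) by (simp only: linear_add[OF L(1)] linear_cmul[OF L(1)])
  then show ?thesis
    using L(2) assms(2,3) by (simp add: algebra_simps)
qed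

lemma affine_on_line:
  assumes "affine_on S f" "x \<in> S" "y \<in> S" "x + t *\<^sub>R (y - x) \<in> S"
  shows "f (x + t *\<^sub>R (y - x)) = f x + t *\<^sub>R (f y - f x)"
proof -
  have "x + t *\<^sub>R (y - x) = (1 - t) *\<^sub>R x + t *\<^sub>R y" by (simp add: algebra_simps)
  then show ?thesis
    using affine_on_combination[OF assms(1-3), of t] assms(4) by (simp add: algebra_simps)
qed

lemma affine_on_continuous:
  fixes f :: "'v::euclidean_space \<Rightarrow> 'w::real_normed_vector"
  assumes "affine_on S f" shows "continuous_on S f"
proof -
  obtain L b where L: "linear L" "\<forall>x\<in>S. f x = L x + b"
    using assms unfolding affine_on_def by blast
  have "continuous_on S (\<lambda>x. L x + b)"
    using L(1) by (intro continuous_intros linear_continuous_on linear_conv_bounded_linear[THEN iffD1])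
  then show ?thesis by (rule continuous_on_eq) (use L(2) in auto)
qed

lemma affine_on_subset: "affine_on S f \<Longrightarrow> T \<subseteq> S \<Longrightarrow> affine_on T f"
  unfolding affine_on_def by blast

lemma affine_on_rel_interior:
  fixes f :: "'v::euclidean_space \<Rightarrow> 'w::euclidean_space"
  assumes "affine_on S f" "K \<subseteq> S" "convex K"
  shows "rel_interior (f ` K) = f ` rel_interior K"
proof -
  obtain L b where L: "linear L" "\<forall>x\<in>S. f x = L x + b"
    using assms(1) unfolding affine_on_def by blast
  have fK: "f ` T = (+) b ` L ` T" if "T \<subseteq> K" for T
    unfolding image_image using that assms(2) L(2) by (intro image_cong) (auto simp: add.commute)
  show ?thesis
    unfolding fK[OF order_refl] fK[OF rel_interior_subset] rel_interior_translation
      rel_interior_convex_linear_image[OF L(1) assms(3)] ..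
qed

lemma affine_on_affine_hull:
  fixes f :: "'v::euclidean_space \<Rightarrow> 'w::euclidean_space"
  assumes "affine_on S f" "affine hull K \<subseteq> S"
  shows "affine hull (f ` K) = f ` (affine hull K)"
proof -
  obtain L b where L: "linear L" "\<forall>x\<in>S. f x = L x + b"
    using assms(1) unfolding affine_on_def by blast
  have fK: "f ` T = (+) b ` L ` T" if "T \<subseteq> S" for T
    unfolding image_image using that L(2) by (intro image_cong) (auto simp: add.commute)
  have KS: "K \<subseteq> S" using assms(2) hull_subset by fast
  show ?thesis
    unfolding fK[OF KS] fK[OF assms(2)] affine_hull_translation
      affine_hull_linear_image[OF L(1)[unfolded linear_conv_bounded_linear]] ..
qed

lemma affine_on_closed_image:
  fixes f :: "'v::euclidean_space \<Rightarrow> 'w::euclidean_space"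
  assumes "affine_on S f" "subspace S" "inj_on f S" "K \<subseteq> S" "closed K"
  shows "closed (f ` K)"
proof -
  obtain L b where L: "linear L" "\<forall>x\<in>S. f x = L x + b"
    using assms(1) unfolding affine_on_def by blast
  have "inj_on L S" using assms(3) L(2) by (auto simp: inj_on_def)
  then have "\<forall>x\<in>S. L x = 0 \<longrightarrow> x = 0"
    using linear_injective_on_subspace_0[OF L(1) assms(2)] by blast
  obtain g where g: "linear g" "\<forall>x\<in>S. g (L x) = x"
    using linear_inj_on_left_inverse[OF L(1), of S] \<open>inj_on L S\<close>
    unfolding span_eq_iff[THEN iffD2, OF assms(2)] by blast
  have "closed (L ` S)"
    using assms(2) L(1) by (intro closed_subspace linear_subspace_image)
  moreover have "closed (g -` K)"
    using continuous_closed_vimage[OF assms(5), of g] g(1)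
    by (simp add: linear_continuous_at linear_conv_bounded_linear)
  moreover have "L ` K = L ` S \<inter> g -` K"
    using g(2) assms(4) by (force simp: image_iff)
  ultimately have "closed (L ` K)" by (metis closed_Int)
  then have "closed ((+) b ` L ` K)" by (rule closed_translation)
  moreover have "f ` K = (+) b ` L ` K"
    unfolding image_image using assms(4) L(2) by (intro image_cong) (auto simp: add.commute)
  ultimately show ?thesis by simp
qed

text \<open>A small multiple of any direction of the affine hull can be added to a relative interior point
  without leaving \<open>K\<close>.\<close>

lemma affine_on_inj_extend:
  fixes f :: "'v::euclidean_space \<Rightarrow> 'w::euclidean_space"
  assumes f: "affine_on S f" and S: "affine hull K = S" "subspace S"
    and K: "convex K" "K \<noteq> {}" and inj: "inj_on f K"
  shows "inj_on f S"
proof (rule inj_onI)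
  fix u v assume uv: "u \<in> S" "v \<in> S" "f u = f v"
  obtain L b where L: "linear L" "\<forall>x\<in>S. f x = L x + b"
    using f unfolding affine_on_def by blast
  obtain x where x: "x \<in> rel_interior K"
    using K rel_interior_eq_empty by blast
  then obtain e where e: "e > 0" "cball x e \<inter> S \<subseteq> K" "x \<in> K"
    unfolding mem_rel_interior_cball S(1) by blast
  have xS: "x \<in> S" unfolding S(1)[symmetric] using e(3) by (rule hull_inc)
  show "u = v"
  proof (rule ccontr)
    assume "u \<noteq> v"
    define t where "t = e / norm (v - u)"
    have t: "t \<noteq> 0" using e(1) \<open>u \<noteq> v\<close> unfolding t_def by simp
    have yS: "x + t *\<^sub>R (v - u) \<in> S"
      using xS uv(1,2) S(2) by (intro subspace_add subspace_scale subspace_diff)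
    moreover have "x + t *\<^sub>R (v - u) \<in> cball x e"
      using e(1) \<open>u \<noteq> v\<close> unfolding t_def by (simp add: dist_norm)
    ultimately have "x + t *\<^sub>R (v - u) \<in> K" using e(2) by blast
    moreover have "L v = L u" using L(2) uv by simp
    then have "f (x + t *\<^sub>R (v - u)) = f x"
      using L(2) yS xS by (simp add: linear_add[OF L(1)] linear_cmul[OF L(1)] linear_diff[OF L(1)])
    ultimately have "x + t *\<^sub>R (v - u) = x" using inj e(3) by (simp add: inj_on_eq_iff)
    then show False using t \<open>u \<noteq> v\<close> by simp
  qed
qed

lemma affine_on_preimage_face:
  assumes f: "affine_on K f" and K: "convex K" and T: "T face_of P" "f ` K \<subseteq> P"
  shows "{x \<in> K. f x \<in> T} face_of K"
proof -
  obtain L b where L: "linear L" "\<forall>x\<in>K. f x = L x + b"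
    using f unfolding affine_on_def by blast
  have comb: "f ((1 - t) *\<^sub>R x + t *\<^sub>R y) = (1 - t) *\<^sub>R f x + t *\<^sub>R f y"
    if "x \<in> K" "y \<in> K" "0 \<le> t" "t \<le> 1" for x y t
    using affine_on_combination[OF f that(1,2)] convexD_alt[OF K that(1,2)] that(3,4) by blast
  show ?thesis
    unfolding face_of_def
  proof (intro conjI ballI impI)
    show "convex {x \<in> K. f x \<in> T}"
      unfolding convex_alt using comb convexD_alt[OF K]
        convexD_alt[OF face_of_imp_convex[OF T(1)]] by auto
    fix x y z assume x: "x \<in> K" and y: "y \<in> K" and z: "z \<in> {x \<in> K. f x \<in> T}"
      and seg: "z \<in> open_segment x y"
    obtain t where t: "0 < t" "t < 1" "z = (1 - t) *\<^sub>R x + t *\<^sub>R y"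
      using seg unfolding in_segment by blast
    then have fz: "f z = (1 - t) *\<^sub>R f x + t *\<^sub>R f y" using comb x y by simp
    have P: "f x \<in> P" "f y \<in> P" using T(2) x y by blast+
    have "f x \<in> T \<and> f y \<in> T"
    proof (cases "f x = f y")
      case True
      then show ?thesis using fz z by (simp add: algebra_simps)
    next
      case False
      then have "f z \<in> open_segment (f x) (f y)" using t fz unfolding in_segment by blast
      then show ?thesis using T(1) P z unfolding face_of_def by blast
    qed
    then show "x \<in> {x \<in> K. f x \<in> T}" "y \<in> {x \<in> K. f x \<in> T}" using x y by blast+
  qed blast
qed

section \<open>Integral polyhedra and face morphisms\<close>

lemma rational_polyhedron_imp_polyhedron:
  fixes P :: "'v::euclidean_space set"
  assumes "rational_polyhedron N P"
  shows "polyhedron P"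
proof -
  obtain H :: "(('v \<Rightarrow> real) \<times> real) set" where H: "finite H"
      "\<forall>(u, c) \<in> H. linear u \<and> u ` N \<subseteq> \<int>" "P = {x \<in> span N. \<forall>(u, c) \<in> H. u x \<ge> c}"
    using assms unfolding rational_polyhedron_def by blast
  have "P = span N \<inter> \<Inter>((\<lambda>(u, c). {x. u x \<ge> c}) ` H)"
    unfolding H(3) by auto
  moreover have "polyhedron {x. u x \<ge> c}" if "(u, c) \<in> H" for u c
  proof -
    have "linear u" using H(2) that by blast
    then have "u x = adjoint u 1 \<bullet> x" for x
      using adjoint_works[of u x 1] by (simp add: inner_commute)
    then show ?thesis
      using polyhedron_halfspace_ge[of c "adjoint u 1"] by simp
  qed
  moreover have "polyhedron (span N)"
    by (simp add: affine_imp_polyhedron subspace_imp_affine)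
  ultimately show ?thesis
    using H(1) by (auto intro!: polyhedron_Inter)
qed

lemma integral_polyhedronD:
  fixes N P :: "'v::euclidean_space set"
  assumes "integral_polyhedron (N, P)"
  shows "is_lattice N" "polyhedron P" "closed P" "convex P" "P \<noteq> {}" "\<not> contains_line P"
    "affine hull P = span N" "P \<subseteq> span N"
proof -
  have P: "is_lattice N" "rational_polyhedron N P" "P \<noteq> {}" "\<not> contains_line P"
      "N \<subseteq> affine hull P"
    using assms unfolding integral_polyhedron_def by auto
  then show "is_lattice N" "P \<noteq> {}" "\<not> contains_line P" by blast+
  show "polyhedron P" using P(2) by (rule rational_polyhedron_imp_polyhedron)
  then show "closed P" "convex P" by (simp_all add: polyhedron_imp_closed polyhedron_imp_convex)
  show "P \<subseteq> span N" using P(2) unfolding rational_polyhedron_def by blast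
  then have "affine hull P \<subseteq> span N"
    by (simp add: hull_minimal subspace_imp_affine)
  moreover have "affine hull P = span P"
    using P(5) lattice_zero[OF P(1)] affine_hull_span_0 by blast
  then have "span N \<subseteq> affine hull P"
    using P(5) by (simp add: span_minimal)
  ultimately show "affine hull P = span N" by blast
qed

lemma integrally_affine_affine_on: "integrally_affine N N' f \<Longrightarrow> affine_on (span N) f"
  unfolding integrally_affine_def affine_on_def by blast

text \<open>Of these facts only the injectivity on the real span is not immediate; it comes from the
  lattice bijection by the rounding argument above.\<close>

lemma face_morphismD:
  fixes N N' P T :: "'v::euclidean_space set"
  assumes T: "integral_polyhedron (N', T)" and P: "integral_polyhedron (N, P)"
    and f: "face_morphism (N', T) (N, P) f"
  shows "affine_on (span N') f" "inj_on f (span N')" "f \<in> extensional (span N')"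
    "f ` span N' \<subseteq> span N"
    "f ` T face_of P" "f ` N' = N \<inter> affine hull (f ` T)" "affine hull (f ` T) = f ` span N'"
proof -
  have ia: "integrally_affine N' N f" and face: "is_face (f ` T) P"
    and bij: "bij_betw f N' (N \<inter> affine hull (f ` T))"
    using f unfolding face_morphism_def by auto
  show aff: "affine_on (span N') f" using ia by (rule integrally_affine_affine_on)
  show "f \<in> extensional (span N')" "f ` span N' \<subseteq> span N"
    using ia unfolding integrally_affine_def by (auto simp: PiE_def)
  show "f ` T face_of P" using face unfolding is_face_def by blast
  show "f ` N' = N \<inter> affine hull (f ` T)" using bij by (simp add: bij_betw_def)
  show "affine hull (f ` T) = f ` span N'"
    using affine_on_affine_hull[OF aff, of T] integral_polyhedronD(7)[OF T] by simp
  obtain L b where L: "linear L" "\<forall>x\<in>span N'. f x = L x + b"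
    using aff unfolding affine_on_def by blast
  have N': "is_lattice N'" "is_lattice N" using T P integral_polyhedronD(1) by blast+
  have fN: "f ` N' \<subseteq> N" using ia unfolding integrally_affine_def by blast
  have LN: "L x = f x - f 0" if "x \<in> N'" for x
    using L(2) that by (simp add: span_base span_zero linear_0[OF L(1)])
  have "L ` N' \<subseteq> N"
    using fN lattice_zero[OF N'(1)] by (auto simp: LN intro!: lattice_diff[OF N'(2)])
  moreover have "inj_on L N'"
    using bij LN unfolding bij_betw_def inj_on_def by simp
  ultimately have "inj_on L (span N')"
    using lattice_injective_imp_span_injective[OF N' L(1)] by blast
  then show "inj_on f (span N')"
    using L(2) by (simp add: inj_on_def)
qed

text \<open>Two face morphisms onto the same face both identify their lattice with the lattice points of the
  affine hull of that face, so they differ by a unique affine lattice isomorphism of their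
  sources. This supplies the input of the lifting axiom of a polyhedral complex.\<close>

lemma face_morphism_lift:
  fixes N N1 N2 P T1 T2 :: "'v::euclidean_space set"
  assumes P1: "integral_polyhedron (N1, T1)" and P2: "integral_polyhedron (N2, T2)"
    and P: "integral_polyhedron (N, P)"
    and f: "face_morphism (N1, T1) (N, P) f" and g: "face_morphism (N2, T2) (N, P) g"
    and img: "f ` T1 = g ` T2"
  obtains u where "face_morphism (N1, T1) (N2, T2) u" "compose (span N1) g u = f"
proof -
  note F = face_morphismD[OF P1 P f] and G = face_morphismD[OF P2 P g]
  define u where "u = restrict (\<lambda>x. inv_into (span N2) g (f x)) (span N1)"
  have "f ` span N1 = g ` span N2" using F(7) G(7) img by simp
  then have u: "u x \<in> span N2" "g (u x) = f x" if "x \<in> span N1" for x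
    using that unfolding u_def by (auto intro!: inv_into_into f_inv_into_f)
  have u_eq: "u x = y" if "x \<in> span N1" "y \<in> span N2" "f x = g y" for x y
    using that u[of x] inj_onD[OF G(2), of "u x" y] by simp
  obtain L b where L: "linear L" "\<forall>x\<in>span N1. f x = L x + b"
    using F(1) unfolding affine_on_def by blast
  obtain M c where M: "linear M" "\<forall>x\<in>span N2. g x = M x + c"
    using G(1) unfolding affine_on_def by blast
  have "inj_on M (span N2)" using G(2) M(2) by (simp add: inj_on_def)
  then obtain h where h: "linear h" "\<forall>x\<in>span N2. h (M x) = x"
    using linear_inj_on_left_inverse[OF M(1)] by blast
  have "u x = (h \<circ> L) x + h (b - c)" if x: "x \<in> span N1" for x
  proof -
    have "M (u x) = L x + (b - c)"
      using u[OF x] M(2) L(2) x by (simp add: algebra_simps)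
    then have "h (M (u x)) = h (L x) + h (b - c)"
      by (simp only: linear_add[OF h(1)])
    then show ?thesis using h(2) u(1)[OF x] by simp
  qed
  then have aff: "\<exists>L b. linear L \<and> (\<forall>x\<in>span N1. u x = L x + b)"
    using linear_compose[OF L(1) h(1)] by blast
  have imgN: "f ` N1 = g ` N2" using F(6) G(6) img by simp
  have uN: "u ` N1 = N2"
  proof (intro equalityI subsetI)
    fix y assume "y \<in> u ` N1"
    then obtain x where x: "x \<in> N1" "y = u x" by blast
    then obtain z where "z \<in> N2" "f x = g z" using imgN by blast
    then show "y \<in> N2" using u_eq[of x z] x by (simp add: span_base)
  next
    fix y assume y: "y \<in> N2"
    then obtain x where x: "x \<in> N1" "f x = g y" using imgN by (metis imageE imageI)
    then show "y \<in> u ` N1" using u_eq[of x y] y by (metis imageI span_base)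
  qed
  have TN: "T1 \<subseteq> span N1" "T2 \<subseteq> span N2"
    using integral_polyhedronD(8) P1 P2 by blast+
  have uT: "u ` T1 = T2"
  proof (intro equalityI subsetI)
    fix y assume "y \<in> u ` T1"
    then obtain x where x: "x \<in> T1" "y = u x" by blast
    then obtain z where "z \<in> T2" "f x = g z" using img by blast
    then show "y \<in> T2" using u_eq[of x z] x TN by auto
  next
    fix y assume y: "y \<in> T2"
    then obtain x where x: "x \<in> T1" "f x = g y" using img by (metis imageE imageI)
    then show "y \<in> u ` T1" using u_eq[of x y] y TN by (metis imageI subsetD)
  qed
  have "inj_on u (span N1)"
    using u(2) F(2) unfolding inj_on_def by metis
  then have "inj_on u N1" by (rule inj_on_subset) (rule span_superset)
  moreover have "N2 \<inter> affine hull (u ` T1) = N2"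
    using integral_polyhedronD(7)[OF P2] uT span_superset[of N2] by auto
  ultimately have "bij_betw u N1 (N2 \<inter> affine hull (u ` T1))"
    using uN by (simp add: bij_betw_def)
  moreover have "is_face (u ` T1) T2"
    unfolding uT is_face_def using integral_polyhedronD(4,5)[OF P2] by (simp add: face_of_refl)
  moreover have "integrally_affine N1 N2 u"
    unfolding integrally_affine_def using aff uN u(1) by (auto simp: u_def)
  ultimately have "face_morphism (N1, T1) (N2, T2) u"
    unfolding face_morphism_def by simp
  moreover have "compose (span N1) g u = f"
    using u(2) F(3) by (intro extensionalityI[of _ "span N1"]) (auto simp: compose_def)
  ultimately show ?thesis using that by blast
qed

lemma face_morphism_id:
  fixes N P :: "'v::euclidean_space set"
  assumes "integral_polyhedron (N, P)"
  shows "face_morphism (N, P) (N, P) (restrict id (span N))"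
proof -
  note D = integral_polyhedronD[OF assms]
  let ?id = "restrict id (span N)"
  have "\<exists>L b. linear L \<and> (\<forall>x\<in>span N. ?id x = L x + b)"
    by (rule exI[of _ id], rule exI[of _ 0]) (simp add: linear_id)
  then have "integrally_affine N N ?id"
    unfolding integrally_affine_def by (auto simp: span_base)
  moreover have im: "?id ` P = P" "?id ` N = N"
    using D(8) by (auto simp: image_iff span_base)
  moreover have "is_face P P" unfolding is_face_def using D(4,5) by (simp add: face_of_refl)
  moreover have "inj_on ?id N" by (auto simp: inj_on_def span_base)
  moreover have "N \<inter> affine hull P = N" using D(7) span_superset by auto
  ultimately show ?thesis
    unfolding face_morphism_def bij_betw_def by simp
qed

lemma poly_face_cat_simps:
  "Ob poly_face_cat = {P. integral_polyhedron P}"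
  "(P, f, Q) \<in> Ar poly_face_cat \<longleftrightarrow>
     integral_polyhedron P \<and> integral_polyhedron Q \<and> face_morphism P Q f"
  "src poly_face_cat (P, f, Q) = P"
  "tgt poly_face_cat (P, f, Q) = Q"
  "ident poly_face_cat P = (P, restrict id (span (fst P)), P)"
  "cmp poly_face_cat (Q', g, R) (P, f, Q) = (P, compose (span (fst P)) g f, R)"
  by (auto simp: poly_face_cat_def)

section \<open>Arrows and faces in a polyhedral complex\<close>

locale rational_complex =
  fixes C :: "('o, 'm) cat" and \<sigma> :: "('o, 'm, 'v::euclidean_space) poly_ftr"
  assumes complex: "polyhedral_complex C \<sigma>"
begin

abbreviation rint :: "'o \<Rightarrow> 'v set" where
  "rint a \<equiv> rel_interior (cell \<sigma> a)"

lemmas complex_axioms = complex[unfolded polyhedral_complex_def]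

lemmas thin = complex_axioms[THEN conjunct1]
lemmas category = thin[unfolded finite_thin_category_def, THEN conjunct1]
lemmas ftr = complex_axioms[THEN conjunct2, THEN conjunct1]
lemmas face_axiom = complex_axioms[THEN conjunct2, THEN conjunct2, THEN conjunct1]
lemmas lift_axiom =
  complex_axioms[THEN conjunct2, THEN conjunct2, THEN conjunct2, THEN conjunct1]
lemmas iso_axioms =
  complex_axioms[THEN conjunct2, THEN conjunct2, THEN conjunct2, THEN conjunct2]

lemmas category_axioms = category[unfolded is_category_def]
lemmas ends_axiom = category_axioms[THEN conjunct1]
lemmas ident_axiom = category_axioms[THEN conjunct2, THEN conjunct1]
lemmas cmp_axiom = category_axioms[THEN conjunct2, THEN conjunct2, THEN conjunct1]

lemmas ftr_axioms = ftr[unfolded is_functor_def]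
lemmas ftr_Ob = ftr_axioms[THEN conjunct1]
lemmas ftr_Ar = ftr_axioms[THEN conjunct2, THEN conjunct1]
lemmas ftr_cmp = ftr_axioms[THEN conjunct2, THEN conjunct2]

lemma finite_Ob: "finite (Ob C)" and finite_Ar: "finite (Ar C)"
  using thin unfolding finite_thin_category_def by blast+

lemma hom_Ob:
  assumes "f \<in> hom_set C a b" shows "a \<in> Ob C" "b \<in> Ob C"
  using assms ends_axiom unfolding hom_set_def by blast+

lemma hom_unique:
  assumes "f \<in> hom_set C a b" "g \<in> hom_set C a b" shows "f = g"
proof -
  have "finite (hom_set C a b)"
    using finite_Ar by (rule finite_subset[rotated]) (auto simp: hom_set_def)
  moreover have "card (hom_set C a b) \<le> 1"
    using thin hom_Ob[OF assms(1)] unfolding finite_thin_category_def by blast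
  ultimately show ?thesis using assms card_le_Suc0_iff_eq by force
qed

lemma ident_hom: "a \<in> Ob C \<Longrightarrow> ident C a \<in> hom_set C a a"
  using ident_axiom by blast

lemma cmp_hom: "f \<in> hom_set C a b \<Longrightarrow> g \<in> hom_set C b c \<Longrightarrow> cmp C g f \<in> hom_set C a c"
  using cmp_axiom unfolding hom_set_def by auto

lemma obj_le_refl: "a \<in> Ob C \<Longrightarrow> obj_le C a a"
  using ident_hom unfolding obj_le_def by blast

lemma obj_le_trans: "obj_le C a b \<Longrightarrow> obj_le C b c \<Longrightarrow> obj_le C a c"
  unfolding obj_le_def using cmp_hom by blast

lemma obj_le_Ob: "obj_le C a b \<Longrightarrow> a \<in> Ob C" "obj_le C a b \<Longrightarrow> b \<in> Ob C"
  unfolding obj_le_def using hom_Ob by blast+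

lemma iso_src_eq_tgt: "is_iso C f \<Longrightarrow> src C f = tgt C f"
  using iso_axioms by blast

lemma obj_le_antisym:
  assumes "obj_le C a b" "obj_le C b a" shows "a = b"
proof -
  obtain f g where fg: "f \<in> hom_set C a b" "g \<in> hom_set C b a"
    using assms unfolding obj_le_def by blast
  have "cmp C g f = ident C a" "cmp C f g = ident C b"
    using hom_unique[OF cmp_hom[OF fg]] hom_unique[OF cmp_hom[OF fg(2,1)]] ident_hom
      hom_Ob[OF fg(1)] by blast+
  then have "is_iso C f"
    using fg unfolding is_iso_def hom_set_def by auto
  then show ?thesis using iso_src_eq_tgt fg(1) unfolding hom_set_def by auto
qed

lemma cell_integral: "a \<in> Ob C \<Longrightarrow> integral_polyhedron (lat \<sigma> a, cell \<sigma> a)"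
  using ftr_Ob by (simp add: poly_face_cat_simps)

lemmas cell_props = integral_polyhedronD[OF cell_integral]

lemma AMap_cases:
  assumes "f \<in> hom_set C a b"
  obtains u where "AMap \<sigma> f = (OMap \<sigma> a, u, OMap \<sigma> b)" "cell_map \<sigma> f = u"
proof -
  have "AMap \<sigma> f \<in> hom_set poly_face_cat (OMap \<sigma> a) (OMap \<sigma> b)"
    using assms ftr_Ar unfolding hom_set_def by blast
  then show ?thesis
    using that by (cases "AMap \<sigma> f") (auto simp: hom_set_def poly_face_cat_simps)
qed

lemma face_morphism_cell_map:
  assumes "f \<in> hom_set C a b"
  shows "face_morphism (lat \<sigma> a, cell \<sigma> a) (lat \<sigma> b, cell \<sigma> b) (cell_map \<sigma> f)"
proof -
  obtain u where u: "AMap \<sigma> f = (OMap \<sigma> a, u, OMap \<sigma> b)" "cell_map \<sigma> f = u"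
    using assms by (rule AMap_cases)
  have "AMap \<sigma> f \<in> Ar poly_face_cat"
    using assms ftr_Ar unfolding hom_set_def by blast
  then show ?thesis
    unfolding u by (simp add: poly_face_cat_simps)
qed

lemmas cell_map_props =
  face_morphismD[OF cell_integral[OF hom_Ob(1)] cell_integral[OF hom_Ob(2)] face_morphism_cell_map]

lemma cell_map_mem:
  assumes "f \<in> hom_set C a b" "x \<in> cell \<sigma> a" shows "cell_map \<sigma> f x \<in> cell \<sigma> b"
  using cell_map_props(5)[OF assms(1,1,1)] face_of_imp_subset assms(2) by blast

lemma cell_map_inj:
  assumes "f \<in> hom_set C a b" "x \<in> cell \<sigma> a" "y \<in> cell \<sigma> a" "cell_map \<sigma> f x = cell_map \<sigma> f y"
  shows "x = y"
  using assms cell_map_props(2)[OF assms(1,1,1)] cell_props(8)[OF hom_Ob(1)[OF assms(1)]]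
  by (meson inj_onD subsetD)

lemma cell_map_ident:
  assumes "a \<in> Ob C" "x \<in> cell \<sigma> a" shows "cell_map \<sigma> (ident C a) x = x"
proof -
  have "AMap \<sigma> (ident C a) = ident poly_face_cat (OMap \<sigma> a)"
    using ftr_Ob assms(1) by blast
  then show ?thesis
    using assms(2) cell_props(8)[OF assms(1)] by (auto simp: poly_face_cat_simps)
qed

lemma cell_map_cmp:
  assumes "f \<in> hom_set C a b" "g \<in> hom_set C b c" "x \<in> cell \<sigma> a"
  shows "cell_map \<sigma> (cmp C g f) x = cell_map \<sigma> g (cell_map \<sigma> f x)"
proof -
  have "AMap \<sigma> (cmp C g f) = cmp poly_face_cat (AMap \<sigma> g) (AMap \<sigma> f)"
    using ftr_cmp assms(1,2) unfolding hom_set_def by auto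
  moreover obtain u v where "AMap \<sigma> f = (OMap \<sigma> a, u, OMap \<sigma> b)" "cell_map \<sigma> f = u"
      "AMap \<sigma> g = (OMap \<sigma> b, v, OMap \<sigma> c)" "cell_map \<sigma> g = v"
    using AMap_cases assms(1,2) by metis
  ultimately show ?thesis
    using assms(3) cell_props(8)[OF hom_Ob(1)[OF assms(1)]]
    by (auto simp: poly_face_cat_simps compose_def)
qed

lemma face_arrow:
  assumes "a \<in> Ob C" "T face_of cell \<sigma> a" "T \<noteq> {}"
  obtains b f where "f \<in> hom_set C b a" "cell_map \<sigma> f ` cell \<sigma> b = T"
proof (cases "T = cell \<sigma> a")
  case True
  have "cell_map \<sigma> (ident C a) ` cell \<sigma> a = cell \<sigma> a"
    using cell_map_ident[OF assms(1)] by (auto simp: image_iff)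
  then show ?thesis using that ident_hom[OF assms(1)] True by blast
next
  case False
  then have "is_proper_face T (cell \<sigma> a)"
    using assms(2,3) unfolding is_proper_face_def is_face_def by blast
  then obtain f where "f \<in> Ar C" "tgt C f = a" "cell_map \<sigma> f ` cell \<sigma> (src C f) = T"
    using face_axiom assms(1) by blast
  then show ?thesis using that[of f "src C f"] unfolding hom_set_def by blast
qed

text \<open>Lifting the identity along the arrow inverts it among integral polyhedra. It is then invertible
  in the indexing category, where isomorphisms are self-maps.\<close>

lemma full_arrow_src:
  assumes f: "f \<in> hom_set C b a" and full: "cell_map \<sigma> f ` cell \<sigma> b = cell \<sigma> a"
  shows "b = a"
proof -
  let ?b = "(lat \<sigma> b, cell \<sigma> b)" and ?a = "(lat \<sigma> a, cell \<sigma> a)"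
  have P: "integral_polyhedron ?b" "integral_polyhedron ?a"
    using cell_integral hom_Ob[OF f] by blast+
  have fm: "face_morphism ?b ?a (cell_map \<sigma> f)" using f by (rule face_morphism_cell_map)
  have im: "restrict id (span (lat \<sigma> a)) ` cell \<sigma> a = cell_map \<sigma> f ` cell \<sigma> b"
    using integral_polyhedronD(8)[OF P(2)] full by (auto simp: image_iff)
  obtain u where u: "face_morphism ?a ?b u"
      "compose (span (lat \<sigma> a)) (cell_map \<sigma> f) u = restrict id (span (lat \<sigma> a))"
    using face_morphism_lift[OF P(2,1,2) face_morphism_id[OF P(2)] fm im] by blast
  note U = face_morphismD[OF P(2,1) u(1)] and F = face_morphismD[OF P fm]
  have "compose (span (lat \<sigma> b)) u (cell_map \<sigma> f) = restrict id (span (lat \<sigma> b))"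
  proof (rule extensionalityI[of _ "span (lat \<sigma> b)"])
    fix x assume x: "x \<in> span (lat \<sigma> b)"
    then have fx: "cell_map \<sigma> f x \<in> span (lat \<sigma> a)" using F(4) by blast
    then have "cell_map \<sigma> f (u (cell_map \<sigma> f x)) = cell_map \<sigma> f x"
      using fun_cong[OF u(2), of "cell_map \<sigma> f x"] by (simp add: compose_def)
    then have "u (cell_map \<sigma> f x) = x"
      using F(2) x fx U(4) by (auto dest: inj_onD)
    then show "compose (span (lat \<sigma> b)) u (cell_map \<sigma> f) x = restrict id (span (lat \<sigma> b)) x"
      using x by (simp add: compose_def)
  qed (auto simp: compose_def)
  moreover obtain v where v: "AMap \<sigma> f = (OMap \<sigma> b, v, OMap \<sigma> a)" "cell_map \<sigma> f = v"
    using f by (rule AMap_cases)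
  ultimately have "is_iso poly_face_cat (OMap \<sigma> b, v, OMap \<sigma> a)"
    unfolding is_iso_def hom_set_def
    using P fm u by (intro conjI bexI[of _ "(OMap \<sigma> a, u, OMap \<sigma> b)"]) (simp_all add: poly_face_cat_simps)
  then have "is_iso poly_face_cat (AMap \<sigma> f)" unfolding v(1) .
  then have "is_iso C f"
    using iso_axioms f unfolding hom_set_def by blast
  then show ?thesis using iso_src_eq_tgt f unfolding hom_set_def by auto
qed

text \<open>The comparison isomorphism of the two sources over their common face is realized by an arrow.\<close>

lemma proper_faces_obj_le:
  assumes f: "f \<in> hom_set C b a" and g: "g \<in> hom_set C c a"
    and eq: "cell_map \<sigma> f ` cell \<sigma> b = cell_map \<sigma> g ` cell \<sigma> c"
    and proper: "cell_map \<sigma> g ` cell \<sigma> c \<noteq> cell \<sigma> a"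
  shows "obj_le C b c"
proof -
  have Ob: "a \<in> Ob C" "b \<in> Ob C" "c \<in> Ob C" using hom_Ob f g by blast+
  note P = cell_integral[OF Ob(1)] cell_integral[OF Ob(2)] cell_integral[OF Ob(3)]
  obtain u where u: "face_morphism (OMap \<sigma> b) (OMap \<sigma> c) u"
      "compose (span (lat \<sigma> b)) (cell_map \<sigma> g) u = cell_map \<sigma> f"
    using face_morphism_lift[OF P(2,3,1) face_morphism_cell_map[OF f] face_morphism_cell_map[OF g] eq]
    by auto
  have "proper_arrow C \<sigma> f" "proper_arrow C \<sigma> g"
    using f g cell_map_props(5)[OF f f f] cell_map_props(5)[OF g g g] eq proper
      cell_props(5)[OF Ob(2)] cell_props(5)[OF Ob(3)]
    unfolding proper_arrow_def is_proper_face_def is_face_def hom_set_def by auto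
  moreover have "(OMap \<sigma> b, u, OMap \<sigma> c) \<in> hom_set poly_face_cat (OMap \<sigma> b) (OMap \<sigma> c)"
    using P u(1) unfolding hom_set_def by (simp add: poly_face_cat_simps)
  moreover have "cmp poly_face_cat (AMap \<sigma> g) (OMap \<sigma> b, u, OMap \<sigma> c) = AMap \<sigma> f"
    using AMap_cases[OF f] AMap_cases[OF g] u(2) by (metis poly_face_cat_simps(6))
  moreover have "f \<in> Ar C" "g \<in> Ar C" and ends: "src C f = b" "src C g = c" "tgt C f = tgt C g"
    using f g unfolding hom_set_def by auto
  ultimately have "\<exists>!h. h \<in> hom_set C (src C f) (src C g) \<and> cmp C g h = f \<and>
      AMap \<sigma> h = (OMap \<sigma> b, u, OMap \<sigma> c)"
    by (intro lift_axiom[rule_format]) simp_all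
  then show ?thesis unfolding obj_le_def ends by blast
qed

text \<open>Together with \<open>face_arrow\<close>: the arrows into \<open>a\<close>, hence the elements below \<open>a\<close> in the face
  poset, correspond bijectively to the nonempty faces of the cell of \<open>a\<close>.\<close>

lemma arrow_eq_if_same_face:
  assumes f: "f \<in> hom_set C b a" and g: "g \<in> hom_set C c a"
    and eq: "cell_map \<sigma> f ` cell \<sigma> b = cell_map \<sigma> g ` cell \<sigma> c"
  shows "b = c" "f = g"
proof -
  show "b = c"
  proof (cases "cell_map \<sigma> g ` cell \<sigma> c = cell \<sigma> a")
    case True
    then show ?thesis using full_arrow_src f g eq by metis
  next
    case False
    then show ?thesis
      using proper_faces_obj_le[OF f g eq] proper_faces_obj_le[OF g f] eq obj_le_antisym by simp
  qed
  then show "f = g" using f g hom_unique by blast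
qed

section \<open>Points of the realization\<close>

lemma rint_subset: "rint a \<subseteq> cell \<sigma> a" by (rule rel_interior_subset)

lemma rintD: "z \<in> rint a \<Longrightarrow> z \<in> cell \<sigma> a" using rint_subset by blast

lemma cell_map_rint:
  assumes "f \<in> hom_set C b a"
  shows "rel_interior (cell_map \<sigma> f ` cell \<sigma> b) = cell_map \<sigma> f ` rint b"
  using affine_on_rel_interior[OF cell_map_props(1)[OF assms assms assms]]
    cell_props(4,8)[OF hom_Ob(1)[OF assms]] by blast

lemma carrier_exists:
  assumes "a \<in> Ob C" "x \<in> cell \<sigma> a"
  obtains b f z where "f \<in> hom_set C b a" "z \<in> rint b" "cell_map \<sigma> f z = x"
proof -
  obtain T where T: "T face_of cell \<sigma> a" "x \<in> rel_interior T"
    using point_in_rel_interior_of_face[OF cell_props(2)[OF assms(1)] assms(2)] by blast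
  obtain b f where f: "f \<in> hom_set C b a" "cell_map \<sigma> f ` cell \<sigma> b = T"
  proof (rule face_arrow[OF assms(1) T(1)])
    show "T \<noteq> {}" using T(2) rel_interior_subset by blast
  qed
  then obtain z where "z \<in> rint b" "x = cell_map \<sigma> f z"
    using T(2) cell_map_rint[OF f(1)] by blast
  then show ?thesis using f that by blast
qed

text \<open>Distinct faces have disjoint relative interiors, and distinct arrows have distinct faces.\<close>

lemma carrier_unique:
  assumes f: "f \<in> hom_set C b a" "z \<in> rint b" and g: "g \<in> hom_set C c a" "w \<in> rint c"
    and eq: "cell_map \<sigma> f z = cell_map \<sigma> g w"
  shows "b = c" "f = g" "z = w"
proof -
  have "cell_map \<sigma> f z \<in> rel_interior (cell_map \<sigma> f ` cell \<sigma> b)"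
      "cell_map \<sigma> f z \<in> rel_interior (cell_map \<sigma> g ` cell \<sigma> c)"
    unfolding cell_map_rint[OF f(1)] cell_map_rint[OF g(1)]
    using imageI[OF f(2), of "cell_map \<sigma> f"] imageI[OF g(2), of "cell_map \<sigma> g"] eq by simp_all
  then have img: "cell_map \<sigma> f ` cell \<sigma> b = cell_map \<sigma> g ` cell \<sigma> c"
    using face_of_eq[OF cell_map_props(5)[OF f(1,1,1)] cell_map_props(5)[OF g(1,1,1)]] by blast
  show bc: "b = c" and fg: "f = g"
    using arrow_eq_if_same_face[OF f(1) g(1) img] by auto
  show "z = w"
    using cell_map_inj[OF f(1)] f(2) g(2) eq bc fg rint_subset by blast
qed

text \<open>The pair \<open>(b, z)\<close> is a normal form for the gluing relation: it depends only on the class of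
  \<open>p\<close>, as it is invariant under each elementary gluing.\<close>

definition carries :: "'o \<Rightarrow> 'v \<Rightarrow> 'o \<times> 'v \<Rightarrow> bool" where
  "carries b z p \<longleftrightarrow> (\<exists>f \<in> hom_set C b (fst p). z \<in> rint b \<and> cell_map \<sigma> f z = snd p)"

lemma carries_glue:
  assumes "(p, q) \<in> glue C \<sigma>" shows "carries b z p \<longleftrightarrow> carries b z q"
proof -
  obtain f x where f: "f \<in> Ar C" "x \<in> cell \<sigma> (src C f)"
      and p: "p = (src C f, x)" "q = (tgt C f, cell_map \<sigma> f x)"
    using assms unfolding glue_def by blast
  have fh: "f \<in> hom_set C (src C f) (tgt C f)" using f(1) unfolding hom_set_def by blast
  have push: "carries b z q" if "carries b z p" for b z
  proof -
    obtain g where g: "g \<in> hom_set C b (src C f)" "z \<in> rint b" "cell_map \<sigma> g z = x"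
      using \<open>carries b z p\<close> p unfolding carries_def by auto
    then have "cell_map \<sigma> (cmp C f g) z = cell_map \<sigma> f x"
      using cell_map_cmp[OF g(1) fh] rint_subset by blast
    then show ?thesis
      unfolding carries_def p using cmp_hom[OF g(1) fh] g(2) by auto
  qed
  moreover have "carries b z p" if bz: "carries b z q"
  proof -
    obtain c g w where g: "g \<in> hom_set C c (src C f)" "w \<in> rint c" "cell_map \<sigma> g w = x"
      using carrier_exists[OF hom_Ob(1)[OF fh] f(2)] by blast
    then have cw: "carries c w p" unfolding carries_def p by auto
    then have "carries c w q" by (rule push)
    with bz have "b = c" "z = w" unfolding carries_def using carrier_unique by metis+
    then show ?thesis using cw by simp
  qed
  ultimately show ?thesis by blast
qed

lemma carries_if_real_inj_eq:
  assumes "a \<in> Ob C" "x \<in> cell \<sigma> a" "a' \<in> Ob C" "x' \<in> cell \<sigma> a'"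
    and "real_inj C \<sigma> a x = real_inj C \<sigma> a' x'"
  shows "carries b z (a, x) \<longleftrightarrow> carries b z (a', x')"
proof -
  have "(a', x') \<in> topspace (cell_sum C \<sigma>)"
    using assms by (simp add: topspace_cell_sum)
  then have "((a, x), (a', x')) \<in> glue_equiv C \<sigma>"
    using eq_equiv_class[OF _ equiv_glue_equiv] assms(5) unfolding real_inj_def by blast
  then have "((a, x), (a', x')) \<in> (glue C \<sigma> \<union> (glue C \<sigma>)\<inverse>)\<^sup>*"
    unfolding glue_equiv_def by blast
  then show ?thesis
    by (induction rule: rtrancl_induct) (auto simp: carries_glue)
qed

lemma real_inj_arrow:
  assumes "f \<in> hom_set C a b" "x \<in> cell \<sigma> a"
  shows "real_inj C \<sigma> b (cell_map \<sigma> f x) = real_inj C \<sigma> a x"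
  using real_inj_cell_map[OF category ftr, of f x] assms unfolding hom_set_def by auto

text \<open>The gluing relation as it is used from here on, without reference to the generated
  equivalence: a point glued to a relative interior point \<open>z\<close> of the cell of \<open>b\<close> is the image
  of \<open>z\<close> under a face arrow.\<close>

lemma real_inj_carrier:
  assumes "a \<in> Ob C" "x \<in> cell \<sigma> a" "b \<in> Ob C" "z \<in> rint b"
    and "real_inj C \<sigma> a x = real_inj C \<sigma> b z"
  obtains f where "f \<in> hom_set C b a" "cell_map \<sigma> f z = x"
proof -
  have z: "z \<in> cell \<sigma> b" using assms(4) rint_subset by blast
  have "carries b z (b, z)"
    unfolding carries_def using ident_hom[OF assms(3)] cell_map_ident[OF assms(3) z] assms(4) by auto
  then have "carries b z (a, x)"
    using carries_if_real_inj_eq[OF assms(1,2,3) z assms(5)] by blast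
  then show ?thesis using that unfolding carries_def by auto
qed

lemma topspace_realization:
  "topspace (realization C \<sigma>) = (\<Union>a\<in>Ob C. real_inj C \<sigma> a ` cell \<sigma> a)"
  unfolding realization_def topspace_quotient_topology topspace_cell_sum quotient_def real_inj_def
  by auto

lemma real_inj_in_topspace:
  "a \<in> Ob C \<Longrightarrow> x \<in> cell \<sigma> a \<Longrightarrow> real_inj C \<sigma> a x \<in> topspace (realization C \<sigma>)"
  unfolding topspace_realization by blast

lemma real_inj_carrier_exists:
  assumes "a \<in> Ob C" "x \<in> cell \<sigma> a"
  obtains b f z where "f \<in> hom_set C b a" "z \<in> rint b" "cell_map \<sigma> f z = x"
    "real_inj C \<sigma> a x = real_inj C \<sigma> b z"
proof -
  obtain b f z where "f \<in> hom_set C b a" "z \<in> rint b" "cell_map \<sigma> f z = x"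
    using assms by (rule carrier_exists)
  then show ?thesis using that real_inj_arrow[of f b a z] rintD by simp
qed

lemma point_exists:
  assumes "p \<in> topspace (realization C \<sigma>)"
  obtains b z where "b \<in> Ob C" "z \<in> rint b" "p = real_inj C \<sigma> b z"
proof -
  obtain a x where "a \<in> Ob C" "x \<in> cell \<sigma> a" "p = real_inj C \<sigma> a x"
    using assms unfolding topspace_realization by blast
  then show ?thesis
    using that real_inj_carrier_exists[of a x] hom_Ob(1) by metis
qed

text \<open>No cell is glued to itself, because there is at most one arrow between two objects.\<close>

lemma real_inj_inj:
  assumes "a \<in> Ob C" "x \<in> cell \<sigma> a" "y \<in> cell \<sigma> a" "real_inj C \<sigma> a x = real_inj C \<sigma> a y"
  shows "x = y"
proof -
  obtain b f z where b: "f \<in> hom_set C b a" "z \<in> rint b" "cell_map \<sigma> f z = x"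
      "real_inj C \<sigma> a x = real_inj C \<sigma> b z"
    using assms(1,2) by (rule real_inj_carrier_exists)
  have "real_inj C \<sigma> a y = real_inj C \<sigma> b z" using b(4) assms(4) by simp
  then obtain g where g: "g \<in> hom_set C b a" "cell_map \<sigma> g z = y"
    using real_inj_carrier[OF assms(1,3) hom_Ob(1)[OF b(1)] b(2)] by blast
  have "f = g" using b(1) g(1) by (rule hom_unique)
  then show ?thesis using b(3) g(2) by simp
qed

text \<open>Hence the realization is the disjoint union of the relative interiors of the cells, and
  \<open>poly_map\<close> is the index of the stratum.\<close>

lemma poly_map_rint:
  assumes "b \<in> Ob C" "z \<in> rint b" shows "poly_map C \<sigma> (real_inj C \<sigma> b z) = b"
proof -
  have le: "obj_le C b c" if c: "c \<in> Ob C" "real_inj C \<sigma> b z \<in> real_inj C \<sigma> c ` cell \<sigma> c" for c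
  proof -
    obtain x where "x \<in> cell \<sigma> c" "real_inj C \<sigma> c x = real_inj C \<sigma> b z" using c(2) by auto
    then show ?thesis
      using real_inj_carrier[OF c(1) _ assms] unfolding obj_le_def by blast
  qed
  have mem: "real_inj C \<sigma> b z \<in> real_inj C \<sigma> b ` cell \<sigma> b"
    using assms(2) rint_subset by blast
  show ?thesis
    unfolding poly_map_def
  proof (rule the_equality)
    fix c assume "c \<in> Ob C \<and> real_inj C \<sigma> b z \<in> real_inj C \<sigma> c ` cell \<sigma> c \<and>
        (\<forall>c'\<in>Ob C. real_inj C \<sigma> b z \<in> real_inj C \<sigma> c' ` cell \<sigma> c' \<longrightarrow> obj_le C c c')"
    then show "c = b" using le mem assms(1) obj_le_antisym by blast
  qed (use le mem assms(1) in blast)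
qed

lemma poly_map_arrow:
  assumes "f \<in> hom_set C b a" "z \<in> rint b"
  shows "poly_map C \<sigma> (real_inj C \<sigma> a (cell_map \<sigma> f z)) = b"
  using real_inj_arrow[OF assms(1) rintD[OF assms(2)]]
    poly_map_rint[OF hom_Ob(1)[OF assms(1)] assms(2)] by simp

lemma poly_map_le:
  assumes "a \<in> Ob C" "x \<in> cell \<sigma> a" shows "obj_le C (poly_map C \<sigma> (real_inj C \<sigma> a x)) a"
proof -
  obtain b f z where "f \<in> hom_set C b a" "z \<in> rint b" "cell_map \<sigma> f z = x"
    using assms by (rule carrier_exists)
  then show ?thesis using poly_map_arrow[of f b a z] unfolding obj_le_def by blast
qed

lemma poly_map_le_imp_in_cell:
  assumes "p \<in> topspace (realization C \<sigma>)" "obj_le C (poly_map C \<sigma> p) a"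
  obtains x where "x \<in> cell \<sigma> a" "p = real_inj C \<sigma> a x"
proof -
  obtain b z where b: "b \<in> Ob C" "z \<in> rint b" "p = real_inj C \<sigma> b z"
    using point_exists[OF assms(1)] by blast
  then obtain f where f: "f \<in> hom_set C b a"
    using assms(2) poly_map_rint[of b z] unfolding obj_le_def by auto
  have "z \<in> cell \<sigma> b" using b(2) rint_subset by blast
  then show ?thesis using that[OF cell_map_mem[OF f]] real_inj_arrow[OF f] b(3) by simp
qed

lemma poly_map_Ob: "p \<in> topspace (realization C \<sigma>) \<Longrightarrow> poly_map C \<sigma> p \<in> Ob C"
  using point_exists poly_map_rint by metis

lemma rint_if_poly_map:
  assumes "a \<in> Ob C" "x \<in> cell \<sigma> a" "poly_map C \<sigma> (real_inj C \<sigma> a x) = a" shows "x \<in> rint a"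
proof -
  obtain b f z where b: "f \<in> hom_set C b a" "z \<in> rint b" "cell_map \<sigma> f z = x"
    using carrier_exists[OF assms(1,2)] by blast
  then have "b = a" using poly_map_arrow assms(3) by metis
  moreover from this have "f = ident C a" using b(1) ident_hom[OF assms(1)] hom_unique by blast
  ultimately show ?thesis using b(2,3) cell_map_ident[OF assms(1)] rintD by auto
qed

section \<open>Topology of the realization\<close>

lemma openin_realization:
  "openin (realization C \<sigma>) U \<longleftrightarrow> U \<subseteq> topspace (realization C \<sigma>) \<and>
    (\<forall>a\<in>Ob C. openin (top_of_set (cell \<sigma> a)) {x \<in> cell \<sigma> a. real_inj C \<sigma> a x \<in> U})"
proof -
  have "openin (cell_sum C \<sigma>) {p \<in> topspace (cell_sum C \<sigma>). glue_equiv C \<sigma> `` {p} \<in> U} \<longleftrightarrow>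
    (\<forall>a\<in>Ob C. openin (top_of_set (cell \<sigma> a)) {x \<in> cell \<sigma> a. real_inj C \<sigma> a x \<in> U})"
  proof -
    have "{x. (a, x) \<in> {p \<in> Sigma (Ob C) (cell \<sigma>). glue_equiv C \<sigma> `` {p} \<in> U}} =
        {x \<in> cell \<sigma> a. real_inj C \<sigma> a x \<in> U}" if "a \<in> Ob C" for a
      using that unfolding real_inj_def by auto
    then show ?thesis
      unfolding topspace_cell_sum unfolding cell_sum_def openin_sum_topology by auto
  qed
  then show ?thesis
    unfolding realization_def openin_quotient_topology topspace_quotient_topology by simp
qed

lemma closedin_realization:
  "closedin (realization C \<sigma>) K \<longleftrightarrow> K \<subseteq> topspace (realization C \<sigma>) \<and>
    (\<forall>a\<in>Ob C. closed {x \<in> cell \<sigma> a. real_inj C \<sigma> a x \<in> K})"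
proof -
  let ?X = "realization C \<sigma>"
  have "openin (top_of_set (cell \<sigma> a)) {x \<in> cell \<sigma> a. real_inj C \<sigma> a x \<in> topspace ?X - K} \<longleftrightarrow>
      closed {x \<in> cell \<sigma> a. real_inj C \<sigma> a x \<in> K}" if a: "a \<in> Ob C" for a
  proof -
    have "{x \<in> cell \<sigma> a. real_inj C \<sigma> a x \<in> topspace ?X - K} =
        cell \<sigma> a - {x \<in> cell \<sigma> a. real_inj C \<sigma> a x \<in> K}"
      using real_inj_in_topspace[OF a] by auto
    then have "openin (top_of_set (cell \<sigma> a)) {x \<in> cell \<sigma> a. real_inj C \<sigma> a x \<in> topspace ?X - K} \<longleftrightarrow>
        closedin (top_of_set (cell \<sigma> a)) {x \<in> cell \<sigma> a. real_inj C \<sigma> a x \<in> K}"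
      by (simp add: closedin_def)
    then show ?thesis
      using closedin_closed_eq[OF cell_props(3)[OF a]] by auto
  qed
  then show ?thesis
    unfolding closedin_def openin_realization by auto
qed

lemma cell_map_closed_image:
  assumes "f \<in> hom_set C a b" "closed K" "K \<subseteq> cell \<sigma> a"
  shows "closed (cell_map \<sigma> f ` K)"
proof (rule affine_on_closed_image)
  show "affine_on (span (lat \<sigma> a)) (cell_map \<sigma> f)" "inj_on (cell_map \<sigma> f) (span (lat \<sigma> a))"
    using cell_map_props(1,2) assms(1) by blast+
  show "K \<subseteq> span (lat \<sigma> a)"
    using assms(3) cell_props(8)[OF hom_Ob(1)[OF assms(1)]] by blast
qed (use assms(2) in auto)

lemma cell_map_closed_preimage:
  assumes "f \<in> hom_set C a b" "closed K"
  shows "closed {x \<in> cell \<sigma> a. cell_map \<sigma> f x \<in> K}"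
proof -
  have a: "a \<in> Ob C" using hom_Ob assms(1) by blast
  have "continuous_on (cell \<sigma> a) (cell_map \<sigma> f)"
    using affine_on_continuous[OF cell_map_props(1)[OF assms(1,1,1)]] cell_props(8)[OF a]
    by (rule continuous_on_subset)
  then have "closed (cell \<sigma> a \<inter> cell_map \<sigma> f -` K)"
    using continuous_closed_preimage cell_props(3)[OF a] assms(2) by blast
  then show ?thesis by (simp add: vimage_def Int_def)
qed

text \<open>The preimage in another cell is assembled from the finitely many common faces of the two
  cells, each embedded as a closed set in both.\<close>

lemma real_inj_closed_image:
  assumes a: "a \<in> Ob C" and A: "closed A" "A \<subseteq> cell \<sigma> a"
  shows "closedin (realization C \<sigma>) (real_inj C \<sigma> a ` A)"
  unfolding closedin_realization
proof (intro conjI ballI)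
  show "real_inj C \<sigma> a ` A \<subseteq> topspace (realization C \<sigma>)"
    using real_inj_in_topspace[OF a] A(2) by blast
next
  fix b assume b: "b \<in> Ob C"
  \<comment> \<open>spans of arrows, one for each common face of the cells of \<open>a\<close> and \<open>b\<close>\<close>
  define I where "I = {(f, g) \<in> Ar C \<times> Ar C. src C f = src C g \<and> tgt C f = a \<and> tgt C g = b}"
  let ?K = "\<lambda>f. {z \<in> cell \<sigma> (src C f). cell_map \<sigma> f z \<in> A}"
  have "{x \<in> cell \<sigma> b. real_inj C \<sigma> b x \<in> real_inj C \<sigma> a ` A} = (\<Union>(f, g)\<in>I. cell_map \<sigma> g ` ?K f)"
  proof (intro equalityI subsetI)
    fix x assume "x \<in> {x \<in> cell \<sigma> b. real_inj C \<sigma> b x \<in> real_inj C \<sigma> a ` A}"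
    then obtain y where x: "x \<in> cell \<sigma> b" and y: "y \<in> A" "real_inj C \<sigma> b x = real_inj C \<sigma> a y"
      by blast
    obtain c g z where g: "g \<in> hom_set C c b" "z \<in> rint c" "cell_map \<sigma> g z = x"
        "real_inj C \<sigma> b x = real_inj C \<sigma> c z"
      using b x by (rule real_inj_carrier_exists)
    have "y \<in> cell \<sigma> a" "real_inj C \<sigma> a y = real_inj C \<sigma> c z" using y A(2) g(4) by auto
    then obtain f where f: "f \<in> hom_set C c a" "cell_map \<sigma> f z = y"
      using real_inj_carrier[OF a _ hom_Ob(1)[OF g(1)] g(2)] by blast
    have "(f, g) \<in> I" "src C f = c"
      using f(1) g(1) unfolding I_def hom_set_def by auto
    moreover have "z \<in> ?K f"
      using f(2) y(1) rintD[OF g(2)] \<open>src C f = c\<close> by simp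
    ultimately show "x \<in> (\<Union>(f, g)\<in>I. cell_map \<sigma> g ` ?K f)"
      using g(3) by blast
  next
    fix x assume "x \<in> (\<Union>(f, g)\<in>I. cell_map \<sigma> g ` ?K f)"
    then obtain f g z where fg: "(f, g) \<in> I" and z: "z \<in> ?K f" "x = cell_map \<sigma> g z"
      by blast
    have f: "f \<in> hom_set C (src C f) a" and g: "g \<in> hom_set C (src C f) b"
      using fg unfolding I_def hom_set_def by auto
    have z': "z \<in> cell \<sigma> (src C f)" "cell_map \<sigma> f z \<in> A" using z(1) by auto
    have "real_inj C \<sigma> b x = real_inj C \<sigma> a (cell_map \<sigma> f z)"
      unfolding z(2) real_inj_arrow[OF g z'(1)] real_inj_arrow[OF f z'(1)] ..
    then show "x \<in> {x \<in> cell \<sigma> b. real_inj C \<sigma> b x \<in> real_inj C \<sigma> a ` A}"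
      using z'(2) z(2) cell_map_mem[OF g z'(1)] by auto
  qed
  moreover have "finite I"
    using finite_Ar unfolding I_def by (auto intro: finite_subset[of _ "Ar C \<times> Ar C"])
  moreover have "closed (cell_map \<sigma> g ` ?K f)" if "(f, g) \<in> I" for f g
  proof -
    have f: "f \<in> hom_set C (src C f) a" and g: "g \<in> hom_set C (src C f) b"
      using that unfolding I_def hom_set_def by auto
    show ?thesis
      by (rule cell_map_closed_image[OF g cell_map_closed_preimage[OF f A(1)]]) blast
  qed
  ultimately show "closed {x \<in> cell \<sigma> b. real_inj C \<sigma> b x \<in> real_inj C \<sigma> a ` A}"
    by auto
qed

lemma topspace_poset_topology: "topspace (poset_topology C) = Ob C"
proof -
  have "openin (poset_topology C) (Ob C)"
    unfolding openin_poset_topology by blast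
  then have "Ob C \<subseteq> topspace (poset_topology C)" by (rule openin_subset)
  moreover have "topspace (poset_topology C) \<subseteq> Ob C"
    by (rule openin_poset_topology[THEN iffD1, OF openin_topspace, THEN conjunct1])
  ultimately show ?thesis by blast
qed

lemma openin_up_set: "openin (poset_topology C) {c \<in> Ob C. obj_le C a c}"
  unfolding openin_poset_topology using obj_le_trans by blast

text \<open>The preimage of a down-closed set is the union of the closed cells that it indexes.\<close>

lemma continuous_poly_map: "continuous_map (realization C \<sigma>) (poset_topology C) (poly_map C \<sigma>)"
  unfolding continuous_map topspace_poset_topology
proof (intro conjI allI impI)
  let ?X = "realization C \<sigma>"
  show "poly_map C \<sigma> ` topspace ?X \<subseteq> Ob C" using poly_map_Ob by blast
  fix U assume U: "openin (poset_topology C) U"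
  have "topspace ?X - {p \<in> topspace ?X. poly_map C \<sigma> p \<in> U} =
      (\<Union>a\<in>Ob C - U. real_inj C \<sigma> a ` cell \<sigma> a)"
  proof (intro equalityI subsetI)
    fix p assume "p \<in> topspace ?X - {p \<in> topspace ?X. poly_map C \<sigma> p \<in> U}"
    then have p: "p \<in> topspace ?X" "poly_map C \<sigma> p \<in> Ob C - U" using poly_map_Ob by auto
    then obtain x where "x \<in> cell \<sigma> (poly_map C \<sigma> p)" "p = real_inj C \<sigma> (poly_map C \<sigma> p) x"
      using poly_map_le_imp_in_cell[OF p(1) obj_le_refl] by blast
    then show "p \<in> (\<Union>a\<in>Ob C - U. real_inj C \<sigma> a ` cell \<sigma> a)" using p(2) by blast
  next
    fix p assume "p \<in> (\<Union>a\<in>Ob C - U. real_inj C \<sigma> a ` cell \<sigma> a)"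
    then obtain a x where a: "a \<in> Ob C" "a \<notin> U" "x \<in> cell \<sigma> a" "p = real_inj C \<sigma> a x" by blast
    then have "poly_map C \<sigma> p \<notin> U"
      using U poly_map_le[OF a(1,3)] unfolding openin_poset_topology by blast
    then show "p \<in> topspace ?X - {p \<in> topspace ?X. poly_map C \<sigma> p \<in> U}"
      using real_inj_in_topspace a by blast
  qed
  moreover have "closedin ?X (\<Union>a\<in>Ob C - U. real_inj C \<sigma> a ` cell \<sigma> a)"
    using finite_Ob real_inj_closed_image cell_props(3) by (intro closedin_Union) auto
  ultimately show "openin ?X {p \<in> topspace ?X. poly_map C \<sigma> p \<in> U}"
    unfolding openin_closedin_eq by auto
qed

lemma segment_in_rint:
  assumes "a \<in> Ob C" "c \<in> rint a" "x \<in> cell \<sigma> a" "y \<in> closed_segment c x" "y \<noteq> x"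
  shows "y \<in> rint a"
proof (cases "y = c")
  case False
  then have "y \<in> open_segment c x" using assms(4,5) by (simp add: open_segment_def)
  then show ?thesis
    using rel_interior_closure_convex_segment[OF cell_props(4)[OF assms(1)] assms(2)]
      assms(3) closure_subset by blast
qed (use assms(2) in simp)

lemma connectedin_real_inj:
  assumes "a \<in> Ob C" "A \<subseteq> cell \<sigma> a" "connected A"
  shows "connectedin (realization C \<sigma>) (real_inj C \<sigma> a ` A)"
  by (rule connectedin_continuous_map_image[OF continuous_map_real_inj[OF assms(1)]])
    (use assms(2,3) in \<open>simp add: connectedin_subtopology\<close>)

lemma rint_nonempty: "a \<in> Ob C \<Longrightarrow> rint a \<noteq> {}"
  using cell_props(4,5) rel_interior_eq_empty by blast

text \<open>A straight segment inside a cell joins any point of the open star to a fixed relative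
  interior point \<open>z\<close> of the central cell.\<close>

lemma connectedin_star:
  assumes a: "a \<in> Ob C"
  shows "connectedin (realization C \<sigma>) {p \<in> topspace (realization C \<sigma>). obj_le C a (poly_map C \<sigma> p)}"
    (is "connectedin ?X ?S")
proof -
  obtain z where z: "z \<in> rint a" using rint_nonempty[OF a] by blast
  let ?q = "real_inj C \<sigma> a z"
  have "\<exists>A. connectedin ?X A \<and> ?q \<in> A \<and> p \<in> A \<and> A \<subseteq> ?S" if p: "p \<in> ?S" for p
  proof -
    obtain b x where b: "b \<in> Ob C" "x \<in> rint b" "p = real_inj C \<sigma> b x"
      using p point_exists by blast
    then have "obj_le C a b" using p poly_map_rint[OF b(1,2)] by auto
    then obtain f where f: "f \<in> hom_set C a b" unfolding obj_le_def by blast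
    let ?e = "cell_map \<sigma> f z" and ?I = "closed_segment x (cell_map \<sigma> f z)"
    have e: "?e \<in> cell \<sigma> b" using cell_map_mem[OF f] rintD[OF z] by blast
    then have I: "?I \<subseteq> cell \<sigma> b"
      using closed_segment_subset rintD[OF b(2)] cell_props(4)[OF b(1)] by blast
    have "obj_le C a (poly_map C \<sigma> (real_inj C \<sigma> b y))" if y: "y \<in> ?I" for y
    proof (cases "y = ?e")
      case True
      then show ?thesis using poly_map_arrow[OF f z] obj_le_refl[OF a] by simp
    next
      case False
      then have "y \<in> rint b" using segment_in_rint[OF b(1,2) e y] by blast
      then show ?thesis using poly_map_rint[OF b(1)] \<open>obj_le C a b\<close> by simp
    qed
    then have "real_inj C \<sigma> b ` ?I \<subseteq> ?S" using real_inj_in_topspace[OF b(1)] I by auto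
    moreover have "connectedin ?X (real_inj C \<sigma> b ` ?I)"
      using connectedin_real_inj[OF b(1) I] by simp
    moreover have "?q = real_inj C \<sigma> b ?e" using real_inj_arrow[OF f rintD[OF z]] by simp
    then have "?q \<in> real_inj C \<sigma> b ` ?I" "p \<in> real_inj C \<sigma> b ` ?I" using b(3) by auto
    ultimately show ?thesis by blast
  qed
  then have "?S = \<Union>{A. connectedin ?X A \<and> ?q \<in> A \<and> A \<subseteq> ?S}"
    by (intro equalityI subsetI) blast+
  moreover have "?q \<in> \<Inter>{A. connectedin ?X A \<and> ?q \<in> A \<and> A \<subseteq> ?S}" by blast
  then have "connectedin ?X (\<Union>{A. connectedin ?X A \<and> ?q \<in> A \<and> A \<subseteq> ?S})"
    by (intro connectedin_Union) blast+
  ultimately show ?thesis by argo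
qed

end

section \<open>Morphisms that are isomorphisms on lower intervals\<close>

text \<open>The standing hypotheses on the morphism. The two complexes are called \<open>S\<close> (source) and
  \<open>T\<close> (target).\<close>

locale down_iso_morphism =
  S: rational_complex C \<sigma> + T: rational_complex D \<delta>
  for C :: "('o, 'm) cat" and \<sigma> :: "('o, 'm, 'v::euclidean_space) poly_ftr"
    and D :: "('p, 'n) cat" and \<delta> :: "('p, 'n, 'w::euclidean_space) poly_ftr" +
  fixes \<phi> :: "('o, 'm, 'p, 'n) ftr" and \<Phi> :: "'o \<Rightarrow> 'v \<Rightarrow> 'w"
  assumes morphism: "complex_morphism C \<sigma> D \<delta> \<phi> \<Phi>"
    and down_iso: "\<forall>a \<in> Ob C. poset_iso_on_down C D (OMap \<phi>) a"
begin

lemmas morphism_axioms = morphism[unfolded complex_morphism_def]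
lemmas ftr_axioms = morphism_axioms[THEN conjunct1, unfolded is_functor_def]
lemmas ftr_Ob = ftr_axioms[THEN conjunct1]
lemmas ftr_Ar = ftr_axioms[THEN conjunct2, THEN conjunct1]
lemmas cell_axiom = morphism_axioms[THEN conjunct2, THEN conjunct1]
lemmas natural_axiom = morphism_axioms[THEN conjunct2, THEN conjunct2, THEN conjunct1]
lemmas nondegenerate_axiom = morphism_axioms[THEN conjunct2, THEN conjunct2, THEN conjunct2]

lemma phi_Ob: "a \<in> Ob C \<Longrightarrow> OMap \<phi> a \<in> Ob D"
  using ftr_Ob by blast

lemma phi_hom:
  assumes "f \<in> hom_set C a b" shows "AMap \<phi> f \<in> hom_set D (OMap \<phi> a) (OMap \<phi> b)"
  using ftr_Ar assms unfolding hom_set_def by auto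

lemma phi_mono:
  assumes "obj_le C a b" shows "obj_le D (OMap \<phi> a) (OMap \<phi> b)"
proof -
  obtain f where "f \<in> hom_set C a b" using assms unfolding obj_le_def by blast
  then show ?thesis using phi_hom unfolding obj_le_def by blast
qed

lemma phi_inj_down:
  assumes "obj_le C a c" "obj_le C b c" "OMap \<phi> a = OMap \<phi> b" shows "a = b"
proof -
  have "inj_on (OMap \<phi>) (down C c)"
    using down_iso S.obj_le_Ob(2)[OF assms(1)] unfolding poset_iso_on_down_def bij_betw_def by blast
  moreover have "a \<in> down C c" "b \<in> down C c"
    using assms(1,2) S.obj_le_Ob(1) unfolding down_def by auto
  ultimately show ?thesis using assms(3) by (simp add: inj_on_eq_iff)
qed

lemma phi_surj_down:
  assumes "a \<in> Ob C" "obj_le D b' (OMap \<phi> a)"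
  obtains b where "obj_le C b a" "OMap \<phi> b = b'"
proof -
  have "OMap \<phi> ` down C a = down D (OMap \<phi> a)"
    using down_iso assms(1) unfolding poset_iso_on_down_def bij_betw_def by blast
  moreover have "b' \<in> down D (OMap \<phi> a)"
    using assms(2) T.obj_le_Ob(1) unfolding down_def by auto
  ultimately have "b' \<in> OMap \<phi> ` down C a" by simp
  then show ?thesis using that unfolding down_def by auto
qed

lemma Phi_affine: "a \<in> Ob C \<Longrightarrow> affine_on (span (lat \<sigma> a)) (\<Phi> a)"
  using cell_axiom integrally_affine_affine_on by blast

lemma Phi_mem: "a \<in> Ob C \<Longrightarrow> x \<in> cell \<sigma> a \<Longrightarrow> \<Phi> a x \<in> cell \<delta> (OMap \<phi> a)"
  using cell_axiom by blast

lemma Phi_natural: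
  assumes "f \<in> hom_set C a b" "x \<in> cell \<sigma> a"
  shows "\<Phi> b (cell_map \<sigma> f x) = cell_map \<delta> (AMap \<phi> f) (\<Phi> a x)"
  using natural_axiom assms unfolding hom_set_def by auto

lemma Phi_line:
  assumes "a \<in> Ob C" "x \<in> cell \<sigma> a" "y \<in> cell \<sigma> a"
  shows "\<Phi> a (x + t *\<^sub>R (y - x)) = \<Phi> a x + t *\<^sub>R (\<Phi> a y - \<Phi> a x)"
proof -
  have "x \<in> span (lat \<sigma> a)" "y \<in> span (lat \<sigma> a)" using S.cell_props(8) assms by blast+
  moreover from this have "x + t *\<^sub>R (y - x) \<in> span (lat \<sigma> a)"
    by (intro span_add span_scale span_diff)
  ultimately show ?thesis using affine_on_line[OF Phi_affine[OF assms(1)]] by blast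
qed

text \<open>The preimage of the face carrying \<open>\<Phi> a x\<close> is a face of the source cell through a relative
  interior point, hence the whole cell; and the image of the cell lies in no proper face.\<close>

lemma Phi_rint:
  assumes a: "a \<in> Ob C" and x: "x \<in> S.rint a" shows "\<Phi> a x \<in> T.rint (OMap \<phi> a)"
proof -
  let ?P = "cell \<delta> (OMap \<phi> a)" and ?K = "cell \<sigma> a"
  have sub: "\<Phi> a ` ?K \<subseteq> ?P" using Phi_mem[OF a] by blast
  obtain F where F: "F face_of ?P" "\<Phi> a x \<in> rel_interior F"
    using point_in_rel_interior_of_face[OF T.cell_props(2)[OF phi_Ob[OF a]] Phi_mem[OF a S.rintD[OF x]]]
    by blast
  then have Fx: "\<Phi> a x \<in> F" using rel_interior_subset by blast
  have "affine_on ?K (\<Phi> a)"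
    using Phi_affine[OF a] S.cell_props(8)[OF a] by (rule affine_on_subset)
  then have "{y \<in> ?K. \<Phi> a y \<in> F} face_of ?K"
    using affine_on_preimage_face S.cell_props(4)[OF a] F(1) sub by blast
  moreover have "x \<in> {y \<in> ?K. \<Phi> a y \<in> F}" using Fx S.rintD[OF x] by blast
  ultimately have "?K \<subseteq> {y \<in> ?K. \<Phi> a y \<in> F}"
    using subset_of_face_of[of "{y \<in> ?K. \<Phi> a y \<in> F}" ?K ?K] x by blast
  then have "\<Phi> a ` ?K \<subseteq> F" by blast
  then have "\<not> is_proper_face F ?P" using nondegenerate_axiom a by blast
  then have "F = ?P" using F(1) Fx unfolding is_proper_face_def is_face_def by blast
  then show ?thesis using F(2) by simp
qed

lemma poly_map_Phi:
  assumes a: "a \<in> Ob C" and x: "x \<in> cell \<sigma> a"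
  shows "poly_map D \<delta> (real_inj D \<delta> (OMap \<phi> a) (\<Phi> a x)) = OMap \<phi> (poly_map C \<sigma> (real_inj C \<sigma> a x))"
proof -
  obtain b f z where b: "f \<in> hom_set C b a" "z \<in> S.rint b" "cell_map \<sigma> f z = x"
    using S.carrier_exists[OF a x] by blast
  have "\<Phi> a x = cell_map \<delta> (AMap \<phi> f) (\<Phi> b z)"
    using Phi_natural[OF b(1) S.rintD[OF b(2)]] b(3) by simp
  then show ?thesis
    using T.poly_map_arrow[OF phi_hom[OF b(1)] Phi_rint[OF S.hom_Ob(1)[OF b(1)] b(2)]]
      S.poly_map_arrow[OF b(1,2)] b(3) by simp
qed

text \<open>A boundary point lies in the relative interior of a face \<open>b < a\<close>, and \<open>\<phi> b \<noteq> \<phi> a\<close>.\<close>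

lemma Phi_rint_iff:
  assumes a: "a \<in> Ob C" and x: "x \<in> cell \<sigma> a"
  shows "\<Phi> a x \<in> T.rint (OMap \<phi> a) \<longleftrightarrow> x \<in> S.rint a"
proof
  assume "\<Phi> a x \<in> T.rint (OMap \<phi> a)"
  then have "OMap \<phi> (poly_map C \<sigma> (real_inj C \<sigma> a x)) = OMap \<phi> a"
    using poly_map_Phi[OF a x] T.poly_map_rint[OF phi_Ob[OF a]] by simp
  then have "poly_map C \<sigma> (real_inj C \<sigma> a x) = a"
    using phi_inj_down[OF S.poly_map_le[OF a x] S.obj_le_refl[OF a]] by blast
  then show "x \<in> S.rint a" by (rule S.rint_if_poly_map[OF a x])
qed (rule Phi_rint[OF a])

text \<open>Otherwise \<open>\<Phi> a\<close> would be constant along the line through \<open>x\<close> and \<open>y\<close>, which contains a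
  boundary point of the cell; but boundary points and relative interior points have different
  images.\<close>

lemma Phi_inj_rint:
  assumes a: "a \<in> Ob C" and x: "x \<in> S.rint a" and y: "y \<in> S.rint a" and eq: "\<Phi> a x = \<Phi> a y"
  shows "x = y"
proof (rule ccontr)
  assume "x \<noteq> y"
  note xy = S.rintD[OF x] S.rintD[OF y]
  obtain t where t: "x + t *\<^sub>R (y - x) \<in> cell \<sigma> a" "x + t *\<^sub>R (y - x) \<notin> S.rint a"
    using line_meets_rel_frontier[OF S.cell_props(3,6)[OF a] xy \<open>x \<noteq> y\<close>] by blast
  have "\<Phi> a (x + t *\<^sub>R (y - x)) = \<Phi> a x"
    using Phi_line[OF a xy] eq by simp
  then show False
    using Phi_rint_iff[OF a t(1)] t(2) Phi_rint[OF a x] by simp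
qed

lemma Phi_inj:
  assumes a: "a \<in> Ob C" and x: "x \<in> cell \<sigma> a" and y: "y \<in> cell \<sigma> a" and eq: "\<Phi> a x = \<Phi> a y"
  shows "x = y"
proof -
  obtain b f z where b: "f \<in> hom_set C b a" "z \<in> S.rint b" "cell_map \<sigma> f z = x"
    using S.carrier_exists[OF a x] by blast
  obtain c g w where c: "g \<in> hom_set C c a" "w \<in> S.rint c" "cell_map \<sigma> g w = y"
    using S.carrier_exists[OF a y] by blast
  have fz: "\<Phi> a x = cell_map \<delta> (AMap \<phi> f) (\<Phi> b z)"
    using Phi_natural[OF b(1) S.rintD[OF b(2)]] b(3) by simp
  have gw: "\<Phi> a y = cell_map \<delta> (AMap \<phi> g) (\<Phi> c w)"
    using Phi_natural[OF c(1) S.rintD[OF c(2)]] c(3) by simp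
  note U = T.carrier_unique[OF phi_hom[OF b(1)] Phi_rint[OF S.hom_Ob(1)[OF b(1)] b(2)]
      phi_hom[OF c(1)] Phi_rint[OF S.hom_Ob(1)[OF c(1)] c(2)]]
  have "obj_le C b a" "obj_le C c a" using b(1) c(1) unfolding obj_le_def by blast+
  then have bc: "b = c" using phi_inj_down U(1) fz gw eq by simp
  then have "\<Phi> b z = \<Phi> b w" using U(3) fz gw eq by simp
  then have "z = w" using Phi_inj_rint[OF S.hom_Ob(1)[OF b(1)] b(2)] c(2) bc by simp
  moreover have "f = g" using S.hom_unique b(1) c(1) bc by blast
  ultimately show ?thesis using b(3) c(3) by simp
qed

text \<open>By induction over the face poset, the boundary of the target cell is in the image, since every
  face of the target cell comes from a face of the source cell. For an interior point \<open>y\<close>,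
  the line through \<open>y\<close> and the image \<open>c\<close> of an interior point has a boundary point, and
  therefore a second point of the image. So the preimage \<open>q\<close> of \<open>y\<close> is determined on a line in
  the source, and \<open>q\<close> is in the cell: if the segment from \<open>x\<close> to \<open>q\<close> met the boundary, its
  image, which is the segment from \<open>c\<close> to \<open>y\<close> in the relative interior, would contain the
  image of a boundary point. The argument covers bounded and unbounded cells alike.\<close>

lemma Phi_surj:
  assumes "a \<in> Ob C" "y \<in> cell \<delta> (OMap \<phi> a)"
  shows "\<exists>x\<in>cell \<sigma> a. \<Phi> a x = y"
  using assms
proof (induction "card {b. obj_le C b a}" arbitrary: a y rule: less_induct)
  case less
  note a = less.prems(1)
  let ?K = "cell \<sigma> a" and ?P = "cell \<delta> (OMap \<phi> a)" and ?R = "T.rint (OMap \<phi> a)"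
  note pa = phi_Ob[OF a]
  have boundary: "\<exists>x\<in>?K. \<Phi> a x = w" if w: "w \<in> ?P" "w \<notin> ?R" for w
  proof -
    obtain b' g v where g: "g \<in> hom_set D b' (OMap \<phi> a)" "v \<in> T.rint b'" "cell_map \<delta> g v = w"
      using T.carrier_exists[OF pa w(1)] by blast
    then have "obj_le D b' (OMap \<phi> a)" unfolding obj_le_def by blast
    then obtain b where b: "obj_le C b a" "OMap \<phi> b = b'" using phi_surj_down[OF a] by blast
    obtain f where f: "f \<in> hom_set C b a" using b(1) unfolding obj_le_def by blast
    have "b \<noteq> a"
    proof
      assume "b = a"
      then have b': "b' = OMap \<phi> a" using b(2) by simp
      then have "g = ident D (OMap \<phi> a)" using g(1) T.ident_hom[OF pa] T.hom_unique by blast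
      then have "w = v" using g(2,3) b' T.cell_map_ident[OF pa T.rintD] by simp
      then show False using g(2) b' w(2) by simp
    qed
    then have "\<not> obj_le C a b" using S.obj_le_antisym b(1) by blast
    then have "{c. obj_le C c b} \<subset> {c. obj_le C c a}"
      using S.obj_le_trans[OF _ b(1)] S.obj_le_refl[OF a] by blast
    moreover have "finite {c. obj_le C c a}"
      using S.finite_Ob S.obj_le_Ob(1) by (blast intro: finite_subset)
    ultimately have "card {c. obj_le C c b} < card {c. obj_le C c a}"
      by (rule psubset_card_mono[rotated])
    then obtain u where u: "u \<in> cell \<sigma> b" "\<Phi> b u = v"
      using less.hyps S.obj_le_Ob(1)[OF b(1)] T.rintD[OF g(2)] b(2) by blast
    have "AMap \<phi> f = g" using phi_hom[OF f] g(1) b(2) T.hom_unique by blast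
    then have "\<Phi> a (cell_map \<sigma> f u) = w" using Phi_natural[OF f u(1)] u(2) g(3) by simp
    then show ?thesis using S.cell_map_mem[OF f u(1)] by blast
  qed
  show ?case
  proof (cases "y \<in> ?R")
    case False
    then show ?thesis using boundary less.prems(2) by blast
  next
    case True
    obtain x where x: "x \<in> S.rint a" using S.rint_nonempty[OF a] by blast
    note xK = S.rintD[OF x]
    define c where "c = \<Phi> a x"
    have c: "c \<in> ?R" unfolding c_def using Phi_rint[OF a x] .
    show ?thesis
    proof (cases "c = y")
      case True
      then show ?thesis using xK c_def by blast
    next
      case False
      obtain s where s: "c + s *\<^sub>R (y - c) \<in> ?P" "c + s *\<^sub>R (y - c) \<notin> ?R"
        using line_meets_rel_frontier[OF T.cell_props(3,6)[OF pa] T.rintD[OF c] less.prems(2) False]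
        by blast
      obtain z where z: "z \<in> ?K" "\<Phi> a z = c + s *\<^sub>R (y - c)" using boundary[OF s] by blast
      have segR: "closed_segment c y \<subseteq> ?R"
        using c True convex_rel_interior[OF T.cell_props(4)[OF pa]] closed_segment_subset by blast
      \<comment> \<open>the preimage of y on the line through x and z\<close>
      define q where "q = x + (1 / s) *\<^sub>R (z - x)"
      have "s \<noteq> 0" using s(2) c by auto
      then have \<Phi>q: "\<Phi> a q = y"
        unfolding q_def Phi_line[OF a xK z(1)] z(2) c_def[symmetric] by simp
      have "q \<in> ?K"
      proof (rule ccontr)
        assume q: "q \<notin> ?K"
        have "q \<in> affine hull ?K"
          unfolding q_def using xK z(1)
          by (intro mem_affine_3_minus[OF affine_affine_hull]) (auto intro: hull_inc)
        then obtain w where w: "w \<in> closed_segment x q" "w \<in> ?K" "w \<notin> S.rint a"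
          using segment_meets_rel_frontier[OF S.cell_props(3)[OF a] xK _ q] by blast
        obtain u where u: "0 \<le> u" "u \<le> 1" "w = (1 - u) *\<^sub>R x + u *\<^sub>R q"
          using w(1) unfolding in_segment by blast
        have "w = x + (u / s) *\<^sub>R (z - x)" unfolding u(3) q_def by (simp add: algebra_simps)
        then have "\<Phi> a w = c + (u / s) *\<^sub>R (s *\<^sub>R (y - c))"
          using Phi_line[OF a xK z(1), of "u / s"] z(2) unfolding c_def[symmetric] by simp
        also have "\<dots> = (1 - u) *\<^sub>R c + u *\<^sub>R y"
          using \<open>s \<noteq> 0\<close> by (simp add: algebra_simps)
        finally have "\<Phi> a w = (1 - u) *\<^sub>R c + u *\<^sub>R y" .
        then have "\<Phi> a w \<in> closed_segment c y" using u(1,2) unfolding in_segment by blast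
        then show False using segR Phi_rint_iff[OF a w(2)] w(3) by blast
      qed
      then show ?thesis using \<Phi>q by blast
    qed
  qed
qed

lemma Phi_closed_image:
  assumes a: "a \<in> Ob C" and K: "closed K" "K \<subseteq> cell \<sigma> a"
  shows "closed (\<Phi> a ` K)"
proof (rule affine_on_closed_image[OF Phi_affine[OF a] subspace_span])
  show "inj_on (\<Phi> a) (span (lat \<sigma> a))"
    using affine_on_inj_extend[OF Phi_affine[OF a] S.cell_props(7)[OF a] subspace_span
        S.cell_props(4)[OF a] S.cell_props(5)[OF a]] Phi_inj[OF a] by (simp add: inj_on_def)
  show "K \<subseteq> span (lat \<sigma> a)" using K(2) S.cell_props(8)[OF a] by blast
qed (rule K(1))

section \<open>The fibre product square\<close>

abbreviation XS where "XS \<equiv> realization C \<sigma>"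
abbreviation XT where "XT \<equiv> realization D \<delta>"
abbreviation F where "F \<equiv> real_map C \<sigma> D \<delta> \<phi> \<Phi>"
abbreviation polyS where "polyS \<equiv> poly_map C \<sigma>"
abbreviation polyT where "polyT \<equiv> poly_map D \<delta>"

lemmas real_map_spec =
  theI'[OF real_map_unique_existence[OF S.complex T.complex morphism], folded real_map_def]

lemma continuous_F: "continuous_map XS XT F"
  using real_map_spec by blast

lemma F_real_inj:
  "a \<in> Ob C \<Longrightarrow> x \<in> cell \<sigma> a \<Longrightarrow> F (real_inj C \<sigma> a x) = real_inj D \<delta> (OMap \<phi> a) (\<Phi> a x)"
  using real_map_spec by blast

lemma F_topspace: "p \<in> topspace XS \<Longrightarrow> F p \<in> topspace XT"
  using continuous_F unfolding continuous_map_def by blast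

lemma poly_F:
  assumes "p \<in> topspace XS" shows "polyT (F p) = OMap \<phi> (polyS p)"
proof -
  obtain a x where a: "a \<in> Ob C" "x \<in> cell \<sigma> a" "p = real_inj C \<sigma> a x"
    using assms unfolding S.topspace_realization by blast
  then show ?thesis using poly_map_Phi F_real_inj by simp
qed

lemma F_inj:
  assumes p: "p \<in> topspace XS" and q: "q \<in> topspace XS" and eq: "F p = F q" "polyS p = polyS q"
  shows "p = q"
proof -
  obtain a x where a: "a \<in> Ob C" "x \<in> S.rint a" "p = real_inj C \<sigma> a x"
    using p S.point_exists by blast
  obtain b y where b: "b \<in> Ob C" "y \<in> S.rint b" "q = real_inj C \<sigma> b y"
    using q S.point_exists by blast
  have ab: "a = b" using eq(2) a b S.poly_map_rint by simp
  have y: "y \<in> cell \<sigma> a" using b(2) ab S.rintD by simp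
  note x = S.rintD[OF a(2)]
  have "real_inj D \<delta> (OMap \<phi> a) (\<Phi> a x) = real_inj D \<delta> (OMap \<phi> a) (\<Phi> a y)"
    using eq(1) F_real_inj[OF a(1) x] F_real_inj[OF a(1) y] a(3) b(3) ab by simp
  then have "\<Phi> a x = \<Phi> a y"
    using T.real_inj_inj[OF phi_Ob[OF a(1)] Phi_mem[OF a(1) x] Phi_mem[OF a(1) y]] by blast
  then show ?thesis using Phi_inj[OF a(1) x y] a(3) b(3) ab by simp
qed

text \<open>Existence part of the fibre product: over the stratum of \<open>\<phi> a\<close> the sheet of \<open>a\<close> is the bijection
  \<open>\<Phi> a\<close> of relative interiors.\<close>

lemma F_lift:
  assumes y: "y \<in> topspace XT" and a: "a \<in> Ob C" "polyT y = OMap \<phi> a"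
  obtains p where "p \<in> topspace XS" "F p = y" "polyS p = a"
proof -
  obtain b v where b: "b \<in> Ob D" "v \<in> T.rint b" "y = real_inj D \<delta> b v"
    using y T.point_exists by blast
  then have ba: "b = OMap \<phi> a" using a(2) T.poly_map_rint by simp
  have "v \<in> cell \<delta> (OMap \<phi> a)" using T.rintD[OF b(2)] ba by simp
  then obtain x where x: "x \<in> cell \<sigma> a" "\<Phi> a x = v" using Phi_surj[OF a(1)] by blast
  then have "x \<in> S.rint a" using Phi_rint_iff[OF a(1) x(1)] b(2) ba by simp
  then have "polyS (real_inj C \<sigma> a x) = a" using S.poly_map_rint[OF a(1)] by simp
  moreover have "F (real_inj C \<sigma> a x) = y" using F_real_inj[OF a(1) x(1)] x(2) b(3) ba by simp
  ultimately show ?thesis using that S.real_inj_in_topspace[OF a(1) x(1)] by blast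
qed

lemma continuous_phi: "continuous_map (poset_topology C) (poset_topology D) (OMap \<phi>)"
  unfolding continuous_map T.topspace_poset_topology S.topspace_poset_topology
proof (intro conjI allI impI)
  show "OMap \<phi> ` Ob C \<subseteq> Ob D" using phi_Ob by blast
  fix U assume U: "openin (poset_topology D) U"
  show "openin (poset_topology C) {x \<in> Ob C. OMap \<phi> x \<in> U}"
    unfolding openin_poset_topology
  proof (intro conjI ballI impI)
    fix a b assume "a \<in> {x \<in> Ob C. OMap \<phi> x \<in> U}" "b \<in> Ob C" "obj_le C a b"
    then show "b \<in> {x \<in> Ob C. OMap \<phi> x \<in> U}"
      using U phi_mono phi_Ob unfolding openin_poset_topology by blast
  qed blast
qed

text \<open>Openness of the comparison map to the fibre product. \<open>V\<close> is the complement of the images of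
  those parts of the cells around \<open>w\<close> that lie outside \<open>W\<close>. These images are closed, and
  they avoid \<open>F w\<close> because \<open>\<phi>\<close> is injective below every cell, so that each cell around \<open>w\<close>
  has \<open>w\<close> as its only point over \<open>F w\<close>.\<close>

lemma F_open_nbhd:
  assumes W: "openin XS W" and w: "w \<in> W"
  obtains V where "openin XT V" "F w \<in> V"
    "\<And>p. p \<in> topspace XS \<Longrightarrow> F p \<in> V \<Longrightarrow> obj_le C (polyS w) (polyS p) \<Longrightarrow> p \<in> W"
proof -
  have w': "w \<in> topspace XS" using openin_subset W w by blast
  let ?I = "{a \<in> Ob C. obj_le C (polyS w) a}"
  let ?K = "\<lambda>a. {x \<in> cell \<sigma> a. real_inj C \<sigma> a x \<notin> W}"
  let ?A = "\<lambda>a. real_inj D \<delta> (OMap \<phi> a) ` \<Phi> a ` ?K a"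
  define V where "V = topspace XT - (\<Union>a\<in>?I. ?A a)"
  have "closedin XT (?A a)" if "a \<in> ?I" for a
  proof -
    have a: "a \<in> Ob C" using that by blast
    have "closedin XS (topspace XS - W)" using W by blast
    then have "closed {x \<in> cell \<sigma> a. real_inj C \<sigma> a x \<in> topspace XS - W}"
      using S.closedin_realization a by blast
    moreover have "{x \<in> cell \<sigma> a. real_inj C \<sigma> a x \<in> topspace XS - W} = ?K a"
      using S.real_inj_in_topspace[OF a] by blast
    ultimately have "closed (?K a)" by simp
    then have "closed (\<Phi> a ` ?K a)" by (rule Phi_closed_image[OF a]) blast
    moreover have "\<Phi> a ` ?K a \<subseteq> cell \<delta> (OMap \<phi> a)" using Phi_mem[OF a] by blast
    ultimately show ?thesis using T.real_inj_closed_image[OF phi_Ob[OF a]] by blast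
  qed
  then have "closedin XT (\<Union>a\<in>?I. ?A a)"
    using S.finite_Ob by (intro closedin_Union) auto
  then have "openin XT V" unfolding V_def by (rule openin_diff[OF openin_topspace])
  moreover have "F w \<in> V"
  proof -
    have "F w \<notin> ?A a" if a: "a \<in> ?I" for a
    proof
      assume "F w \<in> ?A a"
      then obtain x where x: "x \<in> cell \<sigma> a" "real_inj C \<sigma> a x \<notin> W"
          "F w = real_inj D \<delta> (OMap \<phi> a) (\<Phi> a x)" by blast
      have aO: "a \<in> Ob C" using a by blast
      let ?p = "real_inj C \<sigma> a x"
      have p: "?p \<in> topspace XS" using S.real_inj_in_topspace[OF aO x(1)] .
      have Fp: "F w = F ?p" using F_real_inj[OF aO x(1)] x(3) by simp
      then have "OMap \<phi> (polyS w) = OMap \<phi> (polyS ?p)" using poly_F[OF p] poly_F[OF w'] by simp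
      then have "polyS w = polyS ?p"
        using phi_inj_down[OF _ S.poly_map_le[OF aO x(1)]] a by blast
      then have "w = ?p" using F_inj[OF w' p Fp] by blast
      then show False using w x(2) by blast
    qed
    then show ?thesis unfolding V_def using F_topspace[OF w'] by blast
  qed
  moreover have "p \<in> W" if p: "p \<in> topspace XS" "F p \<in> V" "obj_le C (polyS w) (polyS p)" for p
  proof (rule ccontr)
    assume pW: "p \<notin> W"
    have a: "polyS p \<in> Ob C" using S.poly_map_Ob[OF p(1)] .
    obtain x where x: "x \<in> cell \<sigma> (polyS p)" "p = real_inj C \<sigma> (polyS p) x"
      using S.poly_map_le_imp_in_cell[OF p(1) S.obj_le_refl[OF a]] by blast
    have "F p = real_inj D \<delta> (OMap \<phi> (polyS p)) (\<Phi> (polyS p) x)"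
      using F_real_inj[OF a x(1)] x(2) by simp
    moreover have "x \<in> ?K (polyS p)" using x pW by simp
    ultimately have "F p \<in> ?A (polyS p)" by blast
    moreover have "polyS p \<in> ?I" using a p(3) by blast
    ultimately show False using p(2) unfolding V_def by blast
  qed
  ultimately show ?thesis using that by blast
qed

theorem fibre_product:
  "fibre_product_square XS XT (poset_topology C) (poset_topology D) F polyS polyT (OMap \<phi>)"
  unfolding fibre_product_square_def
proof (intro conjI ballI)
  let ?P = "prod_topology XT (poset_topology C)" and ?E = "{(y, a). polyT y = OMap \<phi> a}"
  let ?h = "\<lambda>p. (F p, polyS p)"
  show "homeomorphic_map XS (subtopology ?P ?E) ?h"
  proof (rule bijective_open_imp_homeomorphic_map)
    have "continuous_map XS ?P ?h"
      using continuous_F S.continuous_poly_map by (simp add: continuous_map_paired)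
    then show "continuous_map XS (subtopology ?P ?E) ?h"
      using poly_F by (simp add: continuous_map_in_subtopology image_subset_iff)
    show "inj_on ?h (topspace XS)" using F_inj by (auto simp: inj_on_def)
    show "?h ` topspace XS = topspace (subtopology ?P ?E)"
    proof (intro equalityI subsetI)
      fix e assume "e \<in> ?h ` topspace XS"
      then show "e \<in> topspace (subtopology ?P ?E)"
        using F_topspace S.poly_map_Ob poly_F
        by (auto simp: S.topspace_poset_topology)
    next
      fix e assume "e \<in> topspace (subtopology ?P ?E)"
      then obtain y a where e: "e = (y, a)" "y \<in> topspace XT" "a \<in> Ob C" "polyT y = OMap \<phi> a"
        by (auto simp: S.topspace_poset_topology)
      then obtain p where "p \<in> topspace XS" "F p = y" "polyS p = a" using F_lift by blast
      then show "e \<in> ?h ` topspace XS" using e(1) by blast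
    qed
    show "open_map XS (subtopology ?P ?E) ?h"
      unfolding open_map_def
    proof (intro allI impI)
      fix W assume W: "openin XS W"
      have WS: "W \<subseteq> topspace XS" using W by (rule openin_subset)
      show "openin (subtopology ?P ?E) (?h ` W)"
        unfolding openin_subopen[of _ "?h ` W"]
      proof
        fix e assume "e \<in> ?h ` W"
        then obtain w where w: "w \<in> W" "e = ?h w" by blast
        obtain V where V: "openin XT V" "F w \<in> V"
          "\<And>p. p \<in> topspace XS \<Longrightarrow> F p \<in> V \<Longrightarrow> obj_le C (polyS w) (polyS p) \<Longrightarrow> p \<in> W"
          using F_open_nbhd[OF W w(1)] by blast
        let ?U = "{a \<in> Ob C. obj_le C (polyS w) a}"
        have "openin ?P (V \<times> ?U)"
          using V(1) S.openin_up_set by (simp add: openin_prod_Times_iff)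
        then have "openin (subtopology ?P ?E) (?E \<inter> V \<times> ?U)"
          by (simp add: openin_subtopology_Int2)
        moreover have "e \<in> ?E \<inter> V \<times> ?U"
          using w V(2) WS poly_F S.poly_map_Ob S.obj_le_refl by auto
        moreover have "?E \<inter> V \<times> ?U \<subseteq> ?h ` W"
        proof
          fix e' assume "e' \<in> ?E \<inter> V \<times> ?U"
          then obtain y a where e': "e' = (y, a)" "polyT y = OMap \<phi> a" "y \<in> V" "a \<in> Ob C"
              "obj_le C (polyS w) a" by blast
          have "y \<in> topspace XT" using e'(3) V(1) openin_subset by blast
          then obtain p where p: "p \<in> topspace XS" "F p = y" "polyS p = a"
            using F_lift e'(2,4) by blast
          then have "p \<in> W" using V(3) e'(3,5) by blast
          then show "e' \<in> ?h ` W" using p(2,3) e'(1) by blast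
        qed
        ultimately show "\<exists>U. openin (subtopology ?P ?E) U \<and> e \<in> U \<and> U \<subseteq> ?h ` W" by blast
      qed
    qed
  qed
qed (use continuous_F S.continuous_poly_map T.continuous_poly_map continuous_phi poly_F in auto)

end

section \<open>Degrees and the balancing condition\<close>

lemma connectedin_locally_constant:
  assumes U: "connectedin X U" and d: "\<And>n :: nat. openin X {x \<in> U. d x = n}"
  obtains n where "\<forall>x\<in>U. d x = n"
proof (cases "U = {}")
  case False
  then obtain y where y: "y \<in> U" by blast
  have UX: "U \<subseteq> topspace X" using U connectedin_subset_topspace by blast
  have "openin X {x \<in> U. d x \<noteq> d y}"
  proof -
    have "{x \<in> U. d x \<noteq> d y} = (\<Union>n\<in>- {d y}. {x \<in> U. d x = n})" by blast
    then show ?thesis using d by (metis (no_types, lifting) imageE openin_Union)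
  qed
  moreover note d[of "d y"]
  moreover have "U \<subseteq> {x \<in> U. d x = d y} \<union> {x \<in> U. d x \<noteq> d y}"
    "{x \<in> U. d x = d y} \<inter> {x \<in> U. d x \<noteq> d y} \<inter> U = {}" by blast+
  ultimately have "{x \<in> U. d x = d y} \<inter> U = {} \<or> {x \<in> U. d x \<noteq> d y} \<inter> U = {}"
    using U unfolding connectedin by blast
  then show ?thesis using that[of "d y"] y by blast
qed (use that in blast)

lemma clopen_connected_component:
  assumes S: "connectedin X S" "openin X S" "openin X (topspace X - S)" "S \<noteq> {}"
  shows "S \<in> connected_components_of X"
proof -
  obtain x where x: "x \<in> S" using S(4) by blast
  let ?C = "connected_component_of_set X x"
  have xX: "x \<in> topspace X" using x openin_subset[OF S(2)] by blast
  have SC: "S \<subseteq> ?C" by (rule connected_component_of_maximal[OF S(1) x])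
  have C: "connectedin X ?C" by (rule connectedin_connected_component_of)
  have CX: "?C \<subseteq> topspace X" by (rule connected_component_of_subset_topspace)
  have "S \<inter> (topspace X - S) \<inter> ?C = {}" "?C \<subseteq> S \<union> (topspace X - S)" using CX by blast+
  moreover have "S \<inter> ?C \<noteq> {}" using x SC by blast
  ultimately have "(topspace X - S) \<inter> ?C = {}"
    using C S(2,3) unfolding connectedin by blast
  then have "S = ?C" using SC CX by blast
  then show ?thesis using xX unfolding connected_components_of_def by blast
qed

context rational_complex
begin

lemma connectedin_with_least:
  assumes "S \<subseteq> Ob C" "a \<in> S" "\<And>s. s \<in> S \<Longrightarrow> obj_le C a s"
  shows "connectedin (poset_topology C) S"
  unfolding connectedin topspace_poset_topology
proof (intro conjI notI)
  assume "\<exists>E1 E2. openin (poset_topology C) E1 \<and> openin (poset_topology C) E2 \<and>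
    S \<subseteq> E1 \<union> E2 \<and> E1 \<inter> E2 \<inter> S = {} \<and> E1 \<inter> S \<noteq> {} \<and> E2 \<inter> S \<noteq> {}"
  then obtain E1 E2 where E: "openin (poset_topology C) E1" "openin (poset_topology C) E2"
    "S \<subseteq> E1 \<union> E2" "E1 \<inter> E2 \<inter> S = {}" "E1 \<inter> S \<noteq> {}" "E2 \<inter> S \<noteq> {}" by blast
  have up: "S \<subseteq> E" if "openin (poset_topology C) E" "a \<in> E" for E
    using that assms unfolding openin_poset_topology by blast
  have "a \<in> E1 \<or> a \<in> E2" using E(3) assms(2) by blast
  then show False using up[OF E(1)] up[OF E(2)] E(4-6) by blast
qed (rule assms(1))

definition maximal :: "'o set" where
  "maximal = {a \<in> Ob C. \<forall>b. obj_le C a b \<longrightarrow> b = a}"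

lemma maximal_above:
  assumes "a \<in> Ob C" obtains b where "b \<in> maximal" "obj_le C a b"
proof -
  have "\<exists>b\<in>maximal. obj_le C a b"
    using assms
  proof (induction "card {b. obj_le C a b}" arbitrary: a rule: less_induct)
    case less
    show ?case
    proof (cases "a \<in> maximal")
      case True
      then show ?thesis using obj_le_refl[OF less.prems] by blast
    next
      case False
      then obtain b where b: "obj_le C a b" "b \<noteq> a"
        using less.prems unfolding maximal_def by blast
      then have "\<not> obj_le C b a" using obj_le_antisym by blast
      then have "{c. obj_le C b c} \<subset> {c. obj_le C a c}"
        using obj_le_trans[OF b(1)] obj_le_refl[OF less.prems] by blast
      moreover have "finite {c. obj_le C a c}"
        using finite_Ob obj_le_Ob(2) by (blast intro: finite_subset)
      ultimately have "card {c. obj_le C b c} < card {c. obj_le C a c}"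
        by (rule psubset_card_mono[rotated])
      then obtain c where "c \<in> maximal" "obj_le C b c"
        using less.hyps obj_le_Ob(2)[OF b(1)] by blast
      then show ?thesis using obj_le_trans[OF b(1)] by blast
    qed
  qed
  then show ?thesis using that by blast
qed

lemma openin_maximal: "S \<subseteq> maximal \<Longrightarrow> openin (poset_topology C) S"
  unfolding openin_poset_topology maximal_def by blast

lemma stratum_dense:
  assumes U: "openin (realization C \<sigma>) U" "y \<in> U" and b: "obj_le C (poly_map C \<sigma> y) b"
  shows "\<exists>z\<in>rint b. real_inj C \<sigma> b z \<in> U"
proof -
  have "y \<in> topspace (realization C \<sigma>)" using U openin_subset by blast
  then obtain x where x: "x \<in> cell \<sigma> b" "y = real_inj C \<sigma> b x"
    using poly_map_le_imp_in_cell b by blast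
  have bO: "b \<in> Ob C" using obj_le_Ob(2) b by blast
  have "openin (top_of_set (cell \<sigma> b)) {x \<in> cell \<sigma> b. real_inj C \<sigma> b x \<in> U}"
    using U(1) bO unfolding openin_realization by blast
  then obtain O' where O': "open O'" "{x \<in> cell \<sigma> b. real_inj C \<sigma> b x \<in> U} = cell \<sigma> b \<inter> O'"
    unfolding openin_open by blast
  have "x \<in> closure (rint b)"
    using convex_closure_rel_interior[OF cell_props(4)[OF bO]] x(1) closure_subset by blast
  moreover have "x \<in> O'" using O'(2) x U(2) by blast
  ultimately obtain z where z: "z \<in> rint b" "z \<in> O'"
    using open_Int_closure_eq_empty[OF O'(1)] by blast
  then have "z \<in> {x \<in> cell \<sigma> b. real_inj C \<sigma> b x \<in> U}" using O'(2) rintD by blast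
  then show ?thesis using z(1) by blast
qed

end

context down_iso_morphism
begin

text \<open>The combinatorial content of the degree condition: the index of \<open>a\<close> is distributed among the
  elements over \<open>b\<close> that lie above \<open>a\<close>.\<close>

definition balanced :: "('o \<Rightarrow> nat) \<Rightarrow> bool" where
  "balanced m \<longleftrightarrow> (\<forall>a\<in>Ob C. \<forall>b. obj_le D (OMap \<phi> a) b \<longrightarrow>
     (\<Sum>c | obj_le C a c \<and> OMap \<phi> c = b. m c) = m a)"

text \<open>Every element over \<open>b'\<close> lies above exactly one element over \<open>b\<close>, so \<open>G\<close> is the disjoint
  union of the sets that occur in the balancing condition.\<close>

lemma balanced_sum:
  assumes m: "balanced m" and b: "obj_le D b b'"
    and A: "A \<subseteq> Ob C" "\<And>a. a \<in> A \<Longrightarrow> OMap \<phi> a = b"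
    and G: "G \<subseteq> Ob C" "\<And>c. c \<in> G \<Longrightarrow> OMap \<phi> c = b'"
    and AG: "\<And>a c. OMap \<phi> a = b \<Longrightarrow> OMap \<phi> c = b' \<Longrightarrow> obj_le C a c \<Longrightarrow> c \<in> G \<longleftrightarrow> a \<in> A"
  shows "sum m A = sum m G"
proof -
  let ?up = "\<lambda>a. {c. obj_le C a c \<and> OMap \<phi> c = b'}"
  have G_eq: "G = (\<Union>a\<in>A. ?up a)"
  proof (intro equalityI subsetI)
    fix c assume c: "c \<in> G"
    then obtain a where "obj_le C a c" "OMap \<phi> a = b"
      using phi_surj_down[of c b] b G by blast
    then show "c \<in> (\<Union>a\<in>A. ?up a)" using AG[of a c] c G(2) by blast
  next
    fix c assume "c \<in> (\<Union>a\<in>A. ?up a)"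
    then show "c \<in> G" using AG A(2) by blast
  qed
  have fin: "finite (?up a)" for a
    using S.finite_Ob S.obj_le_Ob(2) by (blast intro: finite_subset)
  have "sum m G = (\<Sum>a\<in>A. sum m (?up a))"
    unfolding G_eq
  proof (rule sum.UNION_disjoint)
    show "finite A" using A(1) S.finite_Ob finite_subset by blast
    show "\<forall>a\<in>A. \<forall>a'\<in>A. a \<noteq> a' \<longrightarrow> ?up a \<inter> ?up a' = {}"
    proof (intro ballI impI)
      fix a a' assume aa: "a \<in> A" "a' \<in> A" "a \<noteq> a'"
      have False if "c \<in> ?up a" "c \<in> ?up a'" for c
        using phi_inj_down[of a c a'] that A(2)[OF aa(1)] A(2)[OF aa(2)] aa(3) by auto
      then show "?up a \<inter> ?up a' = {}" by blast
    qed
  qed (use fin in blast)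
  moreover have "sum m (?up a) = m a" if "a \<in> A" for a
    using m b A that unfolding balanced_def by blast
  ultimately show ?thesis by simp
qed

end

text \<open>What the face posets and the realizations have in common, so that both can be treated at once:
  \<open>X\<close> is the pullback of \<open>\<phi>\<close> along a stratification \<open>h\<close> of \<open>Y\<close> by the target poset. The last
  assumption says that a function on an open set \<open>U\<close> is locally constant if it agrees on any two
  points of \<open>U\<close> that can be linked by a connected subset of \<open>U\<close> which lifts to \<open>X\<close> from every
  point above the end in the larger stratum. In the posets two comparable elements are
  linked; in the realizations the ends of a short segment into the relative interior of a
  cell are linked.\<close>

locale stratified_cover = down_iso_morphism C \<sigma> D \<delta> \<phi> \<Phi>
  for C :: "('o, 'm) cat" and \<sigma> :: "('o, 'm, 'v::euclidean_space) poly_ftr"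
    and D :: "('p, 'n) cat" and \<delta> :: "('p, 'n, 'w::euclidean_space) poly_ftr"
    and \<phi> :: "('o, 'm, 'p, 'n) ftr" and \<Phi> :: "'o \<Rightarrow> 'v \<Rightarrow> 'w" +
  fixes X :: "'x topology" and Y :: "'y topology"
    and f :: "'x \<Rightarrow> 'y" and g :: "'x \<Rightarrow> 'o" and h :: "'y \<Rightarrow> 'p"
  assumes cont: "continuous_map X Y f" "continuous_map X (poset_topology C) g"
      "continuous_map Y (poset_topology D) h"
    and square: "\<And>p. p \<in> topspace X \<Longrightarrow> h (f p) = OMap \<phi> (g p)"
    and pair_inj: "\<And>p q. p \<in> topspace X \<Longrightarrow> q \<in> topspace X \<Longrightarrow> f p = f q \<Longrightarrow> g p = g q \<Longrightarrow> p = q"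
    and pair_surj: "\<And>y a. y \<in> topspace Y \<Longrightarrow> a \<in> Ob C \<Longrightarrow> h y = OMap \<phi> a \<Longrightarrow>
      \<exists>p\<in>topspace X. f p = y \<and> g p = a"
    and pair_open: "\<And>W w. openin X W \<Longrightarrow> w \<in> W \<Longrightarrow>
      \<exists>V. openin Y V \<and> f w \<in> V \<and>
        (\<forall>p\<in>topspace X. f p \<in> V \<longrightarrow> obj_le C (g w) (g p) \<longrightarrow> p \<in> W)"
    and star_connected: "\<And>a. a \<in> Ob C \<Longrightarrow> connectedin X {p \<in> topspace X. obj_le C a (g p)}"
      "\<And>b. b \<in> Ob D \<Longrightarrow> connectedin Y {y \<in> topspace Y. obj_le D b (h y)}"
    and stratum_nonempty: "\<And>b. b \<in> Ob D \<Longrightarrow> \<exists>y\<in>topspace Y. h y = b"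
    and strata_dense: "\<And>U y b. openin Y U \<Longrightarrow> y \<in> U \<Longrightarrow> obj_le D (h y) b \<Longrightarrow> \<exists>y'\<in>U. h y' = b"
    and linked_open: "\<And>U (d :: 'y \<Rightarrow> nat) n. openin Y U \<Longrightarrow>
      (\<And>y y'. y \<in> U \<Longrightarrow> y' \<in> U \<Longrightarrow> obj_le D (h y) (h y') \<Longrightarrow>
        (\<And>p. p \<in> topspace X \<Longrightarrow> f p = y' \<Longrightarrow>
           \<exists>q A. f q = y \<and> obj_le C (g q) (g p) \<and> connectedin X A \<and> p \<in> A \<and> q \<in> A \<and> f ` A \<subseteq> U) \<Longrightarrow>
        d y = d y') \<Longrightarrow>
      openin Y {y \<in> U. d y = n}"
begin

lemma g_Ob: "p \<in> topspace X \<Longrightarrow> g p \<in> Ob C"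
  using cont(2) S.topspace_poset_topology unfolding continuous_map_def by blast

lemma h_Ob: "y \<in> topspace Y \<Longrightarrow> h y \<in> Ob D"
  using cont(3) T.topspace_poset_topology unfolding continuous_map_def by blast

lemma f_topspace: "p \<in> topspace X \<Longrightarrow> f p \<in> topspace Y"
  using cont(1) unfolding continuous_map_def by blast

lemma open_g: "openin (poset_topology C) A \<Longrightarrow> openin X {p \<in> topspace X. g p \<in> A}"
  using cont(2) unfolding continuous_map by blast

lemma open_h: "openin (poset_topology D) A \<Longrightarrow> openin Y {y \<in> topspace Y. h y \<in> A}"
  using cont(3) unfolding continuous_map by blast

lemma fibre_deg_eq:
  assumes "V \<subseteq> topspace X"
  shows "fibre_deg f (m \<circ> g) V y = sum m (g ` {x. x \<in> V \<and> f x = y})"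
proof -
  have "inj_on g {x. x \<in> V \<and> f x = y}"
  proof (rule inj_onI)
    fix p q assume "p \<in> {x. x \<in> V \<and> f x = y}" "q \<in> {x. x \<in> V \<and> f x = y}" "g p = g q"
    then show "p = q" using pair_inj[of p q] assms by auto
  qed
  then show ?thesis unfolding fibre_deg_def by (simp add: sum.reindex)
qed

lemma fibre_finite: "finite {x \<in> topspace X. f x = y}"
proof (rule inj_on_finite[OF _ _ S.finite_Ob])
  show "inj_on g {x \<in> topspace X. f x = y}"
  proof (rule inj_onI)
    fix p q assume "p \<in> {x \<in> topspace X. f x = y}" "q \<in> {x \<in> topspace X. f x = y}" "g p = g q"
    then show "p = q" using pair_inj[of p q] by simp
  qed
  show "g ` {x \<in> topspace X. f x = y} \<subseteq> Ob C" using g_Ob by blast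
qed

text \<open>If \<open>\<phi> a\<close> is maximal then so is \<open>a\<close>, because \<open>\<phi>\<close> is injective below every element. Its stratum
  is therefore open.\<close>

lemma homeomorphic_over_maximal:
  assumes a: "a \<in> Ob C" "OMap \<phi> a \<in> T.maximal"
  shows "openin X {x \<in> topspace X. g x = a}"
    and "homeomorphic_map (subtopology X {x \<in> topspace X. g x = a})
      (subtopology Y {y \<in> topspace Y. h y = OMap \<phi> a}) f"
proof -
  let ?V = "{x \<in> topspace X. g x = a}" and ?U = "{y \<in> topspace Y. h y = OMap \<phi> a}"
  have "b = a" if "obj_le C a b" for b
    using phi_mono[OF that] a(2) phi_inj_down[OF S.obj_le_refl[OF S.obj_le_Ob(2)[OF that]] that]
    unfolding T.maximal_def by auto
  then have "{a} \<subseteq> S.maximal" using a(1) unfolding S.maximal_def by blast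
  then have "openin X {x \<in> topspace X. g x \<in> {a}}"
    by (intro open_g S.openin_maximal)
  then show V: "openin X ?V" by simp
  have "openin Y {y \<in> topspace Y. h y \<in> {OMap \<phi> a}}"
    using a(2) by (intro open_h T.openin_maximal) blast
  then have U: "openin Y ?U" by simp
  have fV: "f ` ?V = ?U"
  proof (intro equalityI subsetI)
    fix y assume "y \<in> f ` ?V" then show "y \<in> ?U" using f_topspace square by auto
  next
    fix y assume "y \<in> ?U"
    then obtain p where "p \<in> topspace X" "f p = y" "g p = a" using pair_surj[of y a] a(1) by auto
    then show "y \<in> f ` ?V" by blast
  qed
  show "homeomorphic_map (subtopology X ?V) (subtopology Y ?U) f"
  proof (rule bijective_open_imp_homeomorphic_map)
    show "continuous_map (subtopology X ?V) (subtopology Y ?U) f"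
      using continuous_map_from_subtopology[OF cont(1)] fV
      by (auto simp: continuous_map_in_subtopology)
    show "f ` topspace (subtopology X ?V) = topspace (subtopology Y ?U)"
      using fV by (simp add: Int_absorb1)
    show "inj_on f (topspace (subtopology X ?V))"
    proof (rule inj_onI)
      fix p q assume "p \<in> topspace (subtopology X ?V)" "q \<in> topspace (subtopology X ?V)" "f p = f q"
      then show "p = q" using pair_inj[of p q] by simp
    qed
    show "open_map (subtopology X ?V) (subtopology Y ?U) f"
      unfolding open_map_def
    proof (intro allI impI)
      fix W assume "openin (subtopology X ?V) W"
      then have W: "openin X W" "W \<subseteq> ?V" using openin_open_subtopology[OF V] by auto
      show "openin (subtopology Y ?U) (f ` W)"
        unfolding openin_subopen[of _ "f ` W"]
      proof
        fix y assume "y \<in> f ` W"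
        then obtain w where w: "w \<in> W" "y = f w" by blast
        obtain N where N: "openin Y N" "f w \<in> N"
            "\<forall>p\<in>topspace X. f p \<in> N \<longrightarrow> obj_le C (g w) (g p) \<longrightarrow> p \<in> W"
          using pair_open[OF W(1) w(1)] by blast
        have ga: "g w = a" using w W(2) by blast
        have "N \<inter> ?U \<subseteq> f ` W"
        proof
          fix y' assume y': "y' \<in> N \<inter> ?U"
          then have "y' \<in> f ` ?V" unfolding fV by blast
          then obtain p where p: "p \<in> topspace X" "f p = y'" "g p = a" by blast
          then have "p \<in> W" using N(3) y' ga S.obj_le_refl[OF a(1)] by simp
          then show "y' \<in> f ` W" using p(2) by blast
        qed
        moreover have "openin (subtopology Y ?U) (N \<inter> ?U)"
          using N(1) by (rule openin_subtopology_Int)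
        moreover have "f w \<in> f ` ?V" using w W(2) by blast
        then have "y \<in> N \<inter> ?U" using w(2) N(2) unfolding fV by simp
        ultimately show "\<exists>N. openin (subtopology Y ?U) N \<and> y \<in> N \<and> N \<subseteq> f ` W" by blast
      qed
    qed
  qed
qed

text \<open>Consequently being a branched cover imposes no condition at all: the complement of the maximal
  strata always serves as branch locus. The sheets over a maximal stratum are the strata of
  the elements in the fibre of \<open>\<phi>\<close>.\<close>

lemma branched_cover: "is_branched_cover X Y f {y \<in> topspace Y. h y \<notin> T.maximal}"
proof -
  let ?B = "{y \<in> topspace Y. h y \<notin> T.maximal}" and ?M = "{y \<in> topspace Y. h y \<in> T.maximal}"
  have M: "topspace Y - ?B = ?M" by blast
  have openM: "openin Y ?M" by (intro open_h T.openin_maximal) blast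
  let ?P = "{x \<in> topspace X. f x \<in> ?M}"
  have "closedin Y ?B" unfolding closedin_def M using openM by blast
  moreover have "Y closure_of ?M = topspace Y"
  proof (intro equalityI subsetI)
    fix y assume y: "y \<in> topspace Y"
    obtain b where b: "b \<in> T.maximal" "obj_le D (h y) b" using T.maximal_above[OF h_Ob[OF y]] by blast
    have "\<exists>y'. y' \<in> ?M \<and> y' \<in> U" if U: "y \<in> U \<and> openin Y U" for U
      using strata_dense[of U y b] U b openin_subset by blast
    then show "y \<in> Y closure_of ?M" using y unfolding in_closure_of by blast
  qed (simp add: in_closure_of)
  moreover have "is_cover (subtopology X ?P) (subtopology Y ?M) f"
    unfolding is_cover_def
  proof (intro conjI ballI)
    show "continuous_map (subtopology X ?P) (subtopology Y ?M) f"
      using continuous_map_from_subtopology[OF cont(1)]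
      by (auto simp: continuous_map_in_subtopology)
    fix y assume "y \<in> topspace (subtopology Y ?M)"
    then have y: "y \<in> topspace Y" "h y \<in> T.maximal" by auto
    let ?U = "{y' \<in> topspace Y. h y' = h y}" and ?I = "{a \<in> Ob C. OMap \<phi> a = h y}"
    let ?V = "\<lambda>a. {x \<in> topspace X. g x = a}"
    have "openin Y {y' \<in> topspace Y. h y' \<in> {h y}}"
      using y(2) by (intro open_h T.openin_maximal) blast
    then have "openin Y ?U" by simp
    moreover have UM: "?U \<subseteq> ?M" using y by auto
    ultimately have U: "openin (subtopology Y ?M) ?U"
      using openM by (simp add: openin_open_subtopology)
    have PX: "topspace (subtopology X ?P) = ?P" by auto
    have cover: "\<Union>(?V ` ?I) = {x \<in> topspace (subtopology X ?P). f x \<in> ?U}"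
      unfolding PX using square f_topspace g_Ob y by auto
    have disj: "pairwise disjnt (?V ` ?I)"
      by (auto simp: pairwise_def disjnt_def)
    have "openin (subtopology X ?P) V \<and>
        homeomorphic_map (subtopology (subtopology X ?P) V) (subtopology (subtopology Y ?M) ?U) f"
      if V: "V \<in> ?V ` ?I" for V
    proof -
      obtain a where a: "a \<in> Ob C" "OMap \<phi> a = h y" "V = ?V a" using V by blast
      note H = homeomorphic_over_maximal[OF a(1)]
      have VP: "V \<subseteq> ?P" unfolding a(3) using square f_topspace a(2) y(2) by auto
      have "openin X V" unfolding a(3) using H(1) a(2) y(2) by simp
      then have "openin (subtopology X ?P) (?P \<inter> V)" by (rule openin_subtopology_Int2)
      then have "openin (subtopology X ?P) V" using VP by (simp add: Int_absorb1)
      moreover have "homeomorphic_map (subtopology X V) (subtopology Y ?U) f"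
        unfolding a(3) using H(2) a(2) y(2) by simp
      ultimately show ?thesis
        using VP UM by (simp add: subtopology_subtopology Int_absorb1)
    qed
    then show "\<exists>U \<V>. openin (subtopology Y ?M) U \<and> y \<in> U \<and>
        \<Union> \<V> = {x \<in> topspace (subtopology X ?P). f x \<in> U} \<and> pairwise disjnt \<V> \<and>
        (\<forall>V\<in>\<V>. openin (subtopology X ?P) V \<and>
          homeomorphic_map (subtopology (subtopology X ?P) V) (subtopology (subtopology Y ?M) U) f)"
      using U cover disj y(1) by (intro exI[of _ ?U] exI[of _ "?V ` ?I"]) blast
  qed
  ultimately show ?thesis
    unfolding is_branched_cover_def M using cont(1) by blast
qed

text \<open>The ends of a linked pair that lie over each other in \<open>X\<close> belong to the same component, so the
  degrees at the two ends are sums of the index map related as in \<open>balanced_sum\<close>.\<close>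

lemma degree_constant_if_balanced:
  assumes m: "balanced m" and U: "openin Y U" "connectedin Y U"
    and V: "V \<in> connected_components_of (subtopology X {x \<in> topspace X. f x \<in> U})"
  shows "\<exists>d. \<forall>y\<in>U. fibre_deg f (m \<circ> g) V y = d"
proof -
  let ?P = "{x \<in> topspace X. f x \<in> U}" and ?deg = "fibre_deg f (m \<circ> g) V"
  have UY: "U \<subseteq> topspace Y" using U(1) by (rule openin_subset)
  have VP: "V \<subseteq> ?P" using connected_components_of_subset[OF V] by auto
  then have VX: "V \<subseteq> topspace X" by blast
  have "?deg y = ?deg y'"
    if y: "y \<in> U" "y' \<in> U" "obj_le D (h y) (h y')"
      and link: "\<And>p. p \<in> topspace X \<Longrightarrow> f p = y' \<Longrightarrow>
        \<exists>q A. f q = y \<and> obj_le C (g q) (g p) \<and> connectedin X A \<and> p \<in> A \<and> q \<in> A \<and> f ` A \<subseteq> U"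
    for y y'
    unfolding fibre_deg_eq[OF VX]
  proof (rule balanced_sum[OF m y(3)])
    let ?A = "\<lambda>y. g ` {x. x \<in> V \<and> f x = y}"
    show "?A y \<subseteq> Ob C" "?A y' \<subseteq> Ob C" using g_Ob VX by blast+
    show "OMap \<phi> a = h y" if "a \<in> ?A y" for a using that square VX by auto
    show "OMap \<phi> a = h y'" if "a \<in> ?A y'" for a using that square VX by auto
    fix a c assume a: "OMap \<phi> a = h y" and c: "OMap \<phi> c = h y'" and ac: "obj_le C a c"
    obtain p where p: "p \<in> topspace X" "f p = y'" "g p = c"
      using pair_surj[of y' c] y(2) UY c S.obj_le_Ob(2)[OF ac] by auto
    obtain q A where q: "f q = y" "obj_le C (g q) (g p)" "connectedin X A" "p \<in> A" "q \<in> A" "f ` A \<subseteq> U"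
      using link[OF p(1,2)] by blast
    have qX: "q \<in> topspace X" using connectedin_subset_topspace[OF q(3)] q(5) by blast
    have "OMap \<phi> (g q) = OMap \<phi> a" using square[OF qX] q(1) a by simp
    then have gq: "g q = a" using phi_inj_down q(2) p(3) ac by blast
    have "A \<subseteq> ?P" using q(6) connectedin_subset_topspace[OF q(3)] by blast
    then have "connectedin (subtopology X ?P) A" using q(3) by (simp add: connectedin_subtopology)
    then have "\<not> disjnt V A \<Longrightarrow> A \<subseteq> V" using connected_components_of_maximal[OF V] by blast
    then have pq: "p \<in> V \<longleftrightarrow> q \<in> V" using q(4,5) unfolding disjnt_def by blast
    have "c \<in> ?A y' \<longleftrightarrow> p \<in> V"
    proof
      assume "c \<in> ?A y'"
      then obtain x where "x \<in> V" "f x = y'" "g x = c" by blast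
      then show "p \<in> V" using pair_inj[of x p] p VX by auto
    qed (use p in blast)
    moreover have "a \<in> ?A y \<longleftrightarrow> q \<in> V"
    proof
      assume "a \<in> ?A y"
      then obtain x where "x \<in> V" "f x = y" "g x = a" by blast
      then show "q \<in> V" using pair_inj[of x q] qX q(1) gq VX by auto
    qed (use q(1) gq in blast)
    ultimately show "c \<in> ?A y' \<longleftrightarrow> a \<in> ?A y" using pq by simp
  qed
  then have "openin Y {y \<in> U. ?deg y = n}" for n by (rule linked_open[OF U(1)])
  then obtain n where "\<forall>y\<in>U. ?deg y = n" using connectedin_locally_constant[OF U(2)] by blast
  then show ?thesis by blast
qed

text \<open>The degree condition for the open star of \<open>\<phi> a\<close> and its component, the open star of \<open>a\<close>: over
  the stratum of \<open>\<phi> a\<close> the degree is \<open>m a\<close>, over the stratum of \<open>b\<close> it is the sum in the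
  balancing condition.\<close>

lemma balanced_if_degree_constant:
  assumes deg: "\<And>U V. openin Y U \<Longrightarrow> connectedin Y U \<Longrightarrow>
      V \<in> connected_components_of (subtopology X {x \<in> topspace X. f x \<in> U}) \<Longrightarrow>
      \<exists>d. \<forall>y\<in>U. fibre_deg f (m \<circ> g) V y = d"
  shows "balanced m"
  unfolding balanced_def
proof (intro ballI allI impI)
  fix a b assume a: "a \<in> Ob C" and b: "obj_le D (OMap \<phi> a) b"
  let ?U = "{y \<in> topspace Y. obj_le D (OMap \<phi> a) (h y)}" and ?V = "{x \<in> topspace X. obj_le C a (g x)}"
  let ?P = "{x \<in> topspace X. f x \<in> ?U}"
  have VX: "?V \<subseteq> topspace X" by blast
  have V_iff: "x \<in> ?V \<longleftrightarrow> obj_le C a (g x)" if "x \<in> topspace X" for x using that by blast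
  have "openin Y {y \<in> topspace Y. h y \<in> {c \<in> Ob D. obj_le D (OMap \<phi> a) c}}"
    by (rule open_h[OF T.openin_up_set])
  moreover have "{y \<in> topspace Y. h y \<in> {c \<in> Ob D. obj_le D (OMap \<phi> a) c}} = ?U" using h_Ob by blast
  ultimately have U: "openin Y ?U" by simp
  have VP: "?V \<subseteq> ?P" using f_topspace square phi_mono by auto
  have "openin X {x \<in> topspace X. g x \<in> {c \<in> Ob C. obj_le C a c}}"
    by (rule open_g[OF S.openin_up_set])
  moreover have "{x \<in> topspace X. g x \<in> {c \<in> Ob C. obj_le C a c}} = ?V" using g_Ob by blast
  ultimately have V: "openin X ?V" by simp
  \<comment> \<open>above the star of the image, the sheets are the stars of the other points of the fibre\<close>
  let ?N = "{c \<in> Ob C. obj_le D (OMap \<phi> a) (OMap \<phi> c) \<and> \<not> obj_le C a c}"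
  have "openin (poset_topology C) ?N"
    unfolding openin_poset_topology
  proof (intro conjI ballI impI)
    fix c c' assume c: "c \<in> ?N" and c': "c' \<in> Ob C" "obj_le C c c'"
    obtain a' where a': "obj_le C a' c" "OMap \<phi> a' = OMap \<phi> a"
      using phi_surj_down[of c "OMap \<phi> a"] c by blast
    have "\<not> obj_le C a c'"
    proof
      assume "obj_le C a c'"
      then have "a' = a" using phi_inj_down[OF S.obj_le_trans[OF a'(1) c'(2)]] a'(2) by blast
      then show False using a'(1) c by blast
    qed
    then show "c' \<in> ?N" using c c' T.obj_le_trans phi_mono by blast
  qed blast
  then have "openin X {x \<in> topspace X. g x \<in> ?N}" by (rule open_g)
  moreover have "{x \<in> topspace X. g x \<in> ?N} = ?P - ?V" using square f_topspace g_Ob by auto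
  ultimately have N: "openin X (?P - ?V)" by simp
  have PX: "topspace (subtopology X ?P) = ?P" by auto
  obtain y0 where y0: "y0 \<in> topspace Y" "h y0 = OMap \<phi> a" using stratum_nonempty[OF phi_Ob[OF a]] by blast
  obtain y1 where y1: "y1 \<in> topspace Y" "h y1 = b" using stratum_nonempty[OF T.obj_le_Ob(2)[OF b]] by blast
  obtain p0 where p0: "p0 \<in> topspace X" "f p0 = y0" "g p0 = a" using pair_surj[OF y0(1) a y0(2)] by blast
  have "?V \<in> connected_components_of (subtopology X ?P)"
  proof (rule clopen_connected_component)
    show "connectedin (subtopology X ?P) ?V"
      using star_connected(1)[OF a] VP by (simp add: connectedin_subtopology)
    have "openin (subtopology X ?P) (?P \<inter> ?V)" "openin (subtopology X ?P) (?P \<inter> (?P - ?V))"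
      by (rule openin_subtopology_Int2[OF V], rule openin_subtopology_Int2[OF N])
    moreover have "?P \<inter> ?V = ?V" "?P \<inter> (?P - ?V) = ?P - ?V" using VP by blast+
    ultimately show "openin (subtopology X ?P) ?V"
      "openin (subtopology X ?P) (topspace (subtopology X ?P) - ?V)"
      unfolding PX by simp_all
    show "?V \<noteq> {}" using p0 S.obj_le_refl[OF a] by blast
  qed
  then obtain d where d: "\<forall>y\<in>?U. fibre_deg f (m \<circ> g) ?V y = d"
    using deg[OF U star_connected(2)[OF phi_Ob[OF a]]] by blast
  have "g ` {x. x \<in> ?V \<and> f x = y0} = {a}"
  proof (intro equalityI subsetI)
    fix c assume "c \<in> g ` {x. x \<in> ?V \<and> f x = y0}"
    then obtain x where x: "x \<in> topspace X" "obj_le C a (g x)" "f x = y0" "c = g x" by blast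
    have "OMap \<phi> (g x) = OMap \<phi> a" using square[OF x(1)] x(3) y0(2) by simp
    then have "g x = a"
      using phi_inj_down[OF S.obj_le_refl[OF S.obj_le_Ob(2)[OF x(2)]] x(2)] by blast
    then show "c \<in> {a}" using x(4) by blast
  next
    fix c assume "c \<in> {a}"
    then show "c \<in> g ` {x. x \<in> ?V \<and> f x = y0}" using p0 S.obj_le_refl[OF a] by blast
  qed
  moreover have "g ` {x. x \<in> ?V \<and> f x = y1} = {c. obj_le C a c \<and> OMap \<phi> c = b}"
  proof (intro equalityI subsetI)
    fix c assume "c \<in> {c. obj_le C a c \<and> OMap \<phi> c = b}"
    then have c: "obj_le C a c" "OMap \<phi> c = b" by blast+
    then obtain p where "p \<in> topspace X" "f p = y1" "g p = c"
      using pair_surj[OF y1(1) S.obj_le_Ob(2)[OF c(1)]] y1(2) by auto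
    then show "c \<in> g ` {x. x \<in> ?V \<and> f x = y1}" using c(1) by blast
  next
    fix c assume "c \<in> g ` {x. x \<in> ?V \<and> f x = y1}"
    then show "c \<in> {c. obj_le C a c \<and> OMap \<phi> c = b}" using square y1(2) by auto
  qed
  moreover have "y0 \<in> ?U" "y1 \<in> ?U" using y0 y1 b T.obj_le_refl[OF phi_Ob[OF a]] by auto
  then have "fibre_deg f (m \<circ> g) ?V y1 = fibre_deg f (m \<circ> g) ?V y0" using d by simp
  ultimately show "(\<Sum>c | obj_le C a c \<and> OMap \<phi> c = b. m c) = m a"
    unfolding fibre_deg_eq[OF VX] by simp
qed

theorem indexed_branched_cover_iff_balanced:
  assumes "\<forall>a\<in>Ob C. m a \<ge> 1"
  shows "indexed_branched_cover X Y f (m \<circ> g) \<longleftrightarrow> balanced m"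
proof
  assume "indexed_branched_cover X Y f (m \<circ> g)"
  then show "balanced m"
    unfolding indexed_branched_cover_def by (intro balanced_if_degree_constant) blast
next
  assume m: "balanced m"
  show "indexed_branched_cover X Y f (m \<circ> g)"
    unfolding indexed_branched_cover_def
  proof (intro conjI allI impI ballI)
    show "\<exists>B. is_branched_cover X Y f B" using branched_cover by blast
    show "finite {x \<in> topspace X. f x = y}" for y by (rule fibre_finite)
    show "(m \<circ> g) x \<ge> 1" if "x \<in> topspace X" for x using assms g_Ob[OF that] by simp
  qed (use degree_constant_if_balanced[OF m] in blast)
qed

end

context down_iso_morphism
begin

section \<open>Face posets and realizations as stratified covers\<close>

lemma posets_stratified:
  "stratified_cover C \<sigma> D \<delta> \<phi> \<Phi> (poset_topology C) (poset_topology D) (OMap \<phi>) id id"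
proof (unfold_locales, unfold S.topspace_poset_topology T.topspace_poset_topology id_apply)
  show "continuous_map (poset_topology C) (poset_topology D) (OMap \<phi>)" by (rule continuous_phi)
  show "continuous_map (poset_topology C) (poset_topology C) (\<lambda>x. x)"
    "continuous_map (poset_topology D) (poset_topology D) (\<lambda>x. x)" by simp_all
  fix W w assume W: "openin (poset_topology C) W" "w \<in> W"
  have w: "w \<in> Ob C" using W unfolding openin_poset_topology by blast
  have "openin (poset_topology D) {b \<in> Ob D. obj_le D (OMap \<phi> w) b}" by (rule T.openin_up_set)
  moreover have "OMap \<phi> w \<in> {b \<in> Ob D. obj_le D (OMap \<phi> w) b}"
    using phi_Ob[OF w] T.obj_le_refl by blast
  ultimately show "\<exists>V. openin (poset_topology D) V \<and> OMap \<phi> w \<in> V \<and>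
      (\<forall>p\<in>Ob C. OMap \<phi> p \<in> V \<longrightarrow> obj_le C w p \<longrightarrow> p \<in> W)"
    using W unfolding openin_poset_topology[of C] by blast
next
  fix a assume "a \<in> Ob C"
  then show "connectedin (poset_topology C) {p \<in> Ob C. obj_le C a p}"
    using S.obj_le_refl by (intro S.connectedin_with_least[of _ a]) auto
next
  fix b assume "b \<in> Ob D"
  then show "connectedin (poset_topology D) {y \<in> Ob D. obj_le D b y}"
    using T.obj_le_refl by (intro T.connectedin_with_least[of _ b]) auto
next
  fix U y b assume "openin (poset_topology D) U" "y \<in> U" "obj_le D y b"
  then show "\<exists>y'\<in>U. y' = b" using T.obj_le_Ob(2) unfolding openin_poset_topology by blast
next
  fix U and d :: "'p \<Rightarrow> nat" and n
  assume U: "openin (poset_topology D) U"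
    and d: "\<And>y y'. y \<in> U \<Longrightarrow> y' \<in> U \<Longrightarrow> obj_le D y y' \<Longrightarrow>
        (\<And>p. p \<in> Ob C \<Longrightarrow> OMap \<phi> p = y' \<Longrightarrow>
           \<exists>q A. OMap \<phi> q = y \<and> obj_le C q p \<and> connectedin (poset_topology C) A \<and>
             p \<in> A \<and> q \<in> A \<and> OMap \<phi> ` A \<subseteq> U) \<Longrightarrow>
        d y = d y'"
  have eq: "d y = d y'" if y: "y \<in> U" "y' \<in> U" "obj_le D y y'" for y y'
  proof (rule d[OF y])
    fix p assume p: "p \<in> Ob C" "OMap \<phi> p = y'"
    then obtain q where q: "obj_le C q p" "OMap \<phi> q = y" using phi_surj_down[of p y] y(3) by blast
    have "connectedin (poset_topology C) {q, p}"
      using q(1) S.obj_le_refl S.obj_le_Ob by (intro S.connectedin_with_least[of _ q]) auto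
    then show "\<exists>q A. OMap \<phi> q = y \<and> obj_le C q p \<and> connectedin (poset_topology C) A \<and>
             p \<in> A \<and> q \<in> A \<and> OMap \<phi> ` A \<subseteq> U"
      using q y(1,2) p(2) by (intro exI[of _ q] exI[of _ "{q, p}"]) auto
  qed
  show "openin (poset_topology D) {y \<in> U. d y = n}"
    unfolding openin_poset_topology
  proof (intro conjI ballI impI)
    show "{y \<in> U. d y = n} \<subseteq> Ob D" using U unfolding openin_poset_topology by blast
    fix a b assume a: "a \<in> {y \<in> U. d y = n}" and b: "b \<in> Ob D" "obj_le D a b"
    have "b \<in> U" using U a b unfolding openin_poset_topology by blast
    then show "b \<in> {y \<in> U. d y = n}" using eq[of a b] a b(2) by simp
  qed
qed auto

text \<open>The segment is lifted by the affine bijection of the cell that carries \<open>p\<close>.\<close>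

lemma F_segment_lift:
  assumes b: "b \<in> Ob D" and c: "c \<in> T.rint b" and x: "x \<in> cell \<delta> b"
    and p: "p \<in> topspace XS" "F p = real_inj D \<delta> b c"
  obtains q A where "F q = real_inj D \<delta> b x" "obj_le C (polyS q) (polyS p)"
    "connectedin XS A" "p \<in> A" "q \<in> A" "F ` A \<subseteq> real_inj D \<delta> b ` closed_segment c x"
proof -
  define a where "a = polyS p"
  have a: "a \<in> Ob C" unfolding a_def by (rule S.poly_map_Ob[OF p(1)])
  have ab: "OMap \<phi> a = b"
    using poly_F[OF p(1)] p(2) T.poly_map_rint[OF b c] unfolding a_def by simp
  obtain u where u: "u \<in> cell \<sigma> a" "p = real_inj C \<sigma> a u"
    using S.poly_map_le_imp_in_cell[OF p(1), of a] S.obj_le_refl[OF a] unfolding a_def by blast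
  obtain v where v: "v \<in> cell \<sigma> a" "\<Phi> a v = x" using Phi_surj[OF a] x ab by blast
  have "real_inj D \<delta> b (\<Phi> a u) = real_inj D \<delta> b c" using F_real_inj[OF a u(1)] u(2) p(2) ab by simp
  moreover have "\<Phi> a u \<in> cell \<delta> b" using Phi_mem[OF a u(1)] ab by simp
  ultimately have Pu: "\<Phi> a u = c" using T.real_inj_inj[OF b _ T.rintD[OF c]] by blast
  have seg: "closed_segment u v \<subseteq> cell \<sigma> a"
    using closed_segment_subset[OF u(1) v(1) S.cell_props(4)[OF a]] .
  have "F (real_inj C \<sigma> a w) \<in> real_inj D \<delta> b ` closed_segment c x" if w: "w \<in> closed_segment u v" for w
  proof -
    obtain t where t: "0 \<le> t" "t \<le> 1" "w = (1 - t) *\<^sub>R u + t *\<^sub>R v"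
      using w unfolding in_segment by blast
    then have "w = u + t *\<^sub>R (v - u)" by (simp add: algebra_simps)
    then have "\<Phi> a w = c + t *\<^sub>R (x - c)" using Phi_line[OF a u(1) v(1)] Pu v(2) by simp
    then have "\<Phi> a w \<in> closed_segment c x"
      unfolding in_segment using t(1,2) by (intro exI[of _ t]) (simp add: algebra_simps)
    then show ?thesis using F_real_inj[OF a] seg w ab by auto
  qed
  then have "F ` real_inj C \<sigma> a ` closed_segment u v \<subseteq> real_inj D \<delta> b ` closed_segment c x" by blast
  moreover have "connectedin XS (real_inj C \<sigma> a ` closed_segment u v)"
    using S.connectedin_real_inj[OF a seg] by simp
  moreover have "F (real_inj C \<sigma> a v) = real_inj D \<delta> b x" using F_real_inj[OF a v(1)] v(2) ab by simp
  moreover have "obj_le C (polyS (real_inj C \<sigma> a v)) (polyS p)"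
    using S.poly_map_le[OF a v(1)] unfolding a_def .
  ultimately show ?thesis
    using that[of "real_inj C \<sigma> a v" "real_inj C \<sigma> a ` closed_segment u v"] u(2) by blast
qed

lemma realizations_stratified:
  "stratified_cover C \<sigma> D \<delta> \<phi> \<Phi> XS XT F polyS polyT"
proof
  show "continuous_map XS XT F" by (rule continuous_F)
  show "continuous_map XS (poset_topology C) polyS" by (rule S.continuous_poly_map)
  show "continuous_map XT (poset_topology D) polyT" by (rule T.continuous_poly_map)
  show "polyT (F p) = OMap \<phi> (polyS p)" if "p \<in> topspace XS" for p using that by (rule poly_F)
  show "p = q" if "p \<in> topspace XS" "q \<in> topspace XS" "F p = F q" "polyS p = polyS q" for p q
    using that by (rule F_inj)
  show "\<exists>p\<in>topspace XS. F p = y \<and> polyS p = a"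
    if "y \<in> topspace XT" "a \<in> Ob C" "polyT y = OMap \<phi> a" for y a
    using F_lift[OF that] by blast
  show "\<exists>V. openin XT V \<and> F w \<in> V \<and>
      (\<forall>p\<in>topspace XS. F p \<in> V \<longrightarrow> obj_le C (polyS w) (polyS p) \<longrightarrow> p \<in> W)"
    if "openin XS W" "w \<in> W" for W w
    using F_open_nbhd[OF that] by metis
  show "connectedin XS {p \<in> topspace XS. obj_le C a (polyS p)}" if "a \<in> Ob C" for a
    using that by (rule S.connectedin_star)
  show "connectedin XT {y \<in> topspace XT. obj_le D b (polyT y)}" if "b \<in> Ob D" for b
    using that by (rule T.connectedin_star)
  show "\<exists>y\<in>topspace XT. polyT y = b" if b: "b \<in> Ob D" for b
    using T.rint_nonempty[OF b] T.poly_map_rint[OF b] T.real_inj_in_topspace[OF b T.rintD] by blast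
  show "\<exists>y'\<in>U. polyT y' = b" if U: "openin XT U" "y \<in> U" "obj_le D (polyT y) b" for U y b
    using T.stratum_dense[OF U] T.poly_map_rint[OF T.obj_le_Ob(2)[OF U(3)]] by blast
next
  fix U and d :: "('p \<times> 'w) set \<Rightarrow> nat" and n
  assume U: "openin XT U"
    and d: "\<And>y y'. y \<in> U \<Longrightarrow> y' \<in> U \<Longrightarrow> obj_le D (polyT y) (polyT y') \<Longrightarrow>
        (\<And>p. p \<in> topspace XS \<Longrightarrow> F p = y' \<Longrightarrow>
           \<exists>q A. F q = y \<and> obj_le C (polyS q) (polyS p) \<and> connectedin XS A \<and>
             p \<in> A \<and> q \<in> A \<and> F ` A \<subseteq> U) \<Longrightarrow>
        d y = d y'"
  show "openin XT {y \<in> U. d y = n}"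
    unfolding T.openin_realization
  proof (intro conjI ballI)
    show "{y \<in> U. d y = n} \<subseteq> topspace XT" using openin_subset[OF U] by blast
    fix b assume b: "b \<in> Ob D"
    let ?W = "{x \<in> cell \<delta> b. real_inj D \<delta> b x \<in> U}"
    let ?Wn = "{x \<in> cell \<delta> b. real_inj D \<delta> b x \<in> {y \<in> U. d y = n}}"
    have W: "openin (top_of_set (cell \<delta> b)) ?W" using U b unfolding T.openin_realization by blast
    show "openin (top_of_set (cell \<delta> b)) ?Wn"
      unfolding openin_contains_ball
    proof (intro conjI ballI)
      fix x assume x: "x \<in> ?Wn"
      then have "x \<in> ?W" by blast
      then obtain r where r: "r > 0" "ball x r \<inter> cell \<delta> b \<subseteq> ?W"
        using W unfolding openin_contains_ball by blast
      have "x \<in> closure (T.rint b)"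
        using convex_closure_rel_interior[OF T.cell_props(4)[OF b]] x closure_subset by blast
      then \<comment> \<open>all points of the cell near \<open>x\<close> are compared with one relative interior point \<open>c\<close>\<close>
 obtain c where c: "c \<in> T.rint b" "c \<in> ball x r"
        using r(1) unfolding closure_approachable mem_ball by (metis dist_commute)
      have eq: "d (real_inj D \<delta> b x') = d (real_inj D \<delta> b c)" if x': "x' \<in> ball x r \<inter> cell \<delta> b" for x'
      proof (rule d)
        have xc: "x' \<in> cell \<delta> b" using x' by blast
        have "convex (ball x r \<inter> cell \<delta> b)" using T.cell_props(4)[OF b] by (intro convex_Int convex_ball)
        moreover have cB: "c \<in> ball x r \<inter> cell \<delta> b" using c T.rintD by blast
        ultimately have "closed_segment c x' \<subseteq> ball x r \<inter> cell \<delta> b"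
          using closed_segment_subset[OF cB x'] by blast
        then have segU: "real_inj D \<delta> b ` closed_segment c x' \<subseteq> U" using r(2) by blast
        show "real_inj D \<delta> b x' \<in> U" "real_inj D \<delta> b c \<in> U" using r(2) x' cB by blast+
        show "obj_le D (polyT (real_inj D \<delta> b x')) (polyT (real_inj D \<delta> b c))"
          using T.poly_map_le[OF b xc] T.poly_map_rint[OF b c(1)] by simp
        fix p assume p: "p \<in> topspace XS" "F p = real_inj D \<delta> b c"
        obtain q A where "F q = real_inj D \<delta> b x'" "obj_le C (polyS q) (polyS p)"
            "connectedin XS A" "p \<in> A" "q \<in> A" "F ` A \<subseteq> real_inj D \<delta> b ` closed_segment c x'"
          by (rule F_segment_lift[OF b c(1) xc p])
        then show "\<exists>q A. F q = real_inj D \<delta> b x' \<and> obj_le C (polyS q) (polyS p) \<and>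
            connectedin XS A \<and> p \<in> A \<and> q \<in> A \<and> F ` A \<subseteq> U"
          using segU by blast
      qed
      have "ball x r \<inter> cell \<delta> b \<subseteq> ?Wn"
      proof
        fix x' assume x': "x' \<in> ball x r \<inter> cell \<delta> b"
        have "x \<in> ball x r \<inter> cell \<delta> b" using r(1) x by simp
        then have "d (real_inj D \<delta> b x') = n" using eq[OF x'] eq[of x] x by simp
        then show "x' \<in> ?Wn" using r(2) x' by blast
      qed
      then show "\<exists>e>0. ball x e \<inter> cell \<delta> b \<subseteq> ?Wn" using r(1) by blast
    qed blast
  qed
qed

lemma indexed_branched_cover_iff:
  assumes "\<forall>a\<in>Ob C. m a \<ge> 1"
  shows "indexed_branched_cover (poset_topology C) (poset_topology D) (OMap \<phi>) m \<longleftrightarrow>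
    indexed_branched_cover XS XT F (m \<circ> polyS)"
  using stratified_cover.indexed_branched_cover_iff_balanced[OF posets_stratified assms]
    stratified_cover.indexed_branched_cover_iff_balanced[OF realizations_stratified assms] by simp

end

theorem mainTheorem1:
  fixes \<Sigma> :: "('o, 'm) cat" and \<sigma> :: "('o, 'm, 'v::euclidean_space) poly_ftr"
    and \<Delta> :: "('p, 'n) cat" and \<delta> :: "('p, 'n, 'w::euclidean_space) poly_ftr"
    and \<phi> :: "('o, 'm, 'p, 'n) ftr" and \<Phi> :: "'o \<Rightarrow> 'v \<Rightarrow> 'w"
    and m :: "'o \<Rightarrow> nat"
  assumes "polyhedral_complex \<Sigma> \<sigma>"
    and "polyhedral_complex \<Delta> \<delta>"
    and "complex_morphism \<Sigma> \<sigma> \<Delta> \<delta> \<phi> \<Phi>"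
    and "\<forall>\<alpha> \<in> Ob \<Sigma>. m \<alpha> \<ge> 1"
    and "\<forall>\<alpha> \<in> Ob \<Sigma>. poset_iso_on_down \<Sigma> \<Delta> (OMap \<phi>) \<alpha>"
  shows "fibre_product_square
           (realization \<Sigma> \<sigma>) (realization \<Delta> \<delta>) (poset_topology \<Sigma>) (poset_topology \<Delta>)
           (real_map \<Sigma> \<sigma> \<Delta> \<delta> \<phi> \<Phi>) (poly_map \<Sigma> \<sigma>) (poly_map \<Delta> \<delta>) (OMap \<phi>)
         \<and>
         (indexed_branched_cover (poset_topology \<Sigma>) (poset_topology \<Delta>) (OMap \<phi>) m
          \<longleftrightarrow>
          indexed_branched_cover (realization \<Sigma> \<sigma>) (realization \<Delta> \<delta>)
            (real_map \<Sigma> \<sigma> \<Delta> \<delta> \<phi> \<Phi>) (m \<circ> poly_map \<Sigma> \<sigma>))"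
proof -
  interpret down_iso_morphism \<Sigma> \<sigma> \<Delta> \<delta> \<phi> \<Phi>
    using assms(1-3,5)
    by (intro down_iso_morphism.intro rational_complex.intro down_iso_morphism_axioms.intro)
  show ?thesis
    using fibre_product indexed_branched_cover_iff[OF assms(4)] by blast
qed

end
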